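(* Let $n\geq 1$ and let $\delta$ be a cardinal. Then $\delta$ is $C^{(n)}$-extendible if and only if $\delta$ is $\Sigma_{n+1}$-supercompact.
   Context: For $n<\omega$, $C^{(n)}$ denotes the class of ordinals $\alpha$ such that $V_\alpha\prec_{\Sigma_n} V$. A cardinal $\kappa$ is $C^{(n)}$-extendible if for every $\lambda>\kappa$ there is an ordinal $\mu$ and an elementary embedding $j:V_\lambda\to V_\mu$ with critical point $\kappa$, $j(\kappa)>\lambda$ and $j(\kappa)\in C^{(n)}$. For $n\geq 1$ and $\lambda>\delta$ with $\lambda\in C^{(n)}$, $\delta$ is $\lambda$-$\Sigma_n$-supercompact if for every $a\in V_\lambda$ there exist ordinals $\bar\delta<\bar\lambda<\delta$, some $\bar a\in V_{\bar\lambda}$ and an elementary embedding $j:V_{\bar\lambda}\to V_\lambda$ with critical point $\bar\delta$, $j(\bar\delta)=\delta$, $j(\bar a)=a$ and $\bar\lambda\in C^{(n)}$. The cardinal $\delta$ is $\Sigma_n$-supercompact if it is $\lambda$-$\Sigma_n$-supercompact for every $\lambda>\delta$ in $C^{(n)}$. *)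

theory Defs
  imports Main
begin

text \<open>
  The ambient universe \<open>V\<close> is an arbitrary first-order model of ZFC: a type \<open>'a\<close> with a binary
  relation, not assumed to be well-founded from outside. A statement proved for every such
  model, one natural number \<open>n\<close> at a time, is a theorem scheme of ZFC.

  There are two levels of syntax. The datatype \<open>fm\<close> below consists of the formulas of the
  metatheory; it is used for the axiom schemes and for elementarity between \<open>V\<^sub>\<alpha>\<close> and the proper
  class \<open>V\<close>. Elementarity of an embedding \<open>j : V\<^sub>\<lambda> \<rightarrow> V\<^sub>\<mu>\<close>, which is a set of the model, refers to
  formulas and satisfaction as coded inside the model.
\<close>

datatype fm = Mem nat nat | Eq nat nat | Neg fm | And fm fm | Ex nat fm

definition All :: "nat \<Rightarrow> fm \<Rightarrow> fm" where
  "All i p = Neg (Ex i (Neg p))"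

inductive delta0 :: "fm \<Rightarrow> bool" where
  "delta0 (Mem i j)"
| "delta0 (Eq i j)"
| "delta0 p \<Longrightarrow> delta0 (Neg p)"
| "delta0 p \<Longrightarrow> delta0 q \<Longrightarrow> delta0 (And p q)"
| "delta0 p \<Longrightarrow> i \<noteq> j \<Longrightarrow> delta0 (Ex i (And (Mem i j) p))"

inductive Sigma_fm :: "nat \<Rightarrow> fm \<Rightarrow> bool" and Pi_fm :: "nat \<Rightarrow> fm \<Rightarrow> bool" where
  "delta0 p \<Longrightarrow> Sigma_fm 0 p"
| "delta0 p \<Longrightarrow> Pi_fm 0 p"
| "Pi_fm n p \<Longrightarrow> Sigma_fm (Suc n) p"
| "Sigma_fm (Suc n) p \<Longrightarrow> Sigma_fm (Suc n) (Ex i p)"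
| "Sigma_fm n p \<Longrightarrow> Pi_fm (Suc n) p"
| "Pi_fm (Suc n) p \<Longrightarrow> Pi_fm (Suc n) (All i p)"

locale set_structure =
  fixes mem :: "'a \<Rightarrow> 'a \<Rightarrow> bool"  (infix "\<^bold>\<in>" 50)
begin

primrec sat :: "'a set \<Rightarrow> (nat \<Rightarrow> 'a) \<Rightarrow> fm \<Rightarrow> bool" where
  "sat A s (Mem i j) \<longleftrightarrow> s i \<^bold>\<in> s j"
| "sat A s (Eq i j) \<longleftrightarrow> s i = s j"
| "sat A s (Neg p) \<longleftrightarrow> \<not> sat A s p"
| "sat A s (And p q) \<longleftrightarrow> sat A s p \<and> sat A s q"
| "sat A s (Ex i p) \<longleftrightarrow> (\<exists>x\<in>A. sat A (s(i := x)) p)"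


subsection \<open>The axioms of ZFC\<close>

definition extensionality :: bool where
  "extensionality \<longleftrightarrow> (\<forall>x y. (\<forall>z. z \<^bold>\<in> x \<longleftrightarrow> z \<^bold>\<in> y) \<longrightarrow> x = y)"

definition foundation :: bool where
  "foundation \<longleftrightarrow> (\<forall>x. (\<exists>y. y \<^bold>\<in> x) \<longrightarrow> (\<exists>y. y \<^bold>\<in> x \<and> \<not> (\<exists>z. z \<^bold>\<in> x \<and> z \<^bold>\<in> y)))"

definition pairing :: bool where
  "pairing \<longleftrightarrow> (\<forall>a b. \<exists>x. \<forall>z. z \<^bold>\<in> x \<longleftrightarrow> z = a \<or> z = b)"

definition union :: bool where
  "union \<longleftrightarrow> (\<forall>x. \<exists>u. \<forall>z. z \<^bold>\<in> u \<longleftrightarrow> (\<exists>y. y \<^bold>\<in> x \<and> z \<^bold>\<in> y))"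

definition powerset :: bool where
  "powerset \<longleftrightarrow> (\<forall>x. \<exists>p. \<forall>z. z \<^bold>\<in> p \<longleftrightarrow> (\<forall>w. w \<^bold>\<in> z \<longrightarrow> w \<^bold>\<in> x))"

definition infinity :: bool where
  "infinity \<longleftrightarrow> (\<exists>x. (\<exists>e. e \<^bold>\<in> x \<and> (\<forall>z. \<not> z \<^bold>\<in> e)) \<and>
     (\<forall>y. y \<^bold>\<in> x \<longrightarrow> (\<exists>w. w \<^bold>\<in> x \<and> (\<forall>z. z \<^bold>\<in> w \<longleftrightarrow> z \<^bold>\<in> y \<or> z = y))))"

definition separation :: bool where
  "separation \<longleftrightarrow> (\<forall>p s x. \<exists>y. \<forall>z. z \<^bold>\<in> y \<longleftrightarrow> z \<^bold>\<in> x \<and> sat UNIV (s(0 := z)) p)"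

definition replacement :: bool where
  "replacement \<longleftrightarrow> (\<forall>p s x.
     (\<forall>u. u \<^bold>\<in> x \<longrightarrow> (\<exists>!v. sat UNIV (s(0 := u, 1 := v)) p)) \<longrightarrow>
     (\<exists>y. \<forall>v. v \<^bold>\<in> y \<longleftrightarrow> (\<exists>u. u \<^bold>\<in> x \<and> sat UNIV (s(0 := u, 1 := v)) p)))"

definition choice :: bool where
  "choice \<longleftrightarrow> (\<forall>x. (\<forall>y. y \<^bold>\<in> x \<longrightarrow> (\<exists>z. z \<^bold>\<in> y)) \<and>
       (\<forall>y y'. y \<^bold>\<in> x \<and> y' \<^bold>\<in> x \<and> y \<noteq> y' \<longrightarrow> \<not> (\<exists>z. z \<^bold>\<in> y \<and> z \<^bold>\<in> y')) \<longrightarrow>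
     (\<exists>c. \<forall>y. y \<^bold>\<in> x \<longrightarrow> (\<exists>!z. z \<^bold>\<in> y \<and> z \<^bold>\<in> c)))"

definition ZFC :: bool where
  "ZFC \<longleftrightarrow> extensionality \<and> foundation \<and> pairing \<and> union \<and> powerset \<and> infinity \<and>
     separation \<and> replacement \<and> choice"


subsection \<open>Sets of the model\<close>

text \<open>Meaningful only if the class \<open>P\<close> is a set of the model, as it is at every use below.\<close>

definition the_set :: "('a \<Rightarrow> bool) \<Rightarrow> 'a" where
  "the_set P = (THE x. \<forall>z. z \<^bold>\<in> x \<longleftrightarrow> P z)"

definition zero :: 'a where
  "zero = the_set (\<lambda>z. False)"

definition succ :: "'a \<Rightarrow> 'a" where
  "succ x = the_set (\<lambda>z. z \<^bold>\<in> x \<or> z = x)"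

primrec num :: "nat \<Rightarrow> 'a" where
  "num 0 = zero"
| "num (Suc k) = succ (num k)"

definition upair :: "'a \<Rightarrow> 'a \<Rightarrow> 'a" where
  "upair a b = the_set (\<lambda>z. z = a \<or> z = b)"

definition opair :: "'a \<Rightarrow> 'a \<Rightarrow> 'a" where
  "opair a b = upair (upair a a) (upair a b)"

definition is_fun :: "'a \<Rightarrow> 'a \<Rightarrow> bool" where
  "is_fun f A \<longleftrightarrow> (\<forall>z. z \<^bold>\<in> f \<longrightarrow> (\<exists>x y. x \<^bold>\<in> A \<and> z = opair x y)) \<and>
     (\<forall>x. x \<^bold>\<in> A \<longrightarrow> (\<exists>!y. opair x y \<^bold>\<in> f))"

definition app :: "'a \<Rightarrow> 'a \<Rightarrow> 'a" where
  "app f x = (THE y. opair x y \<^bold>\<in> f)"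

definition maps :: "'a \<Rightarrow> 'a \<Rightarrow> 'a \<Rightarrow> bool" where
  "maps f A B \<longleftrightarrow> is_fun f A \<and> (\<forall>x. x \<^bold>\<in> A \<longrightarrow> app f x \<^bold>\<in> B)"

definition transitive :: "'a \<Rightarrow> bool" where
  "transitive x \<longleftrightarrow> (\<forall>y z. y \<^bold>\<in> x \<and> z \<^bold>\<in> y \<longrightarrow> z \<^bold>\<in> x)"

definition Ord :: "'a \<Rightarrow> bool" where
  "Ord x \<longleftrightarrow> transitive x \<and> (\<forall>y. y \<^bold>\<in> x \<longrightarrow> transitive y)"

definition Card :: "'a \<Rightarrow> bool" where
  "Card \<kappa> \<longleftrightarrow> Ord \<kappa> \<and>
     \<not> (\<exists>\<alpha> f. \<alpha> \<^bold>\<in> \<kappa> \<and> maps f \<alpha> \<kappa> \<and> (\<forall>y. y \<^bold>\<in> \<kappa> \<longrightarrow> (\<exists>!x. x \<^bold>\<in> \<alpha> \<and> app f x = y)))"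

definition omega :: 'a where
  "omega = the_set (\<lambda>n. Ord n \<and> (\<forall>m. m \<^bold>\<in> succ n \<longrightarrow> m = zero \<or> (\<exists>k. m = succ k)))"

text \<open>The cumulative hierarchy, \<open>V\<^sub>\<beta> = \<Union>\<^sub>\<gamma>\<^sub><\<^sub>\<beta> Pow V\<^sub>\<gamma>\<close>.\<close>

definition Vset :: "'a \<Rightarrow> 'a" where
  "Vset \<alpha> = (THE x. \<exists>f. is_fun f (succ \<alpha>) \<and>
     (\<forall>\<beta>. \<beta> \<^bold>\<in> succ \<alpha> \<longrightarrow>
        (\<forall>z. z \<^bold>\<in> app f \<beta> \<longleftrightarrow> (\<exists>\<gamma>. \<gamma> \<^bold>\<in> \<beta> \<and> (\<forall>w. w \<^bold>\<in> z \<longrightarrow> w \<^bold>\<in> app f \<gamma>)))) \<and>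
     x = app f \<alpha>)"


subsection \<open>Satisfaction and elementary embeddings inside the model\<close>

text \<open>
  Formulas are coded by sets of the model, with variables indexed by the elements of \<open>omega\<close>;
  \<open>omega\<close>, and hence the collection of codes, may be nonstandard. Assignments in \<open>A\<close> are the
  functions from \<open>omega\<close> to \<open>A\<close> that belong to the model.
\<close>

definition cMem :: "'a \<Rightarrow> 'a \<Rightarrow> 'a" where "cMem i j = opair (num 0) (opair i j)"
definition cEq :: "'a \<Rightarrow> 'a \<Rightarrow> 'a" where "cEq i j = opair (num 1) (opair i j)"
definition cNeg :: "'a \<Rightarrow> 'a" where "cNeg p = opair (num 2) p"
definition cAnd :: "'a \<Rightarrow> 'a \<Rightarrow> 'a" where "cAnd p q = opair (num 3) (opair p q)"
definition cEx :: "'a \<Rightarrow> 'a \<Rightarrow> 'a" where "cEx i p = opair (num 4) (opair i p)"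

definition fm_closed :: "'a \<Rightarrow> bool" where
  "fm_closed X \<longleftrightarrow>
     (\<forall>i j. i \<^bold>\<in> omega \<and> j \<^bold>\<in> omega \<longrightarrow> cMem i j \<^bold>\<in> X \<and> cEq i j \<^bold>\<in> X) \<and>
     (\<forall>p. p \<^bold>\<in> X \<longrightarrow> cNeg p \<^bold>\<in> X) \<and>
     (\<forall>p q. p \<^bold>\<in> X \<and> q \<^bold>\<in> X \<longrightarrow> cAnd p q \<^bold>\<in> X) \<and>
     (\<forall>i p. i \<^bold>\<in> omega \<and> p \<^bold>\<in> X \<longrightarrow> cEx i p \<^bold>\<in> X)"

definition is_code :: "'a \<Rightarrow> bool" where
  "is_code p \<longleftrightarrow> (\<forall>X. fm_closed X \<longrightarrow> p \<^bold>\<in> X)"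

definition upd :: "'a \<Rightarrow> 'a \<Rightarrow> 'a \<Rightarrow> 'a" where
  "upd s i x = the_set (\<lambda>z. \<exists>k. k \<^bold>\<in> omega \<and> z = opair k (if k = i then x else app s k))"

text \<open>\<open>T\<close> obeys Tarski's truth definition for the structure \<open>(A, \<in>)\<close>.\<close>

definition truth_set :: "'a \<Rightarrow> 'a \<Rightarrow> bool" where
  "truth_set A T \<longleftrightarrow> (\<forall>s. maps s omega A \<longrightarrow>
     (\<forall>i j. i \<^bold>\<in> omega \<and> j \<^bold>\<in> omega \<longrightarrow>
        (opair (cMem i j) s \<^bold>\<in> T \<longleftrightarrow> app s i \<^bold>\<in> app s j) \<and>
        (opair (cEq i j) s \<^bold>\<in> T \<longleftrightarrow> app s i = app s j)) \<and>
     (\<forall>p. is_code p \<longrightarrow> (opair (cNeg p) s \<^bold>\<in> T \<longleftrightarrow> \<not> opair p s \<^bold>\<in> T)) \<and>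
     (\<forall>p q. is_code p \<and> is_code q \<longrightarrow>
        (opair (cAnd p q) s \<^bold>\<in> T \<longleftrightarrow> opair p s \<^bold>\<in> T \<and> opair q s \<^bold>\<in> T)) \<and>
     (\<forall>i p. i \<^bold>\<in> omega \<and> is_code p \<longrightarrow>
        (opair (cEx i p) s \<^bold>\<in> T \<longleftrightarrow> (\<exists>x. x \<^bold>\<in> A \<and> opair p (upd s i x) \<^bold>\<in> T))))"

definition models :: "'a \<Rightarrow> 'a \<Rightarrow> 'a \<Rightarrow> bool" where
  "models A p s \<longleftrightarrow> (\<exists>T. truth_set A T \<and> opair p s \<^bold>\<in> T)"

definition comp :: "'a \<Rightarrow> 'a \<Rightarrow> 'a" where
  "comp j s = the_set (\<lambda>z. \<exists>k. k \<^bold>\<in> omega \<and> z = opair k (app j (app s k)))"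

definition elem_emb :: "'a \<Rightarrow> 'a \<Rightarrow> 'a \<Rightarrow> bool" where
  "elem_emb j A B \<longleftrightarrow> maps j A B \<and>
     (\<forall>p s. is_code p \<and> maps s omega A \<longrightarrow> (models A p s \<longleftrightarrow> models B p (comp j s)))"

definition critical_point :: "'a \<Rightarrow> 'a \<Rightarrow> 'a \<Rightarrow> bool" where
  "critical_point j A \<kappa> \<longleftrightarrow> Ord \<kappa> \<and> \<kappa> \<^bold>\<in> A \<and> app j \<kappa> \<noteq> \<kappa> \<and>
     (\<forall>\<beta>. \<beta> \<^bold>\<in> \<kappa> \<longrightarrow> app j \<beta> = \<beta>)"


subsection \<open>The large cardinal notions\<close>

text \<open>
  \<open>C n \<alpha>\<close> says \<open>\<alpha> \<in> C\<^sup>(\<^sup>n\<^sup>)\<close>, that is \<open>V\<^sub>\<alpha> \<prec>\<^sub>\<Sigma>\<^sub>n V\<close>. Structures are nonempty, so \<open>V\<^sub>0\<close> is excluded.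
  As usual \<open>n\<close> is a number of the metatheory, and each \<open>C n\<close> is a class of the model.
\<close>

definition C :: "nat \<Rightarrow> 'a \<Rightarrow> bool" where
  "C n \<alpha> \<longleftrightarrow> Ord \<alpha> \<and> (\<exists>x. x \<^bold>\<in> Vset \<alpha>) \<and>
     (\<forall>p s. Sigma_fm n p \<and> (\<forall>i. s i \<^bold>\<in> Vset \<alpha>) \<longrightarrow>
        (sat {x. x \<^bold>\<in> Vset \<alpha>} s p \<longleftrightarrow> sat UNIV s p))"

definition C_extendible :: "nat \<Rightarrow> 'a \<Rightarrow> bool" where
  "C_extendible n \<kappa> \<longleftrightarrow> (\<forall>\<theta>. Ord \<theta> \<and> \<kappa> \<^bold>\<in> \<theta> \<longrightarrow>
     (\<exists>\<mu> j. Ord \<mu> \<and> elem_emb j (Vset \<theta>) (Vset \<mu>) \<and> critical_point j (Vset \<theta>) \<kappa> \<and>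
        \<theta> \<^bold>\<in> app j \<kappa> \<and> C n (app j \<kappa>)))"

definition supercompact_at :: "nat \<Rightarrow> 'a \<Rightarrow> 'a \<Rightarrow> bool" where
  "supercompact_at n \<theta> \<delta> \<longleftrightarrow> (\<forall>a. a \<^bold>\<in> Vset \<theta> \<longrightarrow>
     (\<exists>\<delta>' \<theta>' a' j. Ord \<delta>' \<and> Ord \<theta>' \<and> \<delta>' \<^bold>\<in> \<theta>' \<and> \<theta>' \<^bold>\<in> \<delta> \<and> a' \<^bold>\<in> Vset \<theta>' \<and>
        elem_emb j (Vset \<theta>') (Vset \<theta>) \<and> critical_point j (Vset \<theta>') \<delta>' \<and>
        app j \<delta>' = \<delta> \<and> app j a' = a \<and> C n \<theta>'))"

definition Sigma_supercompact :: "nat \<Rightarrow> 'a \<Rightarrow> bool" where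
  "Sigma_supercompact n \<delta> \<longleftrightarrow> (\<forall>\<theta>. \<delta> \<^bold>\<in> \<theta> \<and> C n \<theta> \<longrightarrow> supercompact_at n \<theta> \<delta>)"

end

end

theory Submission
  imports Defs
begin

text \<open>
  An extendibility embedding \<open>j : V\<^sub>\<mu> \<rightarrow> V\<^sub>\<theta>\<close> fixes \<open>V\<^sub>\<delta>\<close>, so \<open>V\<^sub>\<delta> \<prec> V\<^sub>j\<^sub>\<delta>\<close>, and letting \<open>\<mu>\<close> grow puts \<open>\<delta>\<close> into \<open>C\<^sup>(\<^sup>n\<^sup>+\<^sup>1\<^sup>)\<close>.
  For \<open>\<lambda> < \<mu>\<close> in \<open>C\<^sup>(\<^sup>n\<^sup>+\<^sup>1\<^sup>)\<close> the restriction of \<open>j\<close> to \<open>V\<^sub>\<lambda>\<close> shows inside \<open>V\<^sub>\<theta>\<close> that \<open>j \<delta>\<close> has a supercompactness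
  embedding into \<open>V\<^sub>j\<^sub>\<lambda>\<close>, whose domain is \<open>\<Sigma>\<^sub>n\<^sub>+\<^sub>1\<close>-correct from the point of view of \<open>V\<^sub>j\<^sub>\<delta>\<close>; pull this back along \<open>j\<close>.
  Conversely a \<open>\<Sigma>\<^sub>n\<^sub>+\<^sub>1\<close>-supercompact \<open>\<delta>\<close> is a limit of \<open>C\<^sup>(\<^sup>n\<^sup>+\<^sup>1\<^sup>)\<close>. For \<open>j : V\<^sub>\<theta>\<^sub>' \<rightarrow> V\<^sub>\<theta>\<close> with \<open>j \<alpha>' = \<alpha>\<close> the restriction of \<open>j\<close>
  to \<open>V\<^sub>\<alpha>\<^sub>'\<close> witnesses extendibility of \<open>\<delta>'\<close> at \<open>\<alpha>'\<close>, which is a \<open>\<Sigma>\<^sub>n\<^sub>+\<^sub>1\<close> statement and hence moves to \<open>\<delta>\<close> and \<open>\<alpha>\<close>.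

  Both arguments need \<open>C\<^sup>(\<^sup>n\<^sup>)\<close> to be definable by a single formula of low complexity, although it is given by infinitely
  many conditions. No universal \<open>\<Sigma>\<^sub>n\<close> formula is used: by induction on \<open>n\<close>, \<open>\<alpha> \<in> C\<^sup>(\<^sup>n\<^sup>+\<^sup>1\<^sup>)\<close> iff whatever holds, in the sense of
  satisfaction for internal codes, in some \<open>V\<^sub>\<beta>\<close> with \<open>\<beta> \<in> C\<^sup>(\<^sup>n\<^sup>)\<close> about parameters from \<open>V\<^sub>\<alpha>\<close> holds in such a \<open>V\<^sub>\<beta>\<close> with \<open>\<beta> < \<alpha>\<close>.
\<close>

section \<open>Formulas and definable relations\<close>

text \<open>Three obstacles shape the development. The model may be ill-founded and
  \<open>omega\<close> nonstandard, so every induction, collection or recursion carried out in it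
  needs a definable property. The calculus that supplies definability also yields, when run for
  Delta_n predicates, the complexity bounds. Formulas of the metatheory and codes of the model meet
  only in one direction, through \<open>code\<close>. A claim about all formulas becomes a single
  sentence only after being strengthened to all codes, nonstandard ones included. The target
  V_\<theta> of an extendibility embedding need not even be Sigma_1-correct, so along it only the
  existence of witnesses to Pi_1 statements is pulled back. Membership in \<open>C (n + 1)\<close>
  is too complex for this, whereas satisfaction of a fixed formula in V_(j \<delta>), a parameter,
  is Delta_1. The hypothesis n \<ge> 1 enters through Delta_2: both the function \<alpha> \<mapsto>
  V_\<alpha> and the relation of being an elementary embedding have this complexity, and so may
  occur in Sigma_(n+1) statements.\<close>

primrec vars :: "fm \<Rightarrow> nat set" where
  "vars (Mem i j) = {i, j}"
| "vars (Eq i j) = {i, j}"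
| "vars (Neg p) = vars p"
| "vars (And p q) = vars p \<union> vars q"
| "vars (Ex i p) = insert i (vars p)"

lemma finite_vars [simp]: "finite (vars p)"
  by (induction p) auto

lemma vars_bound: "\<exists>k. \<forall>i\<in>vars p. i < k"
  using finite_nat_set_iff_bounded[of "vars p"] by simp

text \<open>The bound variable is sent above every value of \<open>f\<close> on the variables of the
  formula, so nothing is captured even if \<open>f\<close> is not injective.\<close>

primrec ren :: "fm \<Rightarrow> (nat \<Rightarrow> nat) \<Rightarrow> fm" where
  "ren (Mem i j) f = Mem (f i) (f j)"
| "ren (Eq i j) f = Eq (f i) (f j)"
| "ren (Neg p) f = Neg (ren p f)"
| "ren (And p q) f = And (ren p f) (ren q f)"
| "ren (Ex i p) f = (let k = Suc (Max (f ` insert i (vars p))) in Ex k (ren p (f(i := k))))"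

lemma fresh_image: "v \<in> vars p \<Longrightarrow> f v \<noteq> Suc (Max (f ` insert i (vars p)))"
proof -
  assume "v \<in> vars p"
  then have "f v \<le> Max (f ` insert i (vars p))"
    by (intro Max_ge) auto
  then show ?thesis by simp
qed

lemma delta0_ren: "delta0 p \<Longrightarrow> delta0 (ren p f)"
proof (induction arbitrary: f rule: delta0.induct)
  case (5 p i j)
  let ?k = "Suc (Max (f ` insert i (vars (And (Mem i j) p))))"
  have "f j \<noteq> ?k" by (rule fresh_image) simp
  with 5 show ?case
    by (auto simp: Let_def intro!: delta0.intros)
qed (auto intro: delta0.intros)

lemma Sigma_Pi_ren:
  "(Sigma_fm n p \<longrightarrow> (\<forall>f. Sigma_fm n (ren p f))) \<and> (Pi_fm m q \<longrightarrow> (\<forall>f. Pi_fm m (ren q f)))"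
proof (induction rule: Sigma_fm_Pi_fm.induct)
  case (6 n p i)
  have "Pi_fm (Suc n) (Neg (Ex k (Neg (ren p f))))" for k f
    using Sigma_fm_Pi_fm.intros(6)[of n "ren p f" k] 6 by (simp add: All_def)
  then show ?case by (simp add: Let_def All_def)
qed (simp_all add: Let_def delta0_ren Sigma_fm_Pi_fm.intros)

lemma Pi_ren: "Pi_fm n p \<Longrightarrow> Pi_fm n (ren p f)"
  using Sigma_Pi_ren[of 0 undefined n p] by simp

context set_structure
begin

lemma sat_cong: "(\<And>i. i \<in> vars p \<Longrightarrow> s i = t i) \<Longrightarrow> sat A s p \<longleftrightarrow> sat A t p"
proof (induction p arbitrary: s t)
  case (Ex i p)
  have "sat A (s(i := x)) p \<longleftrightarrow> sat A (t(i := x)) p" for x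
    using Ex.prems by (intro Ex.IH) auto
  then show ?case by simp
next
  case (And p q)
  have "sat A s p \<longleftrightarrow> sat A t p" "sat A s q \<longleftrightarrow> sat A t q"
    by (rule And.IH(1), rule And.prems, simp) (rule And.IH(2), rule And.prems, simp)
  then show ?case by simp
next
  case (Neg p)
  have "sat A s p \<longleftrightarrow> sat A t p"
    by (rule Neg.IH, rule Neg.prems) simp
  then show ?case by simp
qed auto

lemma sat_ren: "sat A s (ren p f) \<longleftrightarrow> sat A (\<lambda>i. s (f i)) p"
proof (induction p arbitrary: s f)
  case (Ex i p)
  define k where "k = Suc (Max (f ` insert i (vars p)))"
  have "sat A (\<lambda>v. (s(k := x)) ((f(i := k)) v)) p \<longleftrightarrow> sat A ((\<lambda>v. s (f v))(i := x)) p" for x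
    using fresh_image[of _ p f i] by (intro sat_cong) (auto simp: k_def)
  then have "sat A s (Ex k (ren p (f(i := k)))) \<longleftrightarrow> sat A (\<lambda>v. s (f v)) (Ex i p)"
    by (simp only: Ex.IH sat.simps)
  then show ?case
    by (simp add: Let_def k_def)
qed auto

section \<open>Definability as a property of predicates on environments\<close>

text \<open>Relations are predicates of an environment \<open>e :: nat \<Rightarrow> 'a\<close> with variables as de Bruijn
  indices: \<open>case_nat x e\<close> pushes \<open>x\<close> in front of \<open>e\<close>. The wrapper \<open>inK\<close> gives closure rules for a variable
  class \<open>K\<close> a rigid head; with plain \<open>K P\<close> higher-order unification would match them everywhere.\<close>

definition inK :: "(((nat \<Rightarrow> 'a) \<Rightarrow> bool) \<Rightarrow> bool) \<Rightarrow> ((nat \<Rightarrow> 'a) \<Rightarrow> bool) \<Rightarrow> bool" where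
  "inK K P \<longleftrightarrow> K P"

text \<open>Definability with parameters: \<open>g\<close> decides for each variable whether it
  holds a parameter or reads a position of the environment.\<close>

definition Df :: "((nat \<Rightarrow> 'a) \<Rightarrow> bool) \<Rightarrow> bool" where
  "Df P \<longleftrightarrow> (\<exists>p g. \<forall>e. P e \<longleftrightarrow> sat UNIV (\<lambda>i. case g i of Inl c \<Rightarrow> c | Inr k \<Rightarrow> e k) p)"

text \<open>The closure properties common to definability and to Delta_n for positive n. In the last
  clause \<open>T\<close> is the graph of a total function: a quantifier over its unique value can
  be read as existential or as universal, hence does not raise the complexity.\<close>

definition good :: "(((nat \<Rightarrow> 'a) \<Rightarrow> bool) \<Rightarrow> bool) \<Rightarrow> bool" where
  "good K \<longleftrightarrow>
     (\<forall>i j. inK K (\<lambda>e. e i \<^bold>\<in> e j)) \<and> (\<forall>i j. inK K (\<lambda>e. e i = e j)) \<and>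
     (\<forall>P. inK K P \<longrightarrow> inK K (\<lambda>e. \<not> P e)) \<and> (\<forall>P Q. inK K P \<longrightarrow> inK K Q \<longrightarrow> inK K (\<lambda>e. P e \<and> Q e)) \<and>
     (\<forall>P f. inK K P \<longrightarrow> inK K (\<lambda>e. P (\<lambda>i. e (f i)))) \<and>
     (\<forall>P i. inK K P \<longrightarrow> inK K (\<lambda>e. \<exists>x. x \<^bold>\<in> e i \<and> P (case_nat x e))) \<and>
     (\<forall>P T. inK K P \<longrightarrow> inK K T \<longrightarrow> (\<forall>e. \<exists>!y. T (case_nat y e)) \<longrightarrow>
        inK K (\<lambda>e. \<exists>y. T (case_nat y e) \<and> P (case_nat y e)))"

definition Fn :: "(((nat \<Rightarrow> 'a) \<Rightarrow> bool) \<Rightarrow> bool) \<Rightarrow> ((nat \<Rightarrow> 'a) \<Rightarrow> 'a) \<Rightarrow> bool" where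
  "Fn K t \<longleftrightarrow> inK K (\<lambda>e. e 0 = t (\<lambda>i. e (Suc i)))"

text \<open>The variables of \<open>p\<close> that read position 0 are merged into variable 0, which
  is then quantified. The others move up by one to keep 0 free, while the positions they read go
  down by one.\<close>

lemma Df_ex_env: assumes "Df P" shows "Df (\<lambda>e. \<exists>x. P (case_nat x e))"
proof -
  obtain p g where P: "\<And>e. P e \<longleftrightarrow> sat UNIV (\<lambda>i. case g i of Inl c \<Rightarrow> c | Inr k \<Rightarrow> e k) p"
    using assms by (auto simp: Df_def)
  define f where "f i = (if g i = Inr 0 then 0 else Suc i)" for i
  define g' where "g' i = (case i of 0 \<Rightarrow> Inr 0 | Suc i \<Rightarrow>
    (case g i of Inl c \<Rightarrow> Inl c | Inr k \<Rightarrow> Inr (k - 1)))" for i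
  let ?s = "\<lambda>e i. case g' i of Inl c \<Rightarrow> c | Inr k \<Rightarrow> e k"
  have "(\<lambda>i. ((?s e)(0 := x)) (f i)) = (\<lambda>i. case g i of Inl c \<Rightarrow> c | Inr k \<Rightarrow> case_nat x e k)" for x e
    by (rule ext) (auto simp: f_def g'_def split: sum.splits nat.splits)
  then have "P (case_nat x e) \<longleftrightarrow> sat UNIV ((?s e)(0 := x)) (ren p f)" for x e
    by (simp add: P sat_ren)
  then show ?thesis
    unfolding Df_def by (intro exI[of _ "Ex 0 (ren p f)"] exI[of _ g']) simp
qed

lemma Df_rename: assumes "Df P" shows "Df (\<lambda>e. P (\<lambda>i. e (f i)))"
proof -
  obtain p g where P: "\<And>e. P e \<longleftrightarrow> sat UNIV (\<lambda>i. case g i of Inl c \<Rightarrow> c | Inr k \<Rightarrow> e k) p"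
    using assms by (auto simp: Df_def)
  show ?thesis unfolding Df_def P
  proof (intro exI[of _ p] exI[of _ "\<lambda>i. case g i of Inl c \<Rightarrow> Inl c | Inr k \<Rightarrow> Inr (f k)"] allI)
  qed (auto intro!: sat_cong split: sum.splits)
qed

text \<open>Each formula has its own parameters, so the variables are kept apart on even and odd
  numbers.\<close>

lemma Df_conj: assumes "Df P" "Df Q" shows "Df (\<lambda>e. P e \<and> Q e)"
proof -
  obtain p g where P: "\<And>e. P e \<longleftrightarrow> sat UNIV (\<lambda>i. case g i of Inl c \<Rightarrow> c | Inr k \<Rightarrow> e k) p"
    using assms by (auto simp: Df_def)
  obtain q h where Q: "\<And>e. Q e \<longleftrightarrow> sat UNIV (\<lambda>i. case h i of Inl c \<Rightarrow> c | Inr k \<Rightarrow> e k) q"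
    using assms by (auto simp: Df_def)
  show ?thesis unfolding Df_def P Q
    by (intro exI[of _ "And (ren p (\<lambda>i. 2 * i)) (ren q (\<lambda>i. 2 * i + 1))"]
        exI[of _ "\<lambda>i. if even i then g (i div 2) else h (i div 2)"]) (simp add: sat_ren)
qed

lemma Df_neg: "Df P \<Longrightarrow> Df (\<lambda>e. \<not> P e)"
  unfolding Df_def by (metis sat.simps(3))

lemma Df_mem: "Df (\<lambda>e. e i \<^bold>\<in> e j)"
  unfolding Df_def by (intro exI[of _ "Mem i j"] exI[of _ Inr]) simp

lemma Df_eq: "Df (\<lambda>e. e i = e j)"
  unfolding Df_def by (intro exI[of _ "Eq i j"] exI[of _ Inr]) simp

lemma good_Df [simp, intro]: "good Df"
proof -
  have "Df (\<lambda>e. \<exists>x. x \<^bold>\<in> e i \<and> P (case_nat x e))" if "Df P" for P i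
    using Df_ex_env[OF Df_conj[OF Df_mem[of 0 "Suc i"] that]] by simp
  moreover have "Df (\<lambda>e. \<exists>y. T (case_nat y e) \<and> P (case_nat y e))" if "Df P" "Df T" for P T
    using Df_ex_env[OF Df_conj[OF that(2,1)]] by simp
  ultimately show ?thesis
    unfolding good_def inK_def using Df_mem Df_eq Df_neg Df_conj Df_rename by blast
qed

text \<open>Rules with which \<open>intro defn\<close> reads definability off the shape of a
  predicate. The hypothesis \<open>good K\<close> is added locally where it is available, so that
  one proof serves \<open>Df\<close> and all the Delta classes.\<close>

named_theorems defn

declare good_Df [defn]

lemma Fn_const [defn]: "Fn Df (\<lambda>e. a)"
  unfolding Fn_def inK_def Df_def
  by (intro exI[of _ "Eq 0 1"] exI[of _ "\<lambda>i. if i = 0 then Inr 0 else Inl a"]) simp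

lemma K_rename: "good K \<Longrightarrow> inK K P \<Longrightarrow> inK K (\<lambda>e. P (\<lambda>i. e (f i)))"
  by (simp add: good_def)

lemma Fn_var [defn]: "good K \<Longrightarrow> Fn K (\<lambda>e. e i)"
  by (simp add: Fn_def good_def)

lemma Fn_shift: "good K \<Longrightarrow> Fn K t \<Longrightarrow> Fn K (\<lambda>e. t (\<lambda>i. e (Suc i)))"
  unfolding Fn_def by (drule K_rename[of K _ "case_nat 0 (\<lambda>i. Suc (Suc i))"]) auto

text \<open>The value of \<open>t\<close> is named by a quantified variable. It is unique, so the
  last clause of \<open>good\<close> applies.\<close>

lemma K_subst:
  assumes "good K" "Fn K t" "inK K (\<lambda>e. P (e 0) (\<lambda>i. e (Suc i)))"
  shows "inK K (\<lambda>e. P (t e) e)"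
proof -
  have sub: "inK K (\<lambda>e. \<exists>y. T (case_nat y e) \<and> P (case_nat y e))"
    if "inK K P" "inK K T" "\<forall>e. \<exists>!y. T (case_nat y e)" for P T
    using assms(1) that unfolding good_def by blast
  show ?thesis
    using sub[OF assms(3) assms(2)[unfolded Fn_def]] by simp
qed

lemma K_app1: "good K \<Longrightarrow> inK K (\<lambda>e. R (e 0)) \<Longrightarrow> Fn K t \<Longrightarrow> inK K (\<lambda>e. R (t e))"
  by (rule K_subst) auto

lemma K_app2: "good K \<Longrightarrow> inK K (\<lambda>e. R (e 0) (e 1)) \<Longrightarrow> Fn K t \<Longrightarrow> Fn K u \<Longrightarrow> inK K (\<lambda>e. R (t e) (u e))"
  apply (rule K_subst[where P = "\<lambda>x e. R x (u e)"], assumption, assumption)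
  apply (rule K_subst[where P = "\<lambda>x e. R (e 0) x"], assumption)
   apply (erule Fn_shift, assumption)
  apply (drule K_rename[of K _ "case_nat 1 (case_nat 0 undefined)"], auto)
  done

lemma K_app3:
  assumes "good K" "inK K (\<lambda>e. R (e 0) (e 1) (e 2))" "Fn K t" "Fn K u" "Fn K v"
  shows "inK K (\<lambda>e. R (t e) (u e) (v e))"
  apply (rule K_subst[where P = "\<lambda>x e. R x (u e) (v e)"], rule assms, rule assms)
  apply (rule K_subst[where P = "\<lambda>x e. R (e 0) x (v (\<lambda>i. e (Suc i)))"], rule assms)
   apply (rule Fn_shift; rule assms)
  apply (rule K_subst[where P = "\<lambda>x e. R (e (Suc 0)) (e 0) x"], rule assms)
   apply (rule Fn_shift[where t = "\<lambda>e. v (\<lambda>i. e (Suc i))"], rule assms, rule Fn_shift; rule assms)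
  using K_rename[OF assms(1,2), of "case_nat 2 (case_nat 1 (case_nat 0 undefined))"]
  by (simp add: numeral_2_eq_2 One_nat_def)

lemma Fn_app1: "good K \<Longrightarrow> Fn K (\<lambda>e. F (e 0)) \<Longrightarrow> Fn K t \<Longrightarrow> Fn K (\<lambda>e. F (t e))"
  unfolding Fn_def[of K "\<lambda>e. F (t e)"]
  apply (rule K_app2[where R = "\<lambda>x y. x = F y"], assumption)
    apply (simp add: Fn_def)
   apply (erule Fn_var)
  apply (erule Fn_shift, assumption)
  done

lemma Fn_app2: "good K \<Longrightarrow> Fn K (\<lambda>e. F (e 0) (e 1)) \<Longrightarrow> Fn K t \<Longrightarrow> Fn K u \<Longrightarrow> Fn K (\<lambda>e. F (t e) (u e))"
  unfolding Fn_def[of K "\<lambda>e. F (t e) (u e)"]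
  apply (rule K_app3[where R = "\<lambda>x y z. x = F y z"], assumption)
    apply (simp add: Fn_def numeral_2_eq_2)
   apply (erule Fn_var)
  apply (erule Fn_shift, assumption)+
  done

lemma K_mem [defn]: "good K \<Longrightarrow> Fn K t \<Longrightarrow> Fn K u \<Longrightarrow> inK K (\<lambda>e. t e \<^bold>\<in> u e)"
  by (rule K_app2) (auto simp: good_def)

lemma K_eq [defn]: "good K \<Longrightarrow> Fn K t \<Longrightarrow> Fn K u \<Longrightarrow> inK K (\<lambda>e. t e = u e)"
  by (rule K_app2) (auto simp: good_def)

lemma K_neg [defn]: "good K \<Longrightarrow> inK K P \<Longrightarrow> inK K (\<lambda>e. \<not> P e)"
  by (simp add: good_def)

lemma K_conj [defn]: "good K \<Longrightarrow> inK K P \<Longrightarrow> inK K Q \<Longrightarrow> inK K (\<lambda>e. P e \<and> Q e)"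
  by (simp add: good_def)

lemma K_disj [defn]: "good K \<Longrightarrow> inK K P \<Longrightarrow> inK K Q \<Longrightarrow> inK K (\<lambda>e. P e \<or> Q e)"
  using K_neg[OF _ K_conj[of K "\<lambda>e. \<not> P e" "\<lambda>e. \<not> Q e"]] by (simp add: K_neg)

lemma K_imp [defn]: "good K \<Longrightarrow> inK K P \<Longrightarrow> inK K Q \<Longrightarrow> inK K (\<lambda>e. P e \<longrightarrow> Q e)"
  using K_disj[of K "\<lambda>e. \<not> P e" Q] by (simp add: K_neg)

lemma K_iff [defn]: "good K \<Longrightarrow> inK K P \<Longrightarrow> inK K Q \<Longrightarrow> inK K (\<lambda>e. P e \<longleftrightarrow> Q e)"
  using K_conj[of K "\<lambda>e. P e \<longrightarrow> Q e" "\<lambda>e. Q e \<longrightarrow> P e"] by (simp add: K_imp iff_conv_conj_imp)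

lemma K_True [defn]: "good K \<Longrightarrow> inK K (\<lambda>e. True)"
  using K_eq[of K "\<lambda>e. e 0" "\<lambda>e. e 0"] by (simp add: Fn_var)

lemma K_bex [defn]:
  assumes "good K" "Fn K t" "inK K (\<lambda>e. P (e 0) (\<lambda>i. e (Suc i)))"
  shows "inK K (\<lambda>e. \<exists>x. x \<^bold>\<in> t e \<and> P x e)"
proof (rule K_subst[where P = "\<lambda>y e. \<exists>x. x \<^bold>\<in> y \<and> P x e", OF assms(1,2)])
  have "inK K (\<lambda>e. P (e 0) (\<lambda>i. e (Suc (Suc i))))"
    using K_rename[OF assms(1,3), of "case_nat 0 (\<lambda>i. Suc (Suc i))"] by simp
  then show "inK K (\<lambda>e. \<exists>x. x \<^bold>\<in> e 0 \<and> P x (\<lambda>i. e (Suc i)))"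
    using assms(1) unfolding good_def by fastforce
qed

lemma K_ball [defn]:
  assumes "good K" "Fn K t" "inK K (\<lambda>e. P (e 0) (\<lambda>i. e (Suc i)))"
  shows "inK K (\<lambda>e. \<forall>x. x \<^bold>\<in> t e \<longrightarrow> P x e)"
  using K_neg[OF assms(1) K_bex[where P = "\<lambda>x e. \<not> P x e", OF assms(1,2) K_neg[OF assms(1,3)]]] by simp

lemma Df_ex [defn]:
  assumes "inK Df (\<lambda>e. P (e 0) (\<lambda>i. e (Suc i)))" shows "inK Df (\<lambda>e. \<exists>x. P x e)"
  using Df_ex_env[OF assms[unfolded inK_def]] by (simp add: inK_def)

lemma Df_all [defn]:
  assumes "inK Df (\<lambda>e. P (e 0) (\<lambda>i. e (Suc i)))" shows "inK Df (\<lambda>e. \<forall>x. P x e)"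
  using K_neg[OF good_Df Df_ex[where P = "\<lambda>x e. \<not> P x e", OF K_neg[OF good_Df assms]]] by simp

end

section \<open>Sets, functions and ordinals\<close>

locale zfc = set_structure +
  assumes ZFC: ZFC
begin

section \<open>Set operations from the axioms, with their definability\<close>

lemma ext: "(\<And>z. z \<^bold>\<in> x \<longleftrightarrow> z \<^bold>\<in> y) \<Longrightarrow> x = y"
  using ZFC by (auto simp: ZFC_def extensionality_def)

lemma mem_the_set: "\<exists>x. \<forall>z. z \<^bold>\<in> x \<longleftrightarrow> P z \<Longrightarrow> z \<^bold>\<in> the_set P \<longleftrightarrow> P z"
proof -
  assume "\<exists>x. \<forall>z. z \<^bold>\<in> x \<longleftrightarrow> P z"
  then have "\<exists>!x. \<forall>z. z \<^bold>\<in> x \<longleftrightarrow> P z" using ext by metis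
  from theI'[OF this] show ?thesis by (simp add: the_set_def)
qed

lemma the_set_eq: "(\<And>z. z \<^bold>\<in> x \<longleftrightarrow> P z) \<Longrightarrow> the_set P = x"
  using mem_the_set[of P] by (intro ext) blast

text \<open>Brings a definable relation into the shape that the axiom schemes expect: variables 0
  and 1 are the arguments, and all others, shifted by two, hold parameters.\<close>

lemma Df_binary:
  assumes "inK Df (\<lambda>e. R (e 0) (e 1))"
  shows "\<exists>p s. \<forall>u v. R u v \<longleftrightarrow> sat UNIV (s(0 := u, 1 := v)) p"
proof -
  from assms[unfolded Df_def inK_def] obtain p g where
    P: "\<forall>e :: nat \<Rightarrow> 'a. R (e 0) (e 1) \<longleftrightarrow> sat UNIV (\<lambda>i. case g i of Inl c \<Rightarrow> c | Inr k \<Rightarrow> e k) p"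
    by (elim exE) (rule that)
  define f where "f i = (if g i = Inr 0 then 0 else if g i = Inr 1 then 1 else Suc (Suc i))" for i :: nat
  \<comment> \<open>Positions of the environment other than 0 and 1 are \<open>undefined\<close> on
    both sides; the relation does not depend on them.\<close>
  define s where "s i = (case g (i - 2) of Inl c \<Rightarrow> c | Inr k \<Rightarrow> undefined)" for i :: nat
  define e where "e u v i = (if i = 0 then u else if i = Suc 0 then v else undefined)" for u v :: 'a and i :: nat
  have "R u v \<longleftrightarrow> sat UNIV (s(0 := u, 1 := v)) (ren p f)" for u v
  proof -
    have "(\<lambda>i. (s(0 := u, 1 := v)) (f i)) = (\<lambda>i. case g i of Inl c \<Rightarrow> c | Inr k \<Rightarrow> e u v k)"
      by (rule HOL.ext) (auto simp: f_def s_def e_def split: sum.splits)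
    then show ?thesis using P[rule_format, of "e u v"] by (simp add: sat_ren e_def)
  qed
  then show ?thesis by blast
qed

lemma separation_Df:
  assumes "inK Df (\<lambda>e. P (e 0))" shows "\<exists>y. \<forall>z. z \<^bold>\<in> y \<longleftrightarrow> z \<^bold>\<in> x \<and> P z"
proof -
  from Df_binary[where R = "\<lambda>u v. P u", OF assms] obtain p s where
    *: "\<forall>u v. P u \<longleftrightarrow> sat UNIV (s(0 := u, 1 := v)) p"
    by (elim exE) (rule that)
  have sep: "separation" using ZFC by (simp add: ZFC_def)
  have "\<exists>y. \<forall>z. z \<^bold>\<in> y \<longleftrightarrow> z \<^bold>\<in> x \<and> sat UNIV ((s(1 := x))(0 := z)) p"
    by (rule sep[unfolded separation_def, rule_format])
  moreover have "(s(1 := x))(0 := z) = s(0 := z, 1 := x)" for z by auto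
  ultimately show ?thesis using * by metis
qed

lemma replacement_Df:
  assumes "inK Df (\<lambda>e. R (e 0) (e 1))" "\<And>u. u \<^bold>\<in> x \<Longrightarrow> \<exists>!v. R u v"
  shows "\<exists>y. \<forall>v. v \<^bold>\<in> y \<longleftrightarrow> (\<exists>u. u \<^bold>\<in> x \<and> R u v)"
proof -
  from Df_binary[where R = R, OF assms(1)] obtain p s where
    *: "\<forall>u v. R u v \<longleftrightarrow> sat UNIV (s(0 := u, 1 := v)) p"
    by (elim exE) (rule that)
  have rep: "replacement" using ZFC by (simp add: ZFC_def)
  have "\<exists>!v. sat UNIV (s(0 := u, 1 := v)) p" if "u \<^bold>\<in> x" for u
    using assms(2)[OF that] * by simp
  from rep[unfolded replacement_def, rule_format, of x s p, OF this] show ?thesis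
    using * by simp
qed

lemma mem_bounded:
  "inK Df (\<lambda>e. P (e 0)) \<Longrightarrow> (\<And>z. P z \<Longrightarrow> z \<^bold>\<in> x) \<Longrightarrow> z \<^bold>\<in> the_set P \<longleftrightarrow> P z"
  using separation_Df[of P x] by (intro mem_the_set) metis

definition Sep :: "'a \<Rightarrow> ('a \<Rightarrow> bool) \<Rightarrow> 'a" where "Sep x P = the_set (\<lambda>z. z \<^bold>\<in> x \<and> P z)"
definition img :: "'a \<Rightarrow> ('a \<Rightarrow> 'a) \<Rightarrow> 'a" where "img x F = the_set (\<lambda>z. \<exists>u. u \<^bold>\<in> x \<and> z = F u)"
definition bigcup :: "'a \<Rightarrow> 'a" where "bigcup x = the_set (\<lambda>z. \<exists>y. y \<^bold>\<in> x \<and> z \<^bold>\<in> y)"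
definition un2 :: "'a \<Rightarrow> 'a \<Rightarrow> 'a" where "un2 x y = the_set (\<lambda>z. z \<^bold>\<in> x \<or> z \<^bold>\<in> y)"
definition subs :: "'a \<Rightarrow> 'a \<Rightarrow> bool" where "subs x y \<longleftrightarrow> (\<forall>z. z \<^bold>\<in> x \<longrightarrow> z \<^bold>\<in> y)"
definition powset :: "'a \<Rightarrow> 'a" where "powset x = the_set (\<lambda>z. subs z x)"

lemma mem_Sep: "inK Df (\<lambda>e. P (e 0)) \<Longrightarrow> z \<^bold>\<in> Sep x P \<longleftrightarrow> z \<^bold>\<in> x \<and> P z"
  unfolding Sep_def by (rule mem_the_set) (rule separation_Df)

lemma mem_img:
  assumes "Fn Df (\<lambda>e. F (e 0))" shows "z \<^bold>\<in> img x F \<longleftrightarrow> (\<exists>u. u \<^bold>\<in> x \<and> z = F u)"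
  unfolding img_def
proof (rule mem_the_set, rule replacement_Df[where R = "\<lambda>u v. v = F u"])
  show "inK Df (\<lambda>e. e 1 = F (e 0))"
    by (intro defn Fn_app1[OF good_Df assms])
qed auto

lemma mem_bigcup [simp]: "z \<^bold>\<in> bigcup x \<longleftrightarrow> (\<exists>y. y \<^bold>\<in> x \<and> z \<^bold>\<in> y)"
  unfolding bigcup_def using ZFC by (intro mem_the_set) (auto simp: ZFC_def union_def)

lemma mem_upair [simp]: "z \<^bold>\<in> upair x y \<longleftrightarrow> z = x \<or> z = y"
  unfolding upair_def using ZFC by (intro mem_the_set) (auto simp: ZFC_def pairing_def)

lemma mem_un2 [simp]: "z \<^bold>\<in> un2 x y \<longleftrightarrow> z \<^bold>\<in> x \<or> z \<^bold>\<in> y"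
  unfolding un2_def by (rule mem_the_set, rule exI[of _ "bigcup (upair x y)"]) auto

lemma mem_powset [simp]: "z \<^bold>\<in> powset x \<longleftrightarrow> subs z x"
  unfolding powset_def subs_def using ZFC by (intro mem_the_set) (auto simp: ZFC_def powerset_def)

lemma mem_zero [simp]: "\<not> z \<^bold>\<in> zero"
  unfolding zero_def using ZFC by (subst mem_the_set) (auto simp: ZFC_def infinity_def)

lemma mem_succ [simp]: "z \<^bold>\<in> succ x \<longleftrightarrow> z \<^bold>\<in> x \<or> z = x"
  unfolding succ_def by (rule mem_the_set, rule exI[of _ "un2 x (upair x x)"]) auto

lemma zero_unique: "x = zero \<longleftrightarrow> (\<forall>z. \<not> z \<^bold>\<in> x)"
  using ext[of x zero] by auto

lemma upair_eq: "upair a b = upair c d \<longleftrightarrow> a = c \<and> b = d \<or> a = d \<and> b = c"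
proof -
  have "upair a b = upair b a" by (rule ext) auto
  then show ?thesis by (metis mem_upair)
qed

lemma opair_inject [simp]: "opair a b = opair c d \<longleftrightarrow> a = c \<and> b = d"
  unfolding opair_def upair_eq by auto

lemma foundation_min: "y \<^bold>\<in> x \<Longrightarrow> \<exists>y. y \<^bold>\<in> x \<and> (\<forall>z. z \<^bold>\<in> y \<longrightarrow> \<not> z \<^bold>\<in> x)"
  using ZFC unfolding ZFC_def foundation_def by metis

lemma not_mem_self [simp]: "\<not> x \<^bold>\<in> x"
  using foundation_min[of x "upair x x"] by auto

lemma mem_asym: "x \<^bold>\<in> y \<Longrightarrow> \<not> y \<^bold>\<in> x"
  using foundation_min[of x "upair x y"] by auto

lemma succ_inject [simp]: "succ x = succ y \<longleftrightarrow> x = y"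
  by (metis mem_asym mem_succ)

lemma succ_not_zero [simp]: "succ x \<noteq> zero" "zero \<noteq> succ x"
  by (metis mem_succ mem_zero)+

lemma K_subs [defn]: assumes G [defn]: "good K" and "Fn K t" "Fn K u" shows "inK K (\<lambda>e. subs (t e) (u e))"
  by (rule K_app2[OF G _ assms(2,3)]; unfold subs_def; intro defn)

lemma K_transitive [defn]: assumes G [defn]: "good K" and "Fn K t" shows "inK K (\<lambda>e. transitive (t e))"
proof (rule K_app1[OF _ _ assms(2)])
  have "transitive x \<longleftrightarrow> (\<forall>y. y \<^bold>\<in> x \<longrightarrow> (\<forall>z. z \<^bold>\<in> y \<longrightarrow> z \<^bold>\<in> x))" for x
    by (auto simp: transitive_def)
  then show "inK K (\<lambda>e. transitive (e 0))" by (simp only:) (intro defn)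
qed (rule assms)

lemma K_Ord [defn]: assumes G [defn]: "good K" and "Fn K t" shows "inK K (\<lambda>e. Ord (t e))"
  by (rule K_app1[OF G _ assms(2)]; unfold Ord_def; intro defn)

lemma Fn_zero [defn]: assumes G [defn]: "good K" shows "Fn K (\<lambda>e. zero)"
proof -
  have "x = zero \<longleftrightarrow> (\<forall>z. z \<^bold>\<in> x \<longrightarrow> \<not> True)" for x by (simp add: zero_unique)
  then show ?thesis unfolding Fn_def by (simp only:) (intro defn)
qed

lemma Fn_upair [defn]: assumes G [defn]: "good K" and "Fn K t" "Fn K u" shows "Fn K (\<lambda>e. upair (t e) (u e))"
proof (rule Fn_app2[OF _ _ assms(2,3)])
  have "x = upair y z \<longleftrightarrow> y \<^bold>\<in> x \<and> z \<^bold>\<in> x \<and> (\<forall>w. w \<^bold>\<in> x \<longrightarrow> w = y \<or> w = z)" for x y z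
    using ext[of x "upair y z"] by auto
  then show "Fn K (\<lambda>e. upair (e 0) (e 1))" unfolding Fn_def by (simp only:) (intro defn)
qed (rule assms)

lemma Fn_opair [defn]: assumes G [defn]: "good K" and "Fn K t" "Fn K u" shows "Fn K (\<lambda>e. opair (t e) (u e))"
  by (rule Fn_app2[OF G _ assms(2,3)]; unfold opair_def; intro defn)

lemma Fn_succ [defn]: assumes G [defn]: "good K" and "Fn K t" shows "Fn K (\<lambda>e. succ (t e))"
proof (rule Fn_app1[OF _ _ assms(2)])
  have "x = succ y \<longleftrightarrow> y \<^bold>\<in> x \<and> subs y x \<and> (\<forall>w. w \<^bold>\<in> x \<longrightarrow> w \<^bold>\<in> y \<or> w = y)" for x y
    using ext[of x "succ y"] by (auto simp: subs_def)
  then show "Fn K (\<lambda>e. succ (e 0))" unfolding Fn_def by (simp only:) (intro defn)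
qed (rule assms)

lemma Fn_num [defn]: assumes G [defn]: "good K" shows "Fn K (\<lambda>e. num k)"
  by (induction k) (simp_all, (intro defn | assumption)+)

lemma Fn_bigcup [defn]: assumes G [defn]: "good K" and "Fn K t" shows "Fn K (\<lambda>e. bigcup (t e))"
proof (rule Fn_app1[OF _ _ assms(2)])
  have "x = bigcup y \<longleftrightarrow> (\<forall>w. w \<^bold>\<in> x \<longrightarrow> (\<exists>v. v \<^bold>\<in> y \<and> w \<^bold>\<in> v)) \<and> (\<forall>v. v \<^bold>\<in> y \<longrightarrow> subs v x)" for x y
    using ext[of x "bigcup y"] by (auto simp: subs_def)
  then show "Fn K (\<lambda>e. bigcup (e 0))" unfolding Fn_def by (simp only:) (intro defn)
qed (rule assms)

lemma Fn_powset [defn]: assumes "Fn Df t" shows "Fn Df (\<lambda>e. powset (t e))"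
proof (rule Fn_app1[OF _ _ assms(1)])
  have "x = powset y \<longleftrightarrow> (\<forall>w. w \<^bold>\<in> x \<longleftrightarrow> subs w y)" for x y
    using ext[of x "powset y"] by auto
  then show "Fn Df (\<lambda>e. powset (e 0))" unfolding Fn_def by (simp only:) (intro defn)
qed (rule defn)

text \<open>For Kuratowski pairs both components lie two unions below \<open>f\<close>, which bounds
  quantifiers over arguments and values.\<close>

lemma mem_opair_bigcup: "opair x y \<^bold>\<in> f \<Longrightarrow> x \<^bold>\<in> bigcup (bigcup f) \<and> y \<^bold>\<in> bigcup (bigcup f)"
  unfolding opair_def mem_bigcup by (metis mem_upair)

definition ap :: "'a \<Rightarrow> 'a \<Rightarrow> 'a" where
  "ap f x = the_set (\<lambda>z. \<exists>y. opair x y \<^bold>\<in> f \<and> z \<^bold>\<in> y)"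

lemma mem_ap: "z \<^bold>\<in> ap f x \<longleftrightarrow> (\<exists>y. opair x y \<^bold>\<in> f \<and> z \<^bold>\<in> y)"
  unfolding ap_def
proof (rule mem_bounded[where x = "bigcup (bigcup (bigcup f))"])
  show "inK Df (\<lambda>e. \<exists>y. opair x y \<^bold>\<in> f \<and> e 0 \<^bold>\<in> y)" by (intro defn)
  show "\<exists>y. opair x y \<^bold>\<in> f \<and> z \<^bold>\<in> y \<Longrightarrow> z \<^bold>\<in> bigcup (bigcup (bigcup f))" for z
    by (metis mem_bigcup mem_opair_bigcup)
qed

lemma opair_mem_fun: "is_fun f A \<Longrightarrow> opair x y \<^bold>\<in> f \<longleftrightarrow> x \<^bold>\<in> A \<and> y = app f x"
proof -
  assume f: "is_fun f A"
  have "opair x (app f x) \<^bold>\<in> f" if "x \<^bold>\<in> A" for x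
    unfolding app_def by (rule theI') (use f that in \<open>auto simp: is_fun_def\<close>)
  with f show ?thesis unfolding is_fun_def by (metis opair_inject)
qed

lemma mem_fun: "is_fun f A \<Longrightarrow> z \<^bold>\<in> f \<longleftrightarrow> (\<exists>x. x \<^bold>\<in> A \<and> z = opair x (app f x))"
proof -
  assume f: "is_fun f A"
  then have "z \<^bold>\<in> f \<Longrightarrow> \<exists>x y. z = opair x y" by (auto simp: is_fun_def)
  then show ?thesis by (metis opair_mem_fun[OF f])
qed

lemma app_ap: "is_fun f A \<Longrightarrow> x \<^bold>\<in> A \<Longrightarrow> app f x = ap f x"
  by (rule ext, unfold mem_ap opair_mem_fun) simp

lemma app_eqI: "is_fun f A \<Longrightarrow> opair x y \<^bold>\<in> f \<Longrightarrow> app f x = y"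
  by (simp add: opair_mem_fun)

lemma fun_ext: "is_fun f A \<Longrightarrow> is_fun g A \<Longrightarrow> (\<And>x. x \<^bold>\<in> A \<Longrightarrow> app f x = app g x) \<Longrightarrow> f = g"
  by (rule ext) (auto simp: mem_fun)

lemma is_funI: "(\<And>z. z \<^bold>\<in> f \<longleftrightarrow> (\<exists>x. x \<^bold>\<in> A \<and> z = opair x (F x))) \<Longrightarrow> is_fun f A \<and> (\<forall>x. x \<^bold>\<in> A \<longrightarrow> app f x = F x)"
proof -
  assume *: "\<And>z. z \<^bold>\<in> f \<longleftrightarrow> (\<exists>x. x \<^bold>\<in> A \<and> z = opair x (F x))"
  then have "is_fun f A" by (auto simp: is_fun_def)
  moreover from this * have "x \<^bold>\<in> A \<Longrightarrow> app f x = F x" for x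
    by (intro app_eqI) auto
  ultimately show ?thesis by blast
qed

definition lam :: "'a \<Rightarrow> ('a \<Rightarrow> 'a) \<Rightarrow> 'a" where "lam A F = img A (\<lambda>x. opair x (F x))"

lemma lam_fun:
  assumes "Fn Df (\<lambda>e. F (e 0))" shows "is_fun (lam A F) A" "x \<^bold>\<in> A \<Longrightarrow> app (lam A F) x = F x"
proof -
  have "Fn Df (\<lambda>e. opair (e 0) (F (e 0)))" by (intro defn assms)
  then have "is_fun (lam A F) A \<and> (\<forall>x. x \<^bold>\<in> A \<longrightarrow> app (lam A F) x = F x)"
    unfolding lam_def by (intro is_funI) (simp add: mem_img)
  then show "is_fun (lam A F) A" "x \<^bold>\<in> A \<Longrightarrow> app (lam A F) x = F x" by auto
qed

text \<open>\<open>app\<close> is \<open>THE\<close> without a uniqueness guarantee, hence not definable as a total function; \<open>ap\<close>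
  agrees with it on functions and is total and \<open>\<Delta>\<^sub>1\<close>.\<close>

lemma Fn_ap [defn]: assumes G [defn]: "good K" and "Fn K t" "Fn K u" shows "Fn K (\<lambda>e. ap (t e) (u e))"
proof (rule Fn_app2[OF _ _ assms(2,3)])
  have *: "(\<exists>y. opair x y \<^bold>\<in> f \<and> z \<^bold>\<in> y) \<longleftrightarrow> (\<exists>y. y \<^bold>\<in> bigcup (bigcup f) \<and> opair x y \<^bold>\<in> f \<and> z \<^bold>\<in> y)" for x z f
    using mem_opair_bigcup by blast
  have "w = ap f x \<longleftrightarrow> (\<forall>z. z \<^bold>\<in> w \<longrightarrow> (\<exists>y. y \<^bold>\<in> bigcup (bigcup f) \<and> opair x y \<^bold>\<in> f \<and> z \<^bold>\<in> y)) \<and>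
      (\<forall>y. y \<^bold>\<in> bigcup (bigcup f) \<longrightarrow> opair x y \<^bold>\<in> f \<longrightarrow> subs y w)" for w f x
  proof -
    have "w = ap f x \<longleftrightarrow> (\<forall>z. z \<^bold>\<in> w \<longleftrightarrow> (\<exists>y. opair x y \<^bold>\<in> f \<and> z \<^bold>\<in> y))"
      using ext[of w "ap f x"] by (auto simp: mem_ap)
    moreover have "(\<forall>y. y \<^bold>\<in> bigcup (bigcup f) \<longrightarrow> opair x y \<^bold>\<in> f \<longrightarrow> subs y w) \<longleftrightarrow>
        (\<forall>y. opair x y \<^bold>\<in> f \<longrightarrow> (\<forall>z. z \<^bold>\<in> y \<longrightarrow> z \<^bold>\<in> w))"
      using mem_opair_bigcup[of x _ f] unfolding subs_def by blast
    ultimately show ?thesis unfolding *[symmetric] by blast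
  qed
  then show "Fn K (\<lambda>e. ap (e 0) (e 1))" unfolding Fn_def by (simp only:) (intro defn)
qed (rule assms)

lemma K_is_fun [defn]: assumes G [defn]: "good K" and "Fn K t" "Fn K u" shows "inK K (\<lambda>e. is_fun (t e) (u e))"
proof (rule K_app2[OF _ _ assms(2,3)])
  have "is_fun f A \<longleftrightarrow> (\<forall>z. z \<^bold>\<in> f \<longrightarrow> (\<exists>x. x \<^bold>\<in> A \<and> z = opair x (ap f x))) \<and>
      (\<forall>x. x \<^bold>\<in> A \<longrightarrow> opair x (ap f x) \<^bold>\<in> f)"
    (is "_ \<longleftrightarrow> ?R") for f A
  proof
    assume f: "is_fun f A"
    then show ?R using app_ap[OF f] by (auto simp: mem_fun[OF f])
  next
    assume ?R
    then show "is_fun f A" by (intro is_funI[where F = "ap f", THEN conjunct1]) blast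
  qed
  then show "inK K (\<lambda>e. is_fun (e 0) (e 1))" by (simp only:) (intro defn)
qed (rule assms)

lemma maps_ap: "maps f A B \<longleftrightarrow> is_fun f A \<and> (\<forall>x. x \<^bold>\<in> A \<longrightarrow> ap f x \<^bold>\<in> B)"
  using app_ap by (auto simp: maps_def)

lemma K_maps [defn]: assumes G [defn]: "good K" and "Fn K t" "Fn K u" "Fn K v"
  shows "inK K (\<lambda>e. maps (t e) (u e) (v e))"
  by (rule K_app3[OF G _ assms(2-4)]; unfold maps_ap; intro defn)

section \<open>Ordinals and natural numbers of the model\<close>

lemma Ord_mem: "Ord \<alpha> \<Longrightarrow> \<beta> \<^bold>\<in> \<alpha> \<Longrightarrow> Ord \<beta>"
  unfolding Ord_def transitive_def by blast

lemma Ord_trans: "Ord \<alpha> \<Longrightarrow> \<gamma> \<^bold>\<in> \<beta> \<Longrightarrow> \<beta> \<^bold>\<in> \<alpha> \<Longrightarrow> \<gamma> \<^bold>\<in> \<alpha>"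
  unfolding Ord_def transitive_def by blast

lemma Ord_zero [simp]: "Ord zero"
  by (simp add: Ord_def transitive_def)

lemma Ord_succ [simp]: "Ord \<alpha> \<Longrightarrow> Ord (succ \<alpha>)"
  unfolding Ord_def transitive_def mem_succ by blast

lemma Ord_bigcup: "(\<And>x. x \<^bold>\<in> a \<Longrightarrow> Ord x) \<Longrightarrow> Ord (bigcup a)"
  unfolding Ord_def transitive_def mem_bigcup by blast

text \<open>Foundation yields a least counterexample once the counterexamples up to \<alpha> form a
  set. Definability of \<open>P\<close> is essential, since the ordinals of the model may be
  ill-founded from outside.\<close>

lemma Ord_induct [consumes 2, case_names step]:
  assumes "inK Df (\<lambda>e. P (e 0))" "Ord \<alpha>"
    and step: "\<And>\<beta>. Ord \<beta> \<Longrightarrow> (\<And>\<gamma>. \<gamma> \<^bold>\<in> \<beta> \<Longrightarrow> P \<gamma>) \<Longrightarrow> P \<beta>"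
  shows "P \<alpha>"
proof (rule ccontr)
  assume "\<not> P \<alpha>"
  have X: "z \<^bold>\<in> Sep (succ \<alpha>) (\<lambda>x. \<not> P x) \<longleftrightarrow> z \<^bold>\<in> succ \<alpha> \<and> \<not> P z" for z
    by (rule mem_Sep) (intro defn assms)
  then have "\<alpha> \<^bold>\<in> Sep (succ \<alpha>) (\<lambda>x. \<not> P x)" using \<open>\<not> P \<alpha>\<close> by simp
  from foundation_min[OF this] obtain \<beta> where \<beta>: "\<beta> \<^bold>\<in> succ \<alpha>" "\<not> P \<beta>"
    "\<And>z. z \<^bold>\<in> \<beta> \<Longrightarrow> \<not> (z \<^bold>\<in> succ \<alpha> \<and> \<not> P z)"
    unfolding X by blast
  have "Ord (succ \<alpha>)" using assms by simp
  then show False using \<beta> step[of \<beta>] Ord_mem Ord_trans by blast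
qed

text \<open>Two nested inductions: a minimal incomparable pair would have the same elements, hence
  be equal.\<close>

lemma Ord_linear:
  assumes "Ord \<alpha>" "Ord \<beta>" shows "\<alpha> \<^bold>\<in> \<beta> \<or> \<alpha> = \<beta> \<or> \<beta> \<^bold>\<in> \<alpha>"
proof -
  let ?C = "\<lambda>\<alpha> \<beta>. \<alpha> \<^bold>\<in> \<beta> \<or> \<alpha> = \<beta> \<or> \<beta> \<^bold>\<in> \<alpha>"
  have "\<forall>\<beta>. Ord \<beta> \<longrightarrow> ?C \<alpha> \<beta>"
  proof (rule Ord_induct[OF _ assms(1)])
    show "inK Df (\<lambda>e. \<forall>\<beta>. Ord \<beta> \<longrightarrow> ?C (e 0) \<beta>)" by (intro defn)
  next
    fix \<alpha> assume "Ord \<alpha>" and IH1: "\<And>\<gamma>. \<gamma> \<^bold>\<in> \<alpha> \<Longrightarrow> \<forall>\<beta>. Ord \<beta> \<longrightarrow> ?C \<gamma> \<beta>"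
    show "\<forall>\<beta>. Ord \<beta> \<longrightarrow> ?C \<alpha> \<beta>"
    proof (intro allI impI)
      fix \<beta> assume "Ord \<beta>"
      show "?C \<alpha> \<beta>"
      proof (rule Ord_induct[where P = "\<lambda>\<beta>. ?C \<alpha> \<beta>", OF _ \<open>Ord \<beta>\<close>])
        show "inK Df (\<lambda>e. ?C \<alpha> (e 0))" by (intro defn)
      next
        fix \<beta> assume "Ord \<beta>" and IH2: "\<And>\<gamma>. \<gamma> \<^bold>\<in> \<beta> \<Longrightarrow> ?C \<alpha> \<gamma>"
        show "?C \<alpha> \<beta>"
        proof (rule ccontr)
          assume n: "\<not> ?C \<alpha> \<beta>"
          have "\<gamma> \<^bold>\<in> \<beta>" if "\<gamma> \<^bold>\<in> \<alpha>" for \<gamma>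
            using IH1[OF that] n that Ord_trans[OF \<open>Ord \<alpha>\<close>] \<open>Ord \<beta>\<close> by blast
          moreover have "\<gamma> \<^bold>\<in> \<alpha>" if "\<gamma> \<^bold>\<in> \<beta>" for \<gamma>
            using IH2[OF that] n that Ord_trans[OF \<open>Ord \<beta>\<close>] by blast
          ultimately show False using n ext by blast
        qed
      qed
    qed
  qed
  then show ?thesis using assms by blast
qed

lemma Ord_least:
  assumes "inK Df (\<lambda>e. P (e 0))" "Ord \<alpha>" "P \<alpha>"
  shows "\<exists>\<beta>. Ord \<beta> \<and> P \<beta> \<and> (\<forall>\<gamma>. \<gamma> \<^bold>\<in> \<beta> \<longrightarrow> \<not> P \<gamma>)"
proof (rule ccontr)
  assume n: "\<not> ?thesis"
  have "\<not> P \<alpha>"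
    by (rule Ord_induct[where P = "\<lambda>x. \<not> P x", OF _ assms(2)]) (intro defn assms, use n in blast)
  then show False using assms by blast
qed

lemma Ord_subs: "Ord \<alpha> \<Longrightarrow> Ord \<beta> \<Longrightarrow> subs \<alpha> \<beta> \<longleftrightarrow> \<alpha> \<^bold>\<in> \<beta> \<or> \<alpha> = \<beta>"
  unfolding subs_def by (metis Ord_linear Ord_trans not_mem_self)

text \<open>The axiom of infinity supplies only some inductive set; induction on the ordinals puts
  every candidate into it, so that the candidates form a set. The bound on \<open>k\<close> leaves
  no unbounded quantifier in the description.\<close>

lemma mem_omega: "n \<^bold>\<in> omega \<longleftrightarrow> Ord n \<and> (\<forall>m. m \<^bold>\<in> succ n \<longrightarrow> m = zero \<or> (\<exists>k. k \<^bold>\<in> m \<and> m = succ k))"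
proof -
  let ?N = "\<lambda>n. Ord n \<and> (\<forall>m. m \<^bold>\<in> succ n \<longrightarrow> m = zero \<or> (\<exists>k. k \<^bold>\<in> m \<and> m = succ k))"
  obtain x where x: "\<exists>e. e \<^bold>\<in> x \<and> (\<forall>z. \<not> z \<^bold>\<in> e)"
    "\<And>y. y \<^bold>\<in> x \<Longrightarrow> \<exists>w. w \<^bold>\<in> x \<and> (\<forall>z. z \<^bold>\<in> w \<longleftrightarrow> z \<^bold>\<in> y \<or> z = y)"
    using ZFC unfolding ZFC_def infinity_def by blast
  have z: "zero \<^bold>\<in> x" using x(1) zero_unique by metis
  have s: "succ y \<^bold>\<in> x" if "y \<^bold>\<in> x" for y using x(2)[OF that] ext[of _ "succ y"] by auto
  have def: "inK Df (\<lambda>e. ?N (e 0))" by (intro defn)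
  have *: "n \<^bold>\<in> x" if "?N n" for n
  proof -
    have "?N n \<longrightarrow> n \<^bold>\<in> x"
    proof (rule Ord_induct[where P = "\<lambda>n. ?N n \<longrightarrow> n \<^bold>\<in> x"])
      show "inK Df (\<lambda>e. ?N (e 0) \<longrightarrow> e 0 \<^bold>\<in> x)" by (intro defn)
      show "Ord n" using that by blast
    next
      fix n assume n: "Ord n" and IH: "\<And>m. m \<^bold>\<in> n \<Longrightarrow> ?N m \<longrightarrow> m \<^bold>\<in> x"
      show "?N n \<longrightarrow> n \<^bold>\<in> x"
      proof
        assume N: "?N n"
        show "n \<^bold>\<in> x"
        proof (cases "n = zero")
          case False
          then obtain k where k: "k \<^bold>\<in> n" "n = succ k" using N by auto
          then have "?N k" using N Ord_mem by auto
          then show ?thesis using IH k s by auto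
        qed (use z in simp)
      qed
    qed
    with that show ?thesis by blast
  qed
  have "(\<lambda>n. Ord n \<and> (\<forall>m. m \<^bold>\<in> succ n \<longrightarrow> m = zero \<or> (\<exists>k. m = succ k))) = ?N"
    by (rule HOL.ext) (metis mem_succ)
  then show ?thesis unfolding omega_def using mem_bounded[OF def *] by simp
qed

lemma zero_omega [simp]: "zero \<^bold>\<in> omega"
  by (simp add: mem_omega)

lemma succ_omega: "k \<^bold>\<in> omega \<Longrightarrow> succ k \<^bold>\<in> omega"
  by (auto simp: mem_omega)

lemma omega_cases: "n \<^bold>\<in> omega \<Longrightarrow> n = zero \<or> (\<exists>k. k \<^bold>\<in> omega \<and> n = succ k)"
  unfolding mem_omega using Ord_mem by (metis mem_succ)

lemma omega_induct [consumes 2, case_names zero succ]: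
  assumes "inK Df (\<lambda>e. P (e 0))" "n \<^bold>\<in> omega" "P zero" "\<And>k. k \<^bold>\<in> omega \<Longrightarrow> P k \<Longrightarrow> P (succ k)"
  shows "P n"
proof -
  have "n \<^bold>\<in> omega \<longrightarrow> P n"
  proof (rule Ord_induct[where P = "\<lambda>n. n \<^bold>\<in> omega \<longrightarrow> P n"])
    show "inK Df (\<lambda>e. e 0 \<^bold>\<in> omega \<longrightarrow> P (e 0))" by (intro defn assms)
    show "Ord n" using assms by (simp add: mem_omega)
  next
    fix \<beta> assume "\<And>\<gamma>. \<gamma> \<^bold>\<in> \<beta> \<Longrightarrow> \<gamma> \<^bold>\<in> omega \<longrightarrow> P \<gamma>"
    then show "\<beta> \<^bold>\<in> omega \<longrightarrow> P \<beta>" using omega_cases[of \<beta>] assms by auto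
  qed
  with assms show ?thesis by blast
qed

lemma Ord_omega [simp]: "Ord omega"
proof -
  have "m \<^bold>\<in> omega" if "n \<^bold>\<in> omega" "m \<^bold>\<in> n" for m n
    using that Ord_mem[of n m] Ord_trans[of n] unfolding mem_omega by auto
  then show ?thesis unfolding Ord_def transitive_def mem_omega by blast
qed

lemma num_omega [simp]: "num k \<^bold>\<in> omega"
  by (induction k) (auto simp: succ_omega)

lemma num_less: "m < n \<Longrightarrow> num m \<^bold>\<in> num n"
  by (induction n) (auto simp: less_Suc_eq)

lemma num_inject [simp]: "num m = num n \<longleftrightarrow> m = n"
  using num_less[of m n] num_less[of n m] by (metis linorder_neqE_nat not_mem_self)

text \<open>A graph in every good class requires a description of the set itself by bounded
  quantifiers: it is the ordinal that contains zero, is closed under successor and consists of zero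
  and successors only.\<close>

lemma Fn_omega [defn]: assumes G [defn]: "good K" shows "Fn K (\<lambda>e. omega)"
proof -
  have "x = omega \<longleftrightarrow> Ord x \<and> zero \<^bold>\<in> x \<and> (\<forall>n. n \<^bold>\<in> x \<longrightarrow> succ n \<^bold>\<in> x) \<and>
      (\<forall>n. n \<^bold>\<in> x \<longrightarrow> n = zero \<or> (\<exists>k. k \<^bold>\<in> n \<and> n = succ k))" (is "_ \<longleftrightarrow> ?R") for x
  proof
    assume R: ?R
    have "z \<^bold>\<in> x" if "z \<^bold>\<in> omega" for z
      by (rule omega_induct[OF _ that]) (intro defn, use R in auto)
    moreover have "z \<^bold>\<in> omega" if "z \<^bold>\<in> x" for z
      unfolding mem_omega
    proof (intro conjI allI impI)
      show "Ord z" using R that Ord_mem by blast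
      fix m assume "m \<^bold>\<in> succ z"
      then have "m \<^bold>\<in> x" using R that Ord_trans by auto
      then show "m = zero \<or> (\<exists>k. k \<^bold>\<in> m \<and> m = succ k)" using R by blast
    qed
    ultimately show "x = omega" by (intro ext) blast
  next
    assume x: "x = omega"
    have "n = zero \<or> (\<exists>k. k \<^bold>\<in> n \<and> n = succ k)" if "n \<^bold>\<in> omega" for n
      using omega_cases[OF that] by auto
    then show ?R unfolding x using succ_omega by simp
  qed
  then show ?thesis unfolding Fn_def by (simp only:) (intro defn)
qed

end

section \<open>The cumulative hierarchy\<close>

context zfc
begin

section \<open>Recursion along the ordinals\<close>

definition approx :: "('a \<Rightarrow> 'a) \<Rightarrow> 'a \<Rightarrow> 'a \<Rightarrow> 'a \<Rightarrow> bool" where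
  "approx H B \<alpha> f \<longleftrightarrow> is_fun f \<alpha> \<and> (\<forall>\<beta>. \<beta> \<^bold>\<in> \<alpha> \<longrightarrow>
     (\<forall>z. z \<^bold>\<in> ap f \<beta> \<longleftrightarrow> z \<^bold>\<in> B \<or> (\<exists>\<gamma>. \<gamma> \<^bold>\<in> \<beta> \<and> z \<^bold>\<in> H (ap f \<gamma>))))"

text \<open>The accumulation \<open>F \<alpha> = B \<union> \<Union>\<^sub>\<gamma>\<^sub><\<^sub>\<alpha> H (F \<gamma>)\<close>, set to be empty off the ordinals so that it is
  total. It serves for \<open>V\<^sub>\<alpha>\<close>, for transitive closures and for closure points.\<close>

definition iter :: "('a \<Rightarrow> 'a) \<Rightarrow> 'a \<Rightarrow> 'a \<Rightarrow> 'a" where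
  "iter H B \<alpha> = the_set (\<lambda>z. \<exists>f. Ord \<alpha> \<and> approx H B (succ \<alpha>) f \<and> z \<^bold>\<in> ap f \<alpha>)"

lemma K_approx [defn]:
  assumes "Fn Df (\<lambda>e. H (e 0))" "Fn Df t" "Fn Df u" shows "inK Df (\<lambda>e. approx H B (t e) (u e))"
  by (rule K_app2[OF good_Df _ assms(2,3)]; unfold approx_def; intro defn Fn_app1[OF good_Df assms(1)])

lemma approx_unique:
  assumes H: "Fn Df (\<lambda>e. H (e 0))" and f: "approx H B \<alpha> f" "approx H B \<alpha>' f'"
    and o: "Ord \<alpha>" "Ord \<alpha>'" and \<beta>: "\<beta> \<^bold>\<in> \<alpha>" "\<beta> \<^bold>\<in> \<alpha>'"
  shows "ap f \<beta> = ap f' \<beta>"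
proof -
  have "\<beta> \<^bold>\<in> \<alpha> \<and> \<beta> \<^bold>\<in> \<alpha>' \<longrightarrow> ap f \<beta> = ap f' \<beta>"
  proof (rule Ord_induct[where P = "\<lambda>\<beta>. \<beta> \<^bold>\<in> \<alpha> \<and> \<beta> \<^bold>\<in> \<alpha>' \<longrightarrow> ap f \<beta> = ap f' \<beta>"])
    show "inK Df (\<lambda>e. e 0 \<^bold>\<in> \<alpha> \<and> e 0 \<^bold>\<in> \<alpha>' \<longrightarrow> ap f (e 0) = ap f' (e 0))" by (intro defn)
    show "Ord \<beta>" using o \<beta> Ord_mem by blast
  next
    fix \<beta> assume IH: "\<And>\<gamma>. \<gamma> \<^bold>\<in> \<beta> \<Longrightarrow> \<gamma> \<^bold>\<in> \<alpha> \<and> \<gamma> \<^bold>\<in> \<alpha>' \<longrightarrow> ap f \<gamma> = ap f' \<gamma>"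
    show "\<beta> \<^bold>\<in> \<alpha> \<and> \<beta> \<^bold>\<in> \<alpha>' \<longrightarrow> ap f \<beta> = ap f' \<beta>"
    proof (intro impI ext)
      fix z assume b: "\<beta> \<^bold>\<in> \<alpha> \<and> \<beta> \<^bold>\<in> \<alpha>'"
      then have "ap f \<gamma> = ap f' \<gamma>" if "\<gamma> \<^bold>\<in> \<beta>" for \<gamma> using IH[OF that] Ord_trans o that by blast
      then show "z \<^bold>\<in> ap f \<beta> \<longleftrightarrow> z \<^bold>\<in> ap f' \<beta>" using f b unfolding approx_def by metis
    qed
  qed
  with \<beta> show ?thesis by blast
qed

text \<open>Approximations agree where they overlap. By replacement the values below \<alpha>
  therefore form one function \<open>f0\<close>, to which the value \<open>Y\<close> at \<alpha> is
  adjoined.\<close>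

lemma approx_exists:
  assumes H: "Fn Df (\<lambda>e. H (e 0))" and "Ord \<alpha>" shows "\<exists>f. approx H B (succ \<alpha>) f"
proof (rule Ord_induct[where P = "\<lambda>\<alpha>. \<exists>f. approx H B (succ \<alpha>) f", OF _ assms(2)])
  show "inK Df (\<lambda>e. \<exists>f. approx H B (succ (e 0)) f)" by (intro defn H)
next
  fix \<alpha> assume o: "Ord \<alpha>" and IH: "\<And>\<gamma>. \<gamma> \<^bold>\<in> \<alpha> \<Longrightarrow> \<exists>f. approx H B (succ \<gamma>) f"
  then obtain g where g: "\<And>\<gamma>. \<gamma> \<^bold>\<in> \<alpha> \<Longrightarrow> approx H B (succ \<gamma>) (g \<gamma>)" by metis
  define F where "F \<gamma> = ap (g \<gamma>) \<gamma>" for \<gamma>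
  have agree: "ap f \<gamma> = F \<gamma>" if "approx H B \<delta> f" "Ord \<delta>" "\<gamma> \<^bold>\<in> \<delta>" "\<gamma> \<^bold>\<in> \<alpha>" for f \<gamma> \<delta>
    unfolding F_def
    by (rule approx_unique[OF H that(1) g[OF that(4)]]) (use that o Ord_mem in auto)
  have eq: "z \<^bold>\<in> F \<beta> \<longleftrightarrow> z \<^bold>\<in> B \<or> (\<exists>\<gamma>. \<gamma> \<^bold>\<in> \<beta> \<and> z \<^bold>\<in> H (F \<gamma>))" if "\<beta> \<^bold>\<in> \<alpha>" for z \<beta>
  proof -
    have "\<gamma> \<^bold>\<in> \<alpha> \<and> ap (g \<beta>) \<gamma> = F \<gamma>" if "\<gamma> \<^bold>\<in> \<beta>" for \<gamma>
      using agree[OF g[OF \<open>\<beta> \<^bold>\<in> \<alpha>\<close>]] that o \<open>\<beta> \<^bold>\<in> \<alpha>\<close> Ord_mem Ord_trans Ord_succ mem_succ by metis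
    then show ?thesis
      using g[OF that] unfolding approx_def F_def[of \<beta>] by (metis mem_succ)
  qed
  \<comment> \<open>The choice \<open>g\<close> is made outside the model and need not be definable.
    Replacement is applied to a relation that quantifies over all approximations, which by
    uniqueness has the same values.\<close>
  let ?R = "\<lambda>u v. \<exists>f. approx H B (succ u) f \<and> v = opair u (ap f u)"
  have R: "?R u v \<longleftrightarrow> v = opair u (F u)" if "u \<^bold>\<in> \<alpha>" for u v
    using agree[of "succ u"] g[OF that] that o Ord_mem unfolding F_def by (metis Ord_succ mem_succ)
  have "\<exists>y. \<forall>v. v \<^bold>\<in> y \<longleftrightarrow> (\<exists>u. u \<^bold>\<in> \<alpha> \<and> ?R u v)"
  proof (rule replacement_Df)
    show "inK Df (\<lambda>e. \<exists>f. approx H B (succ (e 0)) f \<and> e 1 = opair (e 0) (ap f (e 0)))"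
      by (intro defn H)
    show "\<exists>!v. ?R u v" if "u \<^bold>\<in> \<alpha>" for u unfolding R[OF that] by auto
  qed
  then obtain f0 where f0: "\<And>v. v \<^bold>\<in> f0 \<longleftrightarrow> (\<exists>u. u \<^bold>\<in> \<alpha> \<and> v = opair u (F u))"
    using R by metis
  define Y where "Y = un2 B (bigcup (img \<alpha> (\<lambda>\<gamma>. H (ap f0 \<gamma>))))"
  have fun0: "is_fun f0 \<alpha>" "\<And>x. x \<^bold>\<in> \<alpha> \<Longrightarrow> ap f0 x = F x"
    using is_funI[OF f0] app_ap by metis+
  have Y: "z \<^bold>\<in> Y \<longleftrightarrow> z \<^bold>\<in> B \<or> (\<exists>\<gamma>. \<gamma> \<^bold>\<in> \<alpha> \<and> z \<^bold>\<in> H (F \<gamma>))" for z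
  proof -
    have "Fn Df (\<lambda>e. H (ap f0 (e 0)))" by (intro defn Fn_app1[OF good_Df H])
    from mem_img[OF this] show ?thesis using fun0(2) unfolding Y_def by (simp, metis)
  qed
  define f1 where "f1 = un2 f0 (upair (opair \<alpha> Y) (opair \<alpha> Y))"
  let ?F1 = "\<lambda>x. if x \<^bold>\<in> \<alpha> then F x else Y"
  have "is_fun f1 (succ \<alpha>) \<and> (\<forall>x. x \<^bold>\<in> succ \<alpha> \<longrightarrow> app f1 x = ?F1 x)"
    by (rule is_funI) (simp add: f1_def f0 conj_disj_distribR ex_disj_distrib cong: conj_cong)
  then have f1: "is_fun f1 (succ \<alpha>)" "\<And>x. x \<^bold>\<in> succ \<alpha> \<Longrightarrow> ap f1 x = ?F1 x"
    using app_ap by metis+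
  have "approx H B (succ \<alpha>) f1"
    unfolding approx_def
  proof (intro conjI f1 allI impI)
    fix \<beta> z assume b: "\<beta> \<^bold>\<in> succ \<alpha>"
    have "\<gamma> \<^bold>\<in> \<alpha> \<and> ap f1 \<gamma> = F \<gamma>" if "\<gamma> \<^bold>\<in> \<beta>" for \<gamma>
      using b that o Ord_trans f1(2)[of \<gamma>] by auto
    then show "z \<^bold>\<in> ap f1 \<beta> \<longleftrightarrow> z \<^bold>\<in> B \<or> (\<exists>\<gamma>. \<gamma> \<^bold>\<in> \<beta> \<and> z \<^bold>\<in> H (ap f1 \<gamma>))"
      using f1(2)[OF b] eq[of \<beta>] Y b by auto
  qed
  then show "\<exists>f. approx H B (succ \<alpha>) f" by blast
qed

lemma iter_approx:
  assumes H: "Fn Df (\<lambda>e. H (e 0))" and "Ord \<alpha>" "approx H B (succ \<alpha>) f" "\<beta> \<^bold>\<in> succ \<alpha>"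
  shows "iter H B \<beta> = ap f \<beta>"
proof -
  have o: "Ord \<beta>" using assms Ord_mem Ord_succ by blast
  have "ap g \<beta> = ap f \<beta>" if "approx H B (succ \<beta>) g" for g
    by (rule approx_unique[OF H that assms(3)]) (use assms o in auto)
  moreover obtain g where "approx H B (succ \<beta>) g" using approx_exists[OF H o] by blast
  ultimately show ?thesis
    unfolding iter_def using o by (intro the_set_eq) metis
qed

lemma mem_iter:
  assumes H: "Fn Df (\<lambda>e. H (e 0))" and "Ord \<alpha>"
  shows "z \<^bold>\<in> iter H B \<alpha> \<longleftrightarrow> z \<^bold>\<in> B \<or> (\<exists>\<gamma>. \<gamma> \<^bold>\<in> \<alpha> \<and> z \<^bold>\<in> H (iter H B \<gamma>))"
proof -
  obtain f where f: "approx H B (succ \<alpha>) f" using approx_exists[OF assms] by blast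
  then show ?thesis using iter_approx[OF assms f] unfolding approx_def by (metis mem_succ)
qed

lemma Fn_iter:
  assumes H: "Fn Df (\<lambda>e. H (e 0))" and t: "Fn Df t" shows "Fn Df (\<lambda>e. iter H B (t e))"
proof (rule Fn_app1[OF good_Df _ t])
  have "\<exists>x. \<forall>z. z \<^bold>\<in> x \<longleftrightarrow> (\<exists>f. Ord \<alpha> \<and> approx H B (succ \<alpha>) f \<and> z \<^bold>\<in> ap f \<alpha>)" for \<alpha>
  proof (cases "Ord \<alpha>")
    case True
    then have "z \<^bold>\<in> iter H B \<alpha> \<longleftrightarrow> (\<exists>f. Ord \<alpha> \<and> approx H B (succ \<alpha>) f \<and> z \<^bold>\<in> ap f \<alpha>)" for z
      using iter_approx[OF H True] approx_exists[OF H True, of B] by (metis mem_succ)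
    then show ?thesis by blast
  next
    case False
    then show ?thesis by (intro exI[of _ zero]) simp
  qed
  from mem_the_set[OF this]
  have m: "z \<^bold>\<in> iter H B \<alpha> \<longleftrightarrow> (\<exists>f. Ord \<alpha> \<and> approx H B (succ \<alpha>) f \<and> z \<^bold>\<in> ap f \<alpha>)" for z \<alpha>
    by (simp add: iter_def)
  have "y = iter H B \<alpha> \<longleftrightarrow> (\<forall>z. z \<^bold>\<in> y \<longleftrightarrow> (\<exists>f. Ord \<alpha> \<and> approx H B (succ \<alpha>) f \<and> z \<^bold>\<in> ap f \<alpha>))" for y \<alpha>
    unfolding m[symmetric] using ext by blast
  then show "Fn Df (\<lambda>e. iter H B (e 0))"
    unfolding Fn_def by (simp only:) (intro defn H)
qed

section \<open>The sets V_\<alpha> and ranks\<close>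

definition VV :: "'a \<Rightarrow> 'a" where "VV \<alpha> = iter powset zero \<alpha>"

lemma Fn_powset_var: "Fn Df (\<lambda>e. powset (e 0))"
  by (intro defn)

lemma Fn_VV [defn]: "Fn Df t \<Longrightarrow> Fn Df (\<lambda>e. VV (t e))"
  unfolding VV_def by (intro Fn_iter Fn_powset_var)

lemma mem_VV: "Ord \<alpha> \<Longrightarrow> z \<^bold>\<in> VV \<alpha> \<longleftrightarrow> (\<exists>\<gamma>. \<gamma> \<^bold>\<in> \<alpha> \<and> subs z (VV \<gamma>))"
  unfolding VV_def by (simp add: mem_iter[OF Fn_powset_var])

text \<open>On the functions over which the description operator ranges, \<open>app\<close> and
  \<open>ap\<close> coincide, so its condition is that of an approximation with step
  \<open>powset\<close> and start \<open>zero\<close>.\<close>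

lemma Vset_VV: assumes "Ord \<alpha>" shows "Vset \<alpha> = VV \<alpha>"
proof -
  have eq: "is_fun f (succ \<alpha>) \<and> (\<forall>\<beta>. \<beta> \<^bold>\<in> succ \<alpha> \<longrightarrow>
        (\<forall>z. z \<^bold>\<in> app f \<beta> \<longleftrightarrow> (\<exists>\<gamma>. \<gamma> \<^bold>\<in> \<beta> \<and> (\<forall>w. w \<^bold>\<in> z \<longrightarrow> w \<^bold>\<in> app f \<gamma>)))) \<longleftrightarrow>
      approx powset zero (succ \<alpha>) f" for f
  proof (cases "is_fun f (succ \<alpha>)")
    case True
    have *: "app f \<beta> = ap f \<beta>" "\<gamma> \<^bold>\<in> \<beta> \<Longrightarrow> app f \<gamma> = ap f \<gamma>" if "\<beta> \<^bold>\<in> succ \<alpha>" for \<beta> \<gamma>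
      using app_ap[OF True] that assms Ord_trans mem_succ by metis+
    have "(\<forall>\<beta>. \<beta> \<^bold>\<in> succ \<alpha> \<longrightarrow>
        (\<forall>z. z \<^bold>\<in> app f \<beta> \<longleftrightarrow> (\<exists>\<gamma>. \<gamma> \<^bold>\<in> \<beta> \<and> (\<forall>w. w \<^bold>\<in> z \<longrightarrow> w \<^bold>\<in> app f \<gamma>)))) \<longleftrightarrow>
      (\<forall>\<beta>. \<beta> \<^bold>\<in> succ \<alpha> \<longrightarrow>
        (\<forall>z. z \<^bold>\<in> ap f \<beta> \<longleftrightarrow> z \<^bold>\<in> zero \<or> (\<exists>\<gamma>. \<gamma> \<^bold>\<in> \<beta> \<and> z \<^bold>\<in> powset (ap f \<gamma>))))"
      by (intro all_cong1 imp_cong refl) (simp add: subs_def * del: mem_succ cong: conj_cong)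
    with True show ?thesis by (simp add: approx_def del: mem_succ)
  qed (simp add: approx_def)
  have "(\<exists>f. (is_fun f (succ \<alpha>) \<and> (\<forall>\<beta>. \<beta> \<^bold>\<in> succ \<alpha> \<longrightarrow>
        (\<forall>z. z \<^bold>\<in> app f \<beta> \<longleftrightarrow> (\<exists>\<gamma>. \<gamma> \<^bold>\<in> \<beta> \<and> (\<forall>w. w \<^bold>\<in> z \<longrightarrow> w \<^bold>\<in> app f \<gamma>))))) \<and> x = app f \<alpha>)
      \<longleftrightarrow> x = VV \<alpha>" for x
    unfolding eq VV_def
    using approx_exists[OF Fn_powset_var assms, of zero] iter_approx[OF Fn_powset_var assms]
      app_ap by (metis approx_def mem_succ)
  then show ?thesis unfolding Vset_def by (simp add: conj_assoc)
qed

lemma VV_trans: "Ord \<alpha> \<Longrightarrow> y \<^bold>\<in> VV \<alpha> \<Longrightarrow> z \<^bold>\<in> y \<Longrightarrow> z \<^bold>\<in> VV \<alpha>"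
  unfolding mem_VV subs_def by (metis Ord_mem Ord_trans mem_VV subs_def)

lemma transitive_VV: "Ord \<alpha> \<Longrightarrow> transitive (VV \<alpha>)"
  unfolding transitive_def using VV_trans by blast

lemma VV_subs: "Ord \<alpha> \<Longrightarrow> y \<^bold>\<in> VV \<alpha> \<Longrightarrow> subs z y \<Longrightarrow> z \<^bold>\<in> VV \<alpha>"
  unfolding mem_VV subs_def by blast

lemma VV_mem: "Ord \<alpha> \<Longrightarrow> \<beta> \<^bold>\<in> \<alpha> \<Longrightarrow> VV \<beta> \<^bold>\<in> VV \<alpha>"
  unfolding mem_VV subs_def by blast

lemma VV_mono: "Ord \<alpha> \<Longrightarrow> \<beta> \<^bold>\<in> \<alpha> \<Longrightarrow> z \<^bold>\<in> VV \<beta> \<Longrightarrow> z \<^bold>\<in> VV \<alpha>"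
  using VV_mem VV_trans by blast

lemma subs_VV: assumes "Ord \<alpha>" shows "subs \<alpha> (VV \<alpha>)"
proof (rule Ord_induct[OF _ assms])
  show "inK Df (\<lambda>e. subs (e 0) (VV (e 0)))" by (intro defn)
  show "subs \<beta> (VV \<beta>)" if "Ord \<beta>" "\<And>\<gamma>. \<gamma> \<^bold>\<in> \<beta> \<Longrightarrow> subs \<gamma> (VV \<gamma>)" for \<beta>
    using that unfolding subs_def[of \<beta>] mem_VV[OF that(1)] by blast
qed

lemma not_mem_VV: assumes "Ord \<alpha>" shows "\<not> \<alpha> \<^bold>\<in> VV \<alpha>"
proof (rule Ord_induct[OF _ assms])
  show "inK Df (\<lambda>e. \<not> e 0 \<^bold>\<in> VV (e 0))" by (intro defn)
  show "\<not> \<beta> \<^bold>\<in> VV \<beta>" if "Ord \<beta>" "\<And>\<gamma>. \<gamma> \<^bold>\<in> \<beta> \<Longrightarrow> \<not> \<gamma> \<^bold>\<in> VV \<gamma>" for \<beta>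
    using that unfolding mem_VV[OF that(1)] subs_def by blast
qed

lemma Ord_mem_VV: "Ord \<alpha> \<Longrightarrow> Ord \<beta> \<Longrightarrow> \<beta> \<^bold>\<in> VV \<alpha> \<longleftrightarrow> \<beta> \<^bold>\<in> \<alpha>"
  using subs_VV[of \<alpha>] not_mem_VV[of \<alpha>] Ord_linear[of \<alpha> \<beta>] VV_trans[of \<alpha> \<beta> \<alpha>]
  unfolding subs_def by blast

lemma VV_inject: "Ord \<alpha> \<Longrightarrow> Ord \<beta> \<Longrightarrow> VV \<alpha> = VV \<beta> \<longleftrightarrow> \<alpha> = \<beta>"
  by (metis Ord_linear Ord_mem_VV not_mem_VV)

text \<open>Passing to the least suitable ordinal makes the relation functional, so replacement
  applies; the bound is the successor of the supremum.\<close>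

lemma Ord_collection:
  assumes R: "inK Df (\<lambda>e. R (e 0) (e 1))" and ex: "\<And>u. u \<^bold>\<in> a \<Longrightarrow> \<exists>\<alpha>. Ord \<alpha> \<and> R u \<alpha>"
  shows "\<exists>\<sigma>. Ord \<sigma> \<and> (\<forall>u. u \<^bold>\<in> a \<longrightarrow> (\<exists>\<alpha>. \<alpha> \<^bold>\<in> \<sigma> \<and> R u \<alpha>))"
proof -
  let ?M = "\<lambda>u \<alpha>. Ord \<alpha> \<and> R u \<alpha> \<and> (\<forall>\<beta>. \<beta> \<^bold>\<in> \<alpha> \<longrightarrow> \<not> R u \<beta>)"
  note Rr = K_app2[OF good_Df R]
  have "\<exists>y. \<forall>v. v \<^bold>\<in> y \<longleftrightarrow> (\<exists>u. u \<^bold>\<in> a \<and> ?M u v)"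
  proof (rule replacement_Df)
    show "inK Df (\<lambda>e. ?M (e 0) (e 1))" by (intro defn Rr)
    fix u assume "u \<^bold>\<in> a"
    then obtain \<alpha> where "Ord \<alpha>" "R u \<alpha>" using ex by blast
    moreover have "inK Df (\<lambda>e. R u (e 0))" by (intro defn Rr)
    ultimately have "\<exists>\<alpha>. ?M u \<alpha>" using Ord_least[where P = "R u"] by blast
    then show "\<exists>!\<alpha>. ?M u \<alpha>" using Ord_linear by blast
  qed
  then obtain y where y: "\<And>v. v \<^bold>\<in> y \<longleftrightarrow> (\<exists>u. u \<^bold>\<in> a \<and> ?M u v)" by blast
  have "Ord (succ (bigcup y))" by (intro Ord_succ Ord_bigcup) (use y in blast)
  moreover have "\<exists>\<alpha>. \<alpha> \<^bold>\<in> succ (bigcup y) \<and> R u \<alpha>" if u: "u \<^bold>\<in> a" for u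
  proof -
    obtain \<alpha> where "Ord \<alpha>" "R u \<alpha>" using ex u by blast
    moreover have "inK Df (\<lambda>e. R u (e 0))" by (intro defn Rr)
    ultimately obtain \<beta> where \<beta>: "?M u \<beta>" using Ord_least[where P = "R u"] by blast
    then have "\<beta> \<^bold>\<in> y" using y u by blast
    then have "subs \<beta> (bigcup y)" by (auto simp: subs_def)
    moreover have "Ord (bigcup y)" by (intro Ord_bigcup) (use y in blast)
    ultimately have "\<beta> \<^bold>\<in> succ (bigcup y)" using Ord_subs \<beta> by simp
    then show ?thesis using \<beta> by blast
  qed
  ultimately show ?thesis by blast
qed

lemma VV_collect:
  assumes "\<And>v. v \<^bold>\<in> u \<Longrightarrow> \<exists>\<alpha>. Ord \<alpha> \<and> v \<^bold>\<in> VV \<alpha>" shows "\<exists>\<alpha>. Ord \<alpha> \<and> u \<^bold>\<in> VV \<alpha>"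
proof -
  have "inK Df (\<lambda>e. e 0 \<^bold>\<in> VV (e 1))" by (intro defn)
  from Ord_collection[where R = "\<lambda>u \<alpha>. u \<^bold>\<in> VV \<alpha>", OF this assms]
  obtain \<sigma> where s: "Ord \<sigma>" "\<And>v. v \<^bold>\<in> u \<Longrightarrow> \<exists>\<alpha>. \<alpha> \<^bold>\<in> \<sigma> \<and> v \<^bold>\<in> VV \<alpha>" by blast
  then have "subs u (VV \<sigma>)" unfolding subs_def using VV_mono by blast
  then have "u \<^bold>\<in> VV (succ \<sigma>)" using s(1) by (auto simp: mem_VV)
  then show ?thesis using s(1) Ord_succ by blast
qed

text \<open>\<open>T\<close> is the transitive closure of \<open>x\<close>. An \<in>-minimal element
  of \<open>T\<close> without a rank would have elements that all have ranks, and these are bounded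
  by collection.\<close>

lemma ex_VV: "\<exists>\<alpha>. Ord \<alpha> \<and> x \<^bold>\<in> VV \<alpha>"
proof -
  have B: "Fn Df (\<lambda>e. bigcup (e 0))" by (intro defn)
  define T where "T = iter bigcup x omega"
  have xT: "z \<^bold>\<in> T" if "z \<^bold>\<in> x" for z unfolding T_def using that by (simp add: mem_iter[OF B])
  have T: "z \<^bold>\<in> T" if y: "y \<^bold>\<in> T" and z: "z \<^bold>\<in> y" for y z
  proof -
    have "\<exists>k. k \<^bold>\<in> omega \<and> y \<^bold>\<in> iter bigcup x k"
    proof (cases "y \<^bold>\<in> x")
      case True
      then show ?thesis by (intro exI[of _ zero]) (simp add: mem_iter[OF B])
    next
      case False
      then obtain k where k: "k \<^bold>\<in> omega" "y \<^bold>\<in> bigcup (iter bigcup x k)"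
        using y unfolding T_def mem_iter[OF B Ord_omega] by blast
      then have "y \<^bold>\<in> iter bigcup x (succ k)"
        using Ord_mem[OF Ord_omega] by (subst mem_iter[OF B]) auto
      then show ?thesis using k succ_omega by blast
    qed
    then show ?thesis using z unfolding T_def mem_iter[OF B Ord_omega] by auto
  qed
  let ?P = "\<lambda>v. \<exists>\<alpha>. Ord \<alpha> \<and> v \<^bold>\<in> VV \<alpha>"
  have X: "z \<^bold>\<in> Sep T (\<lambda>v. \<not> ?P v) \<longleftrightarrow> z \<^bold>\<in> T \<and> \<not> ?P z" for z
    by (rule mem_Sep) (intro defn)
  have "?P v" if "v \<^bold>\<in> T" for v
  proof (rule ccontr)
    assume "\<not> ?P v"
    then have "v \<^bold>\<in> Sep T (\<lambda>v. \<not> ?P v)" using X that by blast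
    from foundation_min[OF this] obtain u where
      u: "u \<^bold>\<in> T" "\<not> ?P u" "\<And>z. z \<^bold>\<in> u \<Longrightarrow> \<not> (z \<^bold>\<in> T \<and> \<not> ?P z)"
      unfolding X by blast
    then show False using VV_collect[of u] T by blast
  qed
  then show ?thesis using VV_collect[of x] xT by blast
qed

text \<open>The ranks of witnesses are ordinals, so collection for ordinals bounds them, and one
  V_\<sigma> contains enough witnesses.\<close>

lemma collection:
  assumes R: "inK Df (\<lambda>e. R (e 0) (e 1))" and ex: "\<And>u. u \<^bold>\<in> a \<Longrightarrow> \<exists>v. R u v"
  shows "\<exists>w. \<forall>u. u \<^bold>\<in> a \<longrightarrow> (\<exists>v. v \<^bold>\<in> w \<and> R u v)"
proof -
  have "inK Df (\<lambda>e. \<exists>v. v \<^bold>\<in> VV (e 1) \<and> R (e 0) v)" by (intro defn K_app2[OF good_Df R])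
  moreover have "\<exists>\<alpha>. Ord \<alpha> \<and> (\<exists>v. v \<^bold>\<in> VV \<alpha> \<and> R u v)" if "u \<^bold>\<in> a" for u
    using ex[OF that] ex_VV by metis
  ultimately obtain \<sigma> where "Ord \<sigma>" "\<forall>u. u \<^bold>\<in> a \<longrightarrow> (\<exists>\<alpha>. \<alpha> \<^bold>\<in> \<sigma> \<and> (\<exists>v. v \<^bold>\<in> VV \<alpha> \<and> R u v))"
    using Ord_collection[where R = "\<lambda>u \<alpha>. \<exists>v. v \<^bold>\<in> VV \<alpha> \<and> R u v" and a = a] by blast
  then show ?thesis using VV_mono by (intro exI[of _ "VV \<sigma>"]) blast
qed

end

section \<open>The Levy hierarchy\<close>

lemma Sigma_ren: "Sigma_fm n p \<Longrightarrow> Sigma_fm n (ren p f)"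
  using Sigma_Pi_ren[of n p 0 undefined] by simp

lemma case_nat_eta [simp]: "case_nat (e 0) (\<lambda>i. e (Suc i)) = e"
  by (rule ext) (simp split: nat.split)

context set_structure
begin

section \<open>The Levy classes of predicates\<close>

definition D0 :: "((nat \<Rightarrow> 'a) \<Rightarrow> bool) \<Rightarrow> bool" where
  "D0 P \<longleftrightarrow> (\<exists>p. delta0 p \<and> (\<forall>e. sat UNIV e p \<longleftrightarrow> P e))"

text \<open>One unbounded quantifier per level. In contrast to \<open>Df\<close> there are no
  parameters: a predicate of these classes is a pure formula, which an embedding transfers by moving
  the environment.\<close>

primrec Sg :: "nat \<Rightarrow> ((nat \<Rightarrow> 'a) \<Rightarrow> bool) \<Rightarrow> bool" where
  "Sg 0 P = D0 P"
| "Sg (Suc n) P = (\<exists>R. Sg n R \<and> P = (\<lambda>e. \<exists>x. \<not> R (case_nat x e)))"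

definition Pg :: "nat \<Rightarrow> ((nat \<Rightarrow> 'a) \<Rightarrow> bool) \<Rightarrow> bool" where
  "Pg n P \<longleftrightarrow> Sg n (\<lambda>e. \<not> P e)"

definition Dl :: "nat \<Rightarrow> ((nat \<Rightarrow> 'a) \<Rightarrow> bool) \<Rightarrow> bool" where
  "Dl n P \<longleftrightarrow> Sg n P \<and> Pg n P"

text \<open>Connects the two conventions: the variable pushed in front of the environment becomes
  the fresh named variable \<open>k\<close>, and all others keep their names.\<close>

lemma sat_Ex_ren:
  assumes "\<forall>i\<in>vars p. i < k"
  shows "sat A e (Ex k (ren p (case_nat k id))) \<longleftrightarrow> (\<exists>x\<in>A. sat A (case_nat x e) p)"
proof -
  have "sat A (\<lambda>i. (e(k := x)) (case_nat k id i)) p \<longleftrightarrow> sat A (case_nat x e) p" for x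
    using assms by (intro sat_cong) (fastforce split: nat.split)
  then show ?thesis by (simp add: sat_ren)
qed

lemma Sg_formula_aux: "Sg n P \<Longrightarrow> (\<exists>p. Sigma_fm n p \<and> (\<forall>e. sat UNIV e p \<longleftrightarrow> P e)) \<and>
  (\<exists>p. Pi_fm n p \<and> (\<forall>e. sat UNIV e p \<longleftrightarrow> \<not> P e))"
proof (induction n arbitrary: P)
  case 0
  then obtain p where p: "delta0 p" "\<And>e. sat UNIV e p \<longleftrightarrow> P e" by (auto simp: D0_def)
  then show ?case
    by (intro conjI exI[of _ p] exI[of _ "Neg p"]) (auto intro: Sigma_fm_Pi_fm.intros delta0.intros)
next
  case (Suc n)
  then obtain R where R: "Sg n R" "P = (\<lambda>e. \<exists>x. \<not> R (case_nat x e))" by auto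
  obtain p q where p: "Sigma_fm n p" "\<And>e. sat UNIV e p \<longleftrightarrow> R e"
    and q: "Pi_fm n q" "\<And>e. sat UNIV e q \<longleftrightarrow> \<not> R e" using Suc.IH[OF R(1)] by blast
  obtain k l where k: "\<forall>i\<in>vars p. i < k" and l: "\<forall>i\<in>vars q. i < l" using vars_bound by metis
  have "Sigma_fm (Suc n) (Ex l (ren q (case_nat l id)))"
    using q by (intro Sigma_fm_Pi_fm.intros Pi_ren)
  moreover have "Pi_fm (Suc n) (All k (ren p (case_nat k id)))"
    using p by (intro Sigma_fm_Pi_fm.intros Sigma_ren)
  moreover have "sat UNIV e (All k (ren p (case_nat k id))) \<longleftrightarrow> (\<forall>x. sat UNIV (case_nat x e) p)" for e
    using sat_Ex_ren[of "Neg p" k UNIV e] k by (simp add: All_def)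
  ultimately show ?case
    using sat_Ex_ren[OF l] p q R by (metis UNIV_I)
qed

lemma Sg_formula: "inK (Sg n) P \<Longrightarrow> \<exists>p. Sigma_fm n p \<and> (\<forall>e. sat UNIV e p \<longleftrightarrow> P e)"
  using Sg_formula_aux by (simp add: inK_def)

lemma Pg_formula: "inK (Pg n) P \<Longrightarrow> \<exists>p. Pi_fm n p \<and> (\<forall>e. sat UNIV e p \<longleftrightarrow> P e)"
  using Sg_formula_aux[of n "\<lambda>e. \<not> P e"] by (simp add: inK_def Pg_def)

text \<open>What remains of the closure properties for Sigma_n and Pi_n, which lack negation and
  substitution of functions.\<close>

definition closed :: "(((nat \<Rightarrow> 'a) \<Rightarrow> bool) \<Rightarrow> bool) \<Rightarrow> bool" where
  "closed K \<longleftrightarrow> (\<forall>P Q. inK K P \<longrightarrow> inK K Q \<longrightarrow> inK K (\<lambda>e. P e \<and> Q e)) \<and>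
     (\<forall>P Q. inK K P \<longrightarrow> inK K Q \<longrightarrow> inK K (\<lambda>e. P e \<or> Q e)) \<and>
     (\<forall>P f. inK K P \<longrightarrow> inK K (\<lambda>e. P (\<lambda>i. e (f i)))) \<and>
     (\<forall>P i. inK K P \<longrightarrow> inK K (\<lambda>e. \<exists>x. x \<^bold>\<in> e i \<and> P (case_nat x e))) \<and>
     (\<forall>P i. inK K P \<longrightarrow> inK K (\<lambda>e. \<forall>x. x \<^bold>\<in> e i \<longrightarrow> P (case_nat x e)))"

lemma C_conj: "closed K \<Longrightarrow> inK K P \<Longrightarrow> inK K Q \<Longrightarrow> inK K (\<lambda>e. P e \<and> Q e)"
  by (simp add: closed_def)

lemma C_disj: "closed K \<Longrightarrow> inK K P \<Longrightarrow> inK K Q \<Longrightarrow> inK K (\<lambda>e. P e \<or> Q e)"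
  by (simp add: closed_def)

lemma C_rename: "closed K \<Longrightarrow> inK K P \<Longrightarrow> inK K (\<lambda>e. P (\<lambda>i. e (f i)))"
  by (simp add: closed_def)

lemma C_rename1: "closed K \<Longrightarrow> inK K (\<lambda>e. R (e 0) (\<lambda>i. e (Suc i))) \<Longrightarrow> inK K (\<lambda>e. R (e j) (\<lambda>i. e (f i)))"
  by (drule C_rename[of K _ "case_nat j f"], assumption) simp

lemma C_bex: "closed K \<Longrightarrow> inK K (\<lambda>e. P (e 0) (\<lambda>i. e (Suc i))) \<Longrightarrow> inK K (\<lambda>e. \<exists>x. x \<^bold>\<in> e i \<and> P x e)"
  unfolding closed_def by fastforce

lemma C_ball: "closed K \<Longrightarrow> inK K (\<lambda>e. P (e 0) (\<lambda>i. e (Suc i))) \<Longrightarrow> inK K (\<lambda>e. \<forall>x. x \<^bold>\<in> e i \<longrightarrow> P x e)"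
  unfolding closed_def by fastforce

lemma closed_Pg: assumes "closed (Sg n)" shows "closed (Pg n)"
proof -
  have c: "closed (Sg n)" by fact
  have "inK (Pg n) (\<lambda>e. \<exists>x. x \<^bold>\<in> e i \<and> P (case_nat x e))" if "inK (Pg n) P" for P i
    using C_ball[OF c, of "\<lambda>x e. \<not> P (case_nat x e)" i] that by (simp add: inK_def Pg_def)
  moreover have "inK (Pg n) (\<lambda>e. \<forall>x. x \<^bold>\<in> e i \<longrightarrow> P (case_nat x e))" if "inK (Pg n) P" for P i
    using C_bex[OF c, of "\<lambda>x e. \<not> P (case_nat x e)" i] that by (simp add: inK_def Pg_def)
  moreover have "inK (Pg n) (\<lambda>e. P (\<lambda>i. e (f i)))" if "inK (Pg n) P" for P f
    using C_rename[OF c, of "\<lambda>e. \<not> P e"] that by (simp add: inK_def Pg_def)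
  moreover have "inK (Pg n) (\<lambda>e. P e \<and> Q e) \<and> inK (Pg n) (\<lambda>e. P e \<or> Q e)" if "inK (Pg n) P" "inK (Pg n) Q" for P Q
    using C_disj[OF c, of "\<lambda>e. \<not> P e" "\<lambda>e. \<not> Q e"] C_conj[OF c, of "\<lambda>e. \<not> P e" "\<lambda>e. \<not> Q e"] that
    by (simp add: inK_def Pg_def)
  ultimately show ?thesis unfolding closed_def by blast
qed

lemma Sg_SucI: "inK (Pg n) (\<lambda>e. P (e 0) (\<lambda>i. e (Suc i))) \<Longrightarrow> inK (Sg (Suc n)) (\<lambda>e. \<exists>x. P x e)"
  unfolding inK_def Pg_def Sg.simps by (intro exI conjI, assumption) simp

lemma Sg_SucE:
  assumes "inK (Sg (Suc n)) P"
  obtains R where "inK (Pg n) (\<lambda>e. R (e 0) (\<lambda>i. e (Suc i)))" "P = (\<lambda>e. \<exists>x. R x e)"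
proof -
  obtain R where R: "Sg n R" "P = (\<lambda>e. \<exists>x. \<not> R (case_nat x e))" using assms by (auto simp: inK_def)
  show ?thesis
    by (rule that[of "\<lambda>x e. \<not> R (case_nat x e)"]) (use R in \<open>simp_all add: inK_def Pg_def\<close>)
qed

lemma D0_closed: "closed (Sg 0)" "inK (Sg 0) P \<Longrightarrow> inK (Sg 0) (\<lambda>e. \<not> P e)"
proof -
  have neg: "inK (Sg 0) (\<lambda>e. \<not> P e)" if "inK (Sg 0) P" for P
    using that delta0.intros(3) unfolding inK_def Sg.simps D0_def by (metis sat.simps(3))
  have conj: "inK (Sg 0) (\<lambda>e. P e \<and> Q e)" if "inK (Sg 0) P" "inK (Sg 0) Q" for P Q
    using that delta0.intros(4) unfolding inK_def Sg.simps D0_def by (metis sat.simps(4))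
  have disj: "inK (Sg 0) (\<lambda>e. P e \<or> Q e)" if "inK (Sg 0) P" "inK (Sg 0) Q" for P Q
    using neg[OF conj[OF neg[OF that(1)] neg[OF that(2)]]] by simp
  have ren: "inK (Sg 0) (\<lambda>e. P (\<lambda>i. e (f i)))" if "inK (Sg 0) P" for P f
    using that delta0_ren unfolding inK_def Sg.simps D0_def by (metis sat_ren)
  have bex: "inK (Sg 0) (\<lambda>e. \<exists>x. x \<^bold>\<in> e i \<and> P (case_nat x e))" if P: "inK (Sg 0) P" for P i
  proof -
    obtain p where p: "delta0 p" "\<And>e. sat UNIV e p \<longleftrightarrow> P e" using P by (auto simp: inK_def D0_def)
    obtain k where k: "\<forall>j\<in>vars (And (Mem 0 (Suc i)) p). j < k" using vars_bound by metis
    then have "delta0 (Ex k (ren (And (Mem 0 (Suc i)) p) (case_nat k id)))"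
      using p by (auto intro!: delta0.intros delta0_ren)
    then show ?thesis unfolding inK_def Sg.simps D0_def
      using sat_Ex_ren[OF k, of UNIV] p by (intro exI[of _ "Ex k (ren (And (Mem 0 (Suc i)) p) (case_nat k id))"]) simp
  qed
  have "inK (Sg 0) (\<lambda>e. \<forall>x. x \<^bold>\<in> e i \<longrightarrow> P (case_nat x e))" if "inK (Sg 0) P" for P i
    using neg[OF bex[OF neg[OF that]], of i] by simp
  with conj disj ren bex show "closed (Sg 0)" unfolding closed_def by blast
  show "inK (Sg 0) P \<Longrightarrow> inK (Sg 0) (\<lambda>e. \<not> P e)" by (rule neg)
qed

end

context zfc
begin

text \<open>Entries of the environment can be frozen into parameters. This is what allows collection
  to be applied with a fixed environment.\<close>

lemma Df_inst:
  assumes "inK Df P" shows "inK Df (\<lambda>e. P (\<lambda>i. case h i of Inl c \<Rightarrow> c | Inr k \<Rightarrow> e k))"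
proof -
  obtain p g where P: "\<And>e. P e \<longleftrightarrow> sat UNIV (\<lambda>i. case g i of Inl c \<Rightarrow> c | Inr k \<Rightarrow> e k) p"
    using assms by (auto simp: Df_def inK_def)
  have "(\<lambda>i. case g i of Inl c \<Rightarrow> c | Inr k \<Rightarrow> (case h k of Inl c \<Rightarrow> c | Inr k \<Rightarrow> e k)) =
      (\<lambda>i. case (case g i of Inl c \<Rightarrow> Inl c | Inr k \<Rightarrow> h k) of Inl c \<Rightarrow> c | Inr k \<Rightarrow> e k)" for e
    by (rule HOL.ext) (simp split: sum.split)
  then show ?thesis unfolding inK_def Df_def P
    by (intro exI[of _ p] exI[of _ "\<lambda>i. case g i of Inl c \<Rightarrow> Inl c | Inr k \<Rightarrow> h k"]) simp
qed

lemma Sg_Df: "inK (Sg n) P \<Longrightarrow> inK Df P"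
proof (induction n arbitrary: P)
  case 0
  then obtain p where "\<And>e. sat UNIV e p \<longleftrightarrow> P e" by (auto simp: inK_def D0_def)
  then show ?case unfolding inK_def Df_def by (intro exI[of _ p] exI[of _ Inr]) simp
next
  case (Suc n)
  then obtain R where R: "Sg n R" "P = (\<lambda>e. \<exists>x. \<not> R (case_nat x e))" by (auto simp: inK_def)
  have "inK Df R" using Suc.IH R(1) by (simp add: inK_def)
  then show ?case unfolding R(2) by (intro defn) simp
qed

lemma Pg_Df: "inK (Pg n) P \<Longrightarrow> inK Df P"
  using Sg_Df[of n "\<lambda>e. \<not> P e"] K_neg[OF good_Df, of "\<lambda>e. \<not> P e"] by (simp add: inK_def Pg_def)

text \<open>Two witnesses are gathered in one set \<open>w\<close>, so a single unbounded quantifier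
  suffices for a conjunction. A bounded universal quantifier is moved inside the unbounded
  existential one by collection.\<close>

lemma closed_Sg: "closed (Sg n)"
proof (induction n)
  case 0
  show ?case by (rule D0_closed)
next
  case (Suc n)
  have c: "closed (Pg n)" by (rule closed_Pg[OF Suc.IH])
  show ?case unfolding closed_def
  proof (intro conjI allI impI)
    fix P Q assume "inK (Sg (Suc n)) P" "inK (Sg (Suc n)) Q"
    then obtain R R' where
      R: "inK (Pg n) (\<lambda>e. R (e 0) (\<lambda>i. e (Suc i)))" "P = (\<lambda>e. \<exists>x. R x e)" and
      R': "inK (Pg n) (\<lambda>e. R' (e 0) (\<lambda>i. e (Suc i)))" "Q = (\<lambda>e. \<exists>x. R' x e)"
      by (elim Sg_SucE) blast
    have "P e \<and> Q e \<longleftrightarrow> (\<exists>w. \<exists>x. x \<^bold>\<in> w \<and> (\<exists>y. y \<^bold>\<in> w \<and> (R x e \<and> R' y e)))" for e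
      unfolding R R' by (metis mem_upair)
    moreover have "inK (Sg (Suc n)) (\<lambda>e. \<exists>w. \<exists>x. x \<^bold>\<in> w \<and> (\<exists>y. y \<^bold>\<in> w \<and> (R x e \<and> R' y e)))"
      by (intro Sg_SucI C_bex[OF c] C_conj[OF c] C_rename1[OF c R(1)] C_rename1[OF c R'(1)])
    ultimately show "inK (Sg (Suc n)) (\<lambda>e. P e \<and> Q e)" by simp
    have "inK (Sg (Suc n)) (\<lambda>e. \<exists>x. R x e \<or> R' x e)"
      by (intro Sg_SucI C_disj[OF c] R R')
    then show "inK (Sg (Suc n)) (\<lambda>e. P e \<or> Q e)" by (simp add: R R' ex_disj_distrib)
  next
    fix P f assume "inK (Sg (Suc n)) P"
    then obtain R where R: "inK (Pg n) (\<lambda>e. R (e 0) (\<lambda>i. e (Suc i)))" "P = (\<lambda>e. \<exists>x. R x e)"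
      by (rule Sg_SucE)
    show "inK (Sg (Suc n)) (\<lambda>e. P (\<lambda>i. e (f i)))"
      unfolding R(2) by (intro Sg_SucI C_rename1[OF c R(1)])
  next
    fix P i assume "inK (Sg (Suc n)) P"
    then obtain R where R: "inK (Pg n) (\<lambda>e. R (e 0) (\<lambda>i. e (Suc i)))" "P = (\<lambda>e. \<exists>x. R x e)"
      by (rule Sg_SucE)
    have R2: "inK (Pg n) (\<lambda>e. R (e a) (case_nat (e b) (\<lambda>i. e (f i))))" for a b f
    proof -
      have "case_nat (e b) (\<lambda>i. e (f i)) = (\<lambda>i. e (case_nat b f i))" for e :: "nat \<Rightarrow> 'a"
        by (rule HOL.ext) (simp split: nat.split)
      then show ?thesis using C_rename1[OF c R(1), of a "case_nat b f"] by simp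
    qed
    have "(\<exists>y. y \<^bold>\<in> e i \<and> P (case_nat y e)) \<longleftrightarrow> (\<exists>x y. y \<^bold>\<in> e i \<and> R x (case_nat y e))" for e
      unfolding R by blast
    moreover have "inK (Sg (Suc n)) (\<lambda>e. \<exists>x y. y \<^bold>\<in> e i \<and> R x (case_nat y e))"
      by (intro Sg_SucI C_bex[OF c] R2)
    ultimately show "inK (Sg (Suc n)) (\<lambda>e. \<exists>y. y \<^bold>\<in> e i \<and> P (case_nat y e))" by simp
    have "(\<forall>y. y \<^bold>\<in> e i \<longrightarrow> P (case_nat y e)) \<longleftrightarrow>
        (\<exists>w. \<forall>y. y \<^bold>\<in> e i \<longrightarrow> (\<exists>x. x \<^bold>\<in> w \<and> R x (case_nat y e)))" for e
    proof
      assume l: "\<forall>y. y \<^bold>\<in> e i \<longrightarrow> P (case_nat y e)"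
      have "inK Df (\<lambda>e'. R (e' 1) (case_nat (e' 0) e))"
      proof -
        let ?h = "case_nat (Inr 1) (case_nat (Inr 0) (\<lambda>i. Inl (e i)))"
        have "(\<lambda>i. case ?h i of Inl c \<Rightarrow> c | Inr k \<Rightarrow> e' k) = case_nat (e' 1) (case_nat (e' 0) e)" for e' :: "nat \<Rightarrow> 'a"
          by (rule HOL.ext) (simp split: nat.split)
        moreover define Rc where "Rc = (\<lambda>e'. R (e' 0) (\<lambda>i. e' (Suc i)))"
        have "inK Df Rc" using Pg_Df[OF R(1)] by (simp only: Rc_def)
        from Df_inst[OF this, of ?h] have
          "inK Df (\<lambda>e'. Rc (\<lambda>i. case ?h i of Inl c \<Rightarrow> c | Inr k \<Rightarrow> e' k))" .
        ultimately have "inK Df (\<lambda>e'. Rc (case_nat (e' 1) (case_nat (e' 0) e)))"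
          by (simp only:)
        then show ?thesis by (simp add: Rc_def)
      qed
      moreover have "\<exists>x. R x (case_nat y e)" if "y \<^bold>\<in> e i" for y
        using l that unfolding R by blast
      ultimately show "\<exists>w. \<forall>y. y \<^bold>\<in> e i \<longrightarrow> (\<exists>x. x \<^bold>\<in> w \<and> R x (case_nat y e))"
        using collection[where R = "\<lambda>y x. R x (case_nat y e)"] by blast
    qed (unfold R, blast)
    moreover have "inK (Sg (Suc n)) (\<lambda>e. \<exists>w. \<forall>y. y \<^bold>\<in> e i \<longrightarrow> (\<exists>x. x \<^bold>\<in> w \<and> R x (case_nat y e)))"
      by (intro Sg_SucI C_bex[OF c] C_ball[OF c] R2)
    ultimately show "inK (Sg (Suc n)) (\<lambda>e. \<forall>y. y \<^bold>\<in> e i \<longrightarrow> P (case_nat y e))" by simp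
  qed
qed

lemma Pg_Suc: "inK (Pg n) P \<Longrightarrow> inK (Sg (Suc n)) P"
  using Sg_SucI[of n "\<lambda>x e. P e"] C_rename[OF closed_Pg[OF closed_Sg], of n P Suc] by simp

lemma Sg_Suc: "inK (Sg n) P \<Longrightarrow> inK (Sg (Suc n)) P"
proof (induction n arbitrary: P)
  case 0
  then have "inK (Pg 0) P" using D0_closed(2)[OF 0] by (simp add: inK_def Pg_def)
  then show ?case by (rule Pg_Suc)
next
  case (Suc n)
  then obtain R where R: "Sg n R" "P = (\<lambda>e. \<exists>x. \<not> R (case_nat x e))" by (auto simp: inK_def)
  then have "Sg (Suc n) R" using Suc.IH by (simp only: inK_def)
  then show ?case using R(2) unfolding inK_def by (subst Sg.simps) blast
qed

lemma Dl_iff: "inK (Dl n) P \<longleftrightarrow> inK (Sg n) P \<and> inK (Pg n) P"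
  by (simp add: inK_def Dl_def)

lemma Pg_neg: "inK (Pg n) P \<longleftrightarrow> inK (Sg n) (\<lambda>e. \<not> P e)"
  by (simp add: inK_def Pg_def)

lemma Dl_Suc: "inK (Sg n) P \<or> inK (Pg n) P \<Longrightarrow> inK (Dl (Suc n)) P"
  unfolding Dl_iff Pg_neg using Sg_Suc Pg_Suc[of n P] Pg_Suc[of n "\<lambda>e. \<not> P e"] Sg_Suc[of n "\<lambda>e. \<not> P e"]
  by (auto simp: Pg_neg)

lemma Dl_mono: "m \<le> n \<Longrightarrow> inK (Dl m) P \<Longrightarrow> inK (Dl n) P"
  by (induction rule: dec_induct) (use Dl_Suc Dl_iff in blast)+

text \<open>Two adjacent existential quantifiers contract to one over a set that contains both
  witnesses.\<close>

lemma Sg_ex: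
  assumes "inK (Sg (Suc n)) (\<lambda>e. P (e 0) (\<lambda>i. e (Suc i)))" shows "inK (Sg (Suc n)) (\<lambda>e. \<exists>x. P x e)"
proof -
  obtain R where R: "inK (Pg n) (\<lambda>e. R (e 0) (\<lambda>i. e (Suc i)))"
    "(\<lambda>e. P (e 0) (\<lambda>i. e (Suc i))) = (\<lambda>e. \<exists>x. R x e)"
    using assms by (rule Sg_SucE)
  note c = closed_Pg[OF closed_Sg]
  have "P x e \<longleftrightarrow> (\<exists>y. R y (case_nat x e))" for x e
    using fun_cong[OF R(2), of "case_nat x e"] by simp
  then have "(\<exists>x. P x e) \<longleftrightarrow> (\<exists>w. \<exists>x. x \<^bold>\<in> w \<and> (\<exists>y. y \<^bold>\<in> w \<and> R y (case_nat x e)))" for e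
    by (metis mem_upair)
  moreover have R2: "inK (Pg n) (\<lambda>e. R (e a) (case_nat (e b) (\<lambda>i. e (f i))))" for a b f
  proof -
    have "case_nat (e b) (\<lambda>i. e (f i)) = (\<lambda>i. e (case_nat b f i))" for e :: "nat \<Rightarrow> 'a"
      by (rule HOL.ext) (simp split: nat.split)
    then show ?thesis using C_rename1[OF c R(1), of a "case_nat b f"] by simp
  qed
  moreover have "inK (Sg (Suc n)) (\<lambda>e. \<exists>w. \<exists>x. x \<^bold>\<in> w \<and> (\<exists>y. y \<^bold>\<in> w \<and> R y (case_nat x e)))"
    by (intro Sg_SucI C_bex[OF c] R2)
  ultimately show ?thesis by simp
qed

text \<open>For the last clause of \<open>good\<close>, uniqueness of the value turns the negation
  into an existential statement as well, so that both the predicate and its negation are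
  Sigma_(n+1).\<close>

lemma good_Dl [defn]: "good (Dl (Suc n))"
proof -
  have cS: "closed (Sg (Suc n))" and cP: "closed (Pg (Suc n))" using closed_Sg closed_Pg by blast+
  have at: "inK (Dl (Suc n)) P" if "inK (Sg 0) P" for P
    using Dl_mono[of "Suc 0" "Suc n", OF _ Dl_Suc] that by simp
  have "inK (Sg 0) (\<lambda>e. e i \<^bold>\<in> e j)" "inK (Sg 0) (\<lambda>e. e i = e j)" for i j
    unfolding inK_def Sg.simps D0_def using delta0.intros(1,2) by (metis sat.simps(1), metis sat.simps(2))
  then have "inK (Dl (Suc n)) (\<lambda>e. e i \<^bold>\<in> e j)" "inK (Dl (Suc n)) (\<lambda>e. e i = e j)" for i j
    using at by blast+
  moreover have "inK (Dl (Suc n)) (\<lambda>e. \<not> P e)" if "inK (Dl (Suc n)) P" for P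
    using that by (simp add: Dl_iff Pg_neg)
  moreover have "inK (Dl (Suc n)) (\<lambda>e. P e \<and> Q e)" if "inK (Dl (Suc n)) P" "inK (Dl (Suc n)) Q" for P Q
    using that C_conj[OF cS] C_conj[OF cP] unfolding Dl_iff by blast
  moreover have "inK (Dl (Suc n)) (\<lambda>e. P (\<lambda>i. e (f i)))" if "inK (Dl (Suc n)) P" for P f
    using that C_rename[OF cS] C_rename[OF cP] unfolding Dl_iff by blast
  moreover have "inK (Dl (Suc n)) (\<lambda>e. \<exists>x. x \<^bold>\<in> e i \<and> P (case_nat x e))" if "inK (Dl (Suc n)) P" for P i
    using that C_bex[OF cS, of "\<lambda>x e. P (case_nat x e)"] C_bex[OF cP, of "\<lambda>x e. P (case_nat x e)"]
    unfolding Dl_iff by simp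
  moreover have "inK (Dl (Suc n)) (\<lambda>e. \<exists>y. T (case_nat y e) \<and> P (case_nat y e))"
    if "inK (Dl (Suc n)) P" "inK (Dl (Suc n)) T" and u: "\<forall>e. \<exists>!y. T (case_nat y e)" for P T
  proof -
    have *: "inK (Sg (Suc n)) (\<lambda>e. \<exists>y. T (case_nat y e) \<and> Q (case_nat y e))" if "inK (Sg (Suc n)) Q" for Q
      using Sg_ex[of n "\<lambda>y e. T (case_nat y e) \<and> Q (case_nat y e)"] C_conj[OF cS, of T Q] that
        \<open>inK (Dl (Suc n)) T\<close> by (simp add: Dl_iff)
    have "(\<not> (\<exists>y. T (case_nat y e) \<and> P (case_nat y e))) \<longleftrightarrow> (\<exists>y. T (case_nat y e) \<and> \<not> P (case_nat y e))" for e
      using u by metis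
    then show ?thesis
      using *[of P] *[of "\<lambda>e. \<not> P e"] that(1) unfolding Dl_iff Pg_neg by simp
  qed
  ultimately show ?thesis unfolding good_def by blast
qed

lemma Dl_Df: "inK (Dl n) P \<Longrightarrow> inK Df P"
  by (auto simp: Dl_iff intro: Sg_Df)

end

section \<open>Satisfaction inside the model\<close>

context zfc
begin

section \<open>Ranks of pairs and functions, limit ordinals\<close>

lemma Ord_upper: "Ord \<alpha> \<Longrightarrow> Ord \<beta> \<Longrightarrow> \<exists>\<gamma>. Ord \<gamma> \<and> (\<alpha> = \<gamma> \<or> \<alpha> \<^bold>\<in> \<gamma>) \<and> (\<beta> = \<gamma> \<or> \<beta> \<^bold>\<in> \<gamma>)"
  using Ord_linear by blast

lemma ex_VV2: "\<exists>\<alpha>. Ord \<alpha> \<and> x \<^bold>\<in> VV \<alpha> \<and> y \<^bold>\<in> VV \<alpha>"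
  using ex_VV[of x] ex_VV[of y] Ord_upper VV_mono by metis

lemma opair_VV_succ: "Ord \<alpha> \<Longrightarrow> x \<^bold>\<in> VV \<alpha> \<Longrightarrow> y \<^bold>\<in> VV \<alpha> \<Longrightarrow> opair x y \<^bold>\<in> VV (succ (succ \<alpha>))"
  unfolding opair_def by (force simp: mem_VV[of "succ _"] subs_def)

lemma opair_VV_inv:
  assumes "Ord \<alpha>" "opair x y \<^bold>\<in> VV \<alpha>" shows "\<exists>\<gamma>. \<gamma> \<^bold>\<in> \<alpha> \<and> x \<^bold>\<in> VV \<gamma> \<and> y \<^bold>\<in> VV \<gamma>"
proof -
  obtain \<gamma> where g: "\<gamma> \<^bold>\<in> \<alpha>" "subs (opair x y) (VV \<gamma>)" using assms by (auto simp: mem_VV)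
  then have "upair x y \<^bold>\<in> VV \<gamma>" unfolding opair_def subs_def by auto
  then show ?thesis using g assms VV_trans Ord_mem by (metis mem_upair)
qed

text \<open>A pair lies two levels above its components, and a set of pairs one level
  higher.\<close>

lemma fun_VV: "Ord \<alpha> \<Longrightarrow> subs A (VV \<alpha>) \<Longrightarrow> subs B (VV \<alpha>) \<Longrightarrow> maps f A B \<Longrightarrow> f \<^bold>\<in> VV (succ (succ (succ \<alpha>)))"
  unfolding mem_VV[OF Ord_succ[OF Ord_succ[OF Ord_succ]]] maps_def subs_def
  using opair_VV_succ[of \<alpha>] mem_fun[of f A] by (metis mem_succ)

lemma ex_product: "\<exists>w. \<forall>x y. x \<^bold>\<in> A \<and> y \<^bold>\<in> B \<longrightarrow> opair x y \<^bold>\<in> w"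
  using ex_VV2[of A B] opair_VV_succ VV_trans by metis

definition Lim :: "'a \<Rightarrow> bool" where
  "Lim \<alpha> \<longleftrightarrow> Ord \<alpha> \<and> zero \<^bold>\<in> \<alpha> \<and> (\<forall>\<beta>. \<beta> \<^bold>\<in> \<alpha> \<longrightarrow> succ \<beta> \<^bold>\<in> \<alpha>)"

lemma Lim_Ord: "Lim \<alpha> \<Longrightarrow> Ord \<alpha>" and Lim_succ: "Lim \<alpha> \<Longrightarrow> \<beta> \<^bold>\<in> \<alpha> \<Longrightarrow> succ \<beta> \<^bold>\<in> \<alpha>"
  by (auto simp: Lim_def)

lemma Lim_omega: "Lim omega"
  by (simp add: Lim_def succ_omega)

lemma Lim_VV: "Lim \<alpha> \<Longrightarrow> x \<^bold>\<in> VV \<alpha> \<Longrightarrow> \<exists>\<beta>. \<beta> \<^bold>\<in> \<alpha> \<and> x \<^bold>\<in> VV \<beta>"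
  by (metis Lim_def Ord_mem Ord_succ mem_VV mem_succ)

lemma Lim_VV2: "Lim \<alpha> \<Longrightarrow> x \<^bold>\<in> VV \<alpha> \<Longrightarrow> y \<^bold>\<in> VV \<alpha> \<Longrightarrow> \<exists>\<beta>. \<beta> \<^bold>\<in> \<alpha> \<and> x \<^bold>\<in> VV \<beta> \<and> y \<^bold>\<in> VV \<beta>"
  using Lim_VV[of \<alpha> x] Lim_VV[of \<alpha> y] VV_mono Lim_Ord Ord_linear Ord_mem by metis

lemma Lim_opair: "Lim \<alpha> \<Longrightarrow> x \<^bold>\<in> VV \<alpha> \<Longrightarrow> y \<^bold>\<in> VV \<alpha> \<Longrightarrow> opair x y \<^bold>\<in> VV \<alpha>"
  using Lim_VV2 opair_VV_succ Lim_succ Lim_Ord Ord_mem VV_mono by metis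

subsection \<open>Codes of formulas\<close>

lemmas c_defs = cMem_def cEq_def cNeg_def cAnd_def cEx_def

lemma c_inject [simp]:
  "cMem i j = cMem i' j' \<longleftrightarrow> i = i' \<and> j = j'" "cEq i j = cEq i' j' \<longleftrightarrow> i = i' \<and> j = j'"
  "cNeg p = cNeg p' \<longleftrightarrow> p = p'" "cAnd p q = cAnd p' q' \<longleftrightarrow> p = p' \<and> q = q'"
  "cEx i p = cEx i' p' \<longleftrightarrow> i = i' \<and> p = p'"
  by (simp_all add: c_defs del: num.simps)

lemma c_distinct [simp]:
  "cMem i j \<noteq> cEq i' j'" "cMem i j \<noteq> cNeg p" "cMem i j \<noteq> cAnd p q" "cMem i j \<noteq> cEx i' p"
  "cEq i j \<noteq> cMem i' j'" "cEq i j \<noteq> cNeg p" "cEq i j \<noteq> cAnd p q" "cEq i j \<noteq> cEx i' p"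
  "cNeg p \<noteq> cMem i j" "cNeg p \<noteq> cEq i j" "cNeg p \<noteq> cAnd p' q'" "cNeg p \<noteq> cEx i p'"
  "cAnd p q \<noteq> cMem i j" "cAnd p q \<noteq> cEq i j" "cAnd p q \<noteq> cNeg p'" "cAnd p q \<noteq> cEx i p'"
  "cEx i p \<noteq> cMem i' j'" "cEx i p \<noteq> cEq i' j'" "cEx i p \<noteq> cNeg p'" "cEx i p \<noteq> cAnd p' q'"
  by (simp_all add: c_defs del: num.simps)

lemma Fn_codes [defn]: assumes G [defn]: "good K" and [defn]: "Fn K t" "Fn K u"
  shows "Fn K (\<lambda>e. cMem (t e) (u e))" "Fn K (\<lambda>e. cEq (t e) (u e))"
    "Fn K (\<lambda>e. cAnd (t e) (u e))" "Fn K (\<lambda>e. cEx (t e) (u e))"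
  unfolding c_defs by (intro defn)+

lemma Fn_cNeg [defn]: assumes G [defn]: "good K" and [defn]: "Fn K t" shows "Fn K (\<lambda>e. cNeg (t e))"
  unfolding c_defs by (intro defn)

lemma fm_closed_bounded: "fm_closed X \<longleftrightarrow>
     (\<forall>i. i \<^bold>\<in> omega \<longrightarrow> (\<forall>j. j \<^bold>\<in> omega \<longrightarrow> cMem i j \<^bold>\<in> X \<and> cEq i j \<^bold>\<in> X)) \<and>
     (\<forall>p. p \<^bold>\<in> X \<longrightarrow> cNeg p \<^bold>\<in> X) \<and>
     (\<forall>p. p \<^bold>\<in> X \<longrightarrow> (\<forall>q. q \<^bold>\<in> X \<longrightarrow> cAnd p q \<^bold>\<in> X)) \<and>
     (\<forall>i. i \<^bold>\<in> omega \<longrightarrow> (\<forall>p. p \<^bold>\<in> X \<longrightarrow> cEx i p \<^bold>\<in> X))"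
  unfolding fm_closed_def by blast

lemma K_fm_closed [defn]: assumes G [defn]: "good K" and "Fn K t" shows "inK K (\<lambda>e. fm_closed (t e))"
  by (rule K_app1[OF G _ assms(2)]; unfold fm_closed_bounded; intro defn)

text \<open>V_\<omega> is closed under the constructors of codes, so it contains every code and
  separating from it loses nothing.\<close>

definition Codes :: 'a where "Codes = Sep (VV omega) is_code"

lemma num_VV_omega: "i \<^bold>\<in> omega \<Longrightarrow> i \<^bold>\<in> VV omega"
  using Ord_mem_VV[of omega i] Ord_mem[of omega i] by simp

lemma fm_closed_VV_omega: "fm_closed (VV omega)"
  unfolding fm_closed_def c_defs by (auto intro!: Lim_opair[OF Lim_omega] simp: num_VV_omega simp del: num.simps)

lemma mem_Codes: "p \<^bold>\<in> Codes \<longleftrightarrow> is_code p"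
proof -
  have "inK Df (\<lambda>e. is_code (e 0))" unfolding is_code_def by (intro defn)
  then show ?thesis unfolding Codes_def using fm_closed_VV_omega by (auto simp: mem_Sep is_code_def)
qed

lemma fm_closed_Codes: "fm_closed Codes"
  unfolding fm_closed_def mem_Codes by (auto simp: is_code_def fm_closed_def)

lemma Codes_intros [intro]:
  "i \<^bold>\<in> omega \<Longrightarrow> j \<^bold>\<in> omega \<Longrightarrow> cMem i j \<^bold>\<in> Codes" "i \<^bold>\<in> omega \<Longrightarrow> j \<^bold>\<in> omega \<Longrightarrow> cEq i j \<^bold>\<in> Codes"
  "p \<^bold>\<in> Codes \<Longrightarrow> cNeg p \<^bold>\<in> Codes" "p \<^bold>\<in> Codes \<Longrightarrow> q \<^bold>\<in> Codes \<Longrightarrow> cAnd p q \<^bold>\<in> Codes"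
  "i \<^bold>\<in> omega \<Longrightarrow> p \<^bold>\<in> Codes \<Longrightarrow> cEx i p \<^bold>\<in> Codes"
  using fm_closed_Codes unfolding fm_closed_def by blast+

lemma Codes_induct:
  assumes P: "inK Df (\<lambda>e. P (e 0))" and "p \<^bold>\<in> Codes"
    and "\<And>i j. i \<^bold>\<in> omega \<Longrightarrow> j \<^bold>\<in> omega \<Longrightarrow> P (cMem i j)"
    and "\<And>i j. i \<^bold>\<in> omega \<Longrightarrow> j \<^bold>\<in> omega \<Longrightarrow> P (cEq i j)"
    and "\<And>p. p \<^bold>\<in> Codes \<Longrightarrow> P p \<Longrightarrow> P (cNeg p)"
    and "\<And>p q. p \<^bold>\<in> Codes \<Longrightarrow> q \<^bold>\<in> Codes \<Longrightarrow> P p \<Longrightarrow> P q \<Longrightarrow> P (cAnd p q)"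
    and "\<And>i p. i \<^bold>\<in> omega \<Longrightarrow> p \<^bold>\<in> Codes \<Longrightarrow> P p \<Longrightarrow> P (cEx i p)"
  shows "P p"
proof -
  have "fm_closed (Sep Codes P)"
    unfolding fm_closed_def mem_Sep[OF P]
    by (intro conjI allI impI; (elim conjE)?; intro Codes_intros assms(3-); assumption)
  then have "p \<^bold>\<in> Sep Codes P" using assms(2) unfolding mem_Codes is_code_def by blast
  then show ?thesis by (simp add: mem_Sep[OF P])
qed

definition code_form :: "'a \<Rightarrow> 'a \<Rightarrow> bool" where
  "code_form X p \<longleftrightarrow> (\<exists>i. i \<^bold>\<in> omega \<and> (\<exists>j. j \<^bold>\<in> omega \<and> (p = cMem i j \<or> p = cEq i j))) \<or>
    (\<exists>q. q \<^bold>\<in> X \<and> p = cNeg q) \<or> (\<exists>q. q \<^bold>\<in> X \<and> (\<exists>r. r \<^bold>\<in> X \<and> p = cAnd q r)) \<or>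
    (\<exists>i. i \<^bold>\<in> omega \<and> (\<exists>q. q \<^bold>\<in> X \<and> p = cEx i q))"

lemma K_code_form [defn]: assumes G [defn]: "good K" and "Fn K t" "Fn K u"
  shows "inK K (\<lambda>e. code_form (t e) (u e))"
  by (rule K_app2[OF G _ assms(2,3)]; unfold code_form_def; intro defn)

lemma Codes_form: assumes "p \<^bold>\<in> Codes" shows "code_form Codes p"
proof (rule Codes_induct[OF _ assms])
  show "inK Df (\<lambda>e. code_form Codes (e 0))" by (intro defn)
qed (force simp: code_form_def)+

text \<open>\<open>is_code\<close> quantifies over all closed sets. The bounded description used
  instead is that of a closed set in which every element is built from elements of that set;
  induction on rank shows that such a set contains only codes.\<close>

lemma Fn_Codes [defn]: assumes G [defn]: "good K" shows "Fn K (\<lambda>e. Codes)"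
proof -
  have "x = Codes \<longleftrightarrow> fm_closed x \<and> (\<forall>p. p \<^bold>\<in> x \<longrightarrow> code_form x p)" for x
  proof
    assume R: "fm_closed x \<and> (\<forall>p. p \<^bold>\<in> x \<longrightarrow> code_form x p)"
    have "p \<^bold>\<in> Codes" if "p \<^bold>\<in> x" for p
    proof -
      obtain \<alpha> where a: "Ord \<alpha>" "p \<^bold>\<in> VV \<alpha>" using ex_VV by blast
      have "\<forall>p. p \<^bold>\<in> VV \<alpha> \<longrightarrow> p \<^bold>\<in> x \<longrightarrow> p \<^bold>\<in> Codes"
      proof (rule Ord_induct[OF _ a(1)])
        show "inK Df (\<lambda>e. \<forall>p. p \<^bold>\<in> VV (e 0) \<longrightarrow> p \<^bold>\<in> x \<longrightarrow> p \<^bold>\<in> Codes)" by (intro defn)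
      next
        fix \<beta> assume b: "Ord \<beta>" and IH: "\<And>\<gamma>. \<gamma> \<^bold>\<in> \<beta> \<Longrightarrow> \<forall>p. p \<^bold>\<in> VV \<gamma> \<longrightarrow> p \<^bold>\<in> x \<longrightarrow> p \<^bold>\<in> Codes"
        have 1: "q \<^bold>\<in> Codes" if "opair n q \<^bold>\<in> VV \<beta>" "q \<^bold>\<in> x" for n q
          using opair_VV_inv[OF b that(1)] IH that(2) by blast
        have 2: "q \<^bold>\<in> Codes \<and> r \<^bold>\<in> Codes" if "opair n (opair q r) \<^bold>\<in> VV \<beta>" "q \<^bold>\<in> x" "r \<^bold>\<in> x" for n q r
          using opair_VV_inv[OF b that(1)] opair_VV_inv[of _ q r] IH that(2,3) b Ord_mem Ord_trans by metis
        have 3: "q \<^bold>\<in> Codes" if "opair n (opair i q) \<^bold>\<in> VV \<beta>" "q \<^bold>\<in> x" for n q i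
          using opair_VV_inv[OF b that(1)] opair_VV_inv[of _ i q] IH that(2) b Ord_mem Ord_trans by metis
        show "\<forall>p. p \<^bold>\<in> VV \<beta> \<longrightarrow> p \<^bold>\<in> x \<longrightarrow> p \<^bold>\<in> Codes"
        proof (intro allI impI)
          fix p assume p: "p \<^bold>\<in> VV \<beta>" "p \<^bold>\<in> x"
          then have "code_form x p" using R by blast
          then show "p \<^bold>\<in> Codes"
            unfolding code_form_def
            using p(1) 1[of "num 2"] 2[of "num 3"] 3[of "num 4"] unfolding cNeg_def[symmetric] cAnd_def[symmetric] cEx_def[symmetric]
            by (elim disjE exE conjE) (simp_all add: Codes_intros)
        qed
      qed
      then show ?thesis using a that by blast
    qed
    moreover have "p \<^bold>\<in> x" if "p \<^bold>\<in> Codes" for p using that R unfolding mem_Codes is_code_def by blast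
    ultimately show "x = Codes" by (intro ext) blast
  qed (use fm_closed_Codes Codes_form in blast)
  then show ?thesis unfolding Fn_def by (simp only:) (intro defn)
qed

subsection \<open>Truth sets\<close>

lemma Fn_if [defn]: assumes G [defn]: "good K" and P: "inK K P" and t: "Fn K t" and u: "Fn K u"
  shows "Fn K (\<lambda>e. if P e then t e else u e)"
proof -
  have "(x = (if b then y else z)) \<longleftrightarrow> b \<and> x = y \<or> \<not> b \<and> x = z" for x y z :: 'a and b by simp
  then show ?thesis unfolding Fn_def
    by (simp only:) (intro defn K_rename[OF G P, of Suc] Fn_shift[OF G t] Fn_shift[OF G u])
qed

definition up :: "'a \<Rightarrow> 'a \<Rightarrow> 'a \<Rightarrow> 'a" where
  "up s i x = lam omega (\<lambda>k. if k = i then x else ap s k)"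

lemma up_fun: "is_fun (up s i x) omega" "k \<^bold>\<in> omega \<Longrightarrow> ap (up s i x) k = (if k = i then x else ap s k)"
proof -
  have F: "Fn Df (\<lambda>e. if e 0 = i then x else ap s (e 0))" by (intro defn)
  show f: "is_fun (up s i x) omega" unfolding up_def by (rule lam_fun[OF F])
  show "k \<^bold>\<in> omega \<Longrightarrow> ap (up s i x) k = (if k = i then x else ap s k)"
    unfolding app_ap[OF f, symmetric] unfolding up_def by (rule lam_fun[OF F])
qed

lemma fun_ext_ap: "is_fun f A \<Longrightarrow> is_fun g A \<Longrightarrow> (\<And>x. x \<^bold>\<in> A \<Longrightarrow> ap f x = ap g x) \<Longrightarrow> f = g"
  by (rule fun_ext) (auto simp: app_ap)

lemma Fn_up [defn]: assumes G [defn]: "good K" and "Fn K t" "Fn K u" "Fn K v"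
  shows "Fn K (\<lambda>e. up (t e) (u e) (v e))"
proof -
  have "w = up s i x \<longleftrightarrow> is_fun w omega \<and> (\<forall>k. k \<^bold>\<in> omega \<longrightarrow>
      (k = i \<longrightarrow> ap w k = x) \<and> (\<not> k = i \<longrightarrow> ap w k = ap s k))" for w s i x
    using up_fun[where s = s and i = i and x = x] fun_ext_ap[of w omega "up s i x"] by auto
  then show ?thesis unfolding Fn_def
    by (simp only:) (intro defn Fn_shift[OF G] assms(2-4) Fn_shift[OF G Fn_shift[OF G assms(2)]]
        Fn_shift[OF G Fn_shift[OF G assms(3)]] Fn_shift[OF G Fn_shift[OF G assms(4)]])
qed

lemma upd_up: assumes "is_fun s omega" shows "upd s i x = up s i x"
  unfolding upd_def
proof (rule the_set_eq)
  have *: "app (up s i x) k = (if k = i then x else app s k)" if "k \<^bold>\<in> omega" for k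
    using up_fun[where s = s and i = i and x = x] app_ap assms that by simp
  show "z \<^bold>\<in> up s i x \<longleftrightarrow> (\<exists>k. k \<^bold>\<in> omega \<and> z = opair k (if k = i then x else app s k))" for z
    unfolding mem_fun[OF up_fun(1)] using * by (simp cong: conj_cong)
qed

lemma maps_up: "maps s omega A \<Longrightarrow> x \<^bold>\<in> A \<Longrightarrow> maps (up s i x) omega A"
  unfolding maps_ap using up_fun[where s = s and i = i and x = x] by auto

lemma ex_assignments: "\<exists>S. \<forall>s. s \<^bold>\<in> S \<longleftrightarrow> maps s omega A"
proof -
  obtain \<alpha> where a: "Ord \<alpha>" "A \<^bold>\<in> VV \<alpha>" "omega \<^bold>\<in> VV \<alpha>" using ex_VV2 by blast
  then have "subs A (VV \<alpha>)" "subs omega (VV \<alpha>)" unfolding subs_def using VV_trans by blast+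
  then have "s \<^bold>\<in> VV (succ (succ (succ \<alpha>)))" if "maps s omega A" for s
    using fun_VV a(1) that by blast
  moreover have "inK Df (\<lambda>e. maps (e 0) omega A)" by (intro defn)
  ultimately show ?thesis using separation_Df[of "\<lambda>s. maps s omega A"] by metis
qed

text \<open>\<open>truth_set A\<close> quantifies over all assignments, so that a truth set is not a \<open>\<Sigma>\<^sub>1\<close> certificate. Restricting
  to any update-closed set \<open>S\<close> of assignments makes satisfaction \<open>\<Delta>\<^sub>1\<close>.\<close>

definition local_truth :: "'a \<Rightarrow> 'a \<Rightarrow> 'a \<Rightarrow> bool" where
  "local_truth A S T \<longleftrightarrow> (\<forall>s. s \<^bold>\<in> S \<longrightarrow>
     maps s omega A \<and> (\<forall>i. i \<^bold>\<in> omega \<longrightarrow> (\<forall>x. x \<^bold>\<in> A \<longrightarrow> up s i x \<^bold>\<in> S)) \<and>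
     (\<forall>i. i \<^bold>\<in> omega \<longrightarrow> (\<forall>j. j \<^bold>\<in> omega \<longrightarrow>
        (opair (cMem i j) s \<^bold>\<in> T \<longleftrightarrow> ap s i \<^bold>\<in> ap s j) \<and>
        (opair (cEq i j) s \<^bold>\<in> T \<longleftrightarrow> ap s i = ap s j))) \<and>
     (\<forall>p. p \<^bold>\<in> Codes \<longrightarrow> (opair (cNeg p) s \<^bold>\<in> T \<longleftrightarrow> \<not> opair p s \<^bold>\<in> T)) \<and>
     (\<forall>p. p \<^bold>\<in> Codes \<longrightarrow> (\<forall>q. q \<^bold>\<in> Codes \<longrightarrow>
        (opair (cAnd p q) s \<^bold>\<in> T \<longleftrightarrow> opair p s \<^bold>\<in> T \<and> opair q s \<^bold>\<in> T))) \<and>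
     (\<forall>i. i \<^bold>\<in> omega \<longrightarrow> (\<forall>p. p \<^bold>\<in> Codes \<longrightarrow>
        (opair (cEx i p) s \<^bold>\<in> T \<longleftrightarrow> (\<exists>x. x \<^bold>\<in> A \<and> opair p (up s i x) \<^bold>\<in> T)))))"

lemma K_local_truth [defn]: assumes G [defn]: "good K" and "Fn K t" "Fn K u" "Fn K v"
  shows "inK K (\<lambda>e. local_truth (t e) (u e) (v e))"
  by (rule K_app3[OF G _ assms(2-4)]; unfold local_truth_def; intro defn)

lemma local_truth_truth_set:
  assumes S: "\<And>s. s \<^bold>\<in> S \<longleftrightarrow> maps s omega A"
  shows "truth_set A T \<longleftrightarrow> local_truth A S T"
proof -
  have "((\<forall>i j. i \<^bold>\<in> omega \<and> j \<^bold>\<in> omega \<longrightarrow>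
        (opair (cMem i j) s \<^bold>\<in> T \<longleftrightarrow> app s i \<^bold>\<in> app s j) \<and>
        (opair (cEq i j) s \<^bold>\<in> T \<longleftrightarrow> app s i = app s j)) \<and>
     (\<forall>p. is_code p \<longrightarrow> (opair (cNeg p) s \<^bold>\<in> T \<longleftrightarrow> \<not> opair p s \<^bold>\<in> T)) \<and>
     (\<forall>p q. is_code p \<and> is_code q \<longrightarrow>
        (opair (cAnd p q) s \<^bold>\<in> T \<longleftrightarrow> opair p s \<^bold>\<in> T \<and> opair q s \<^bold>\<in> T)) \<and>
     (\<forall>i p. i \<^bold>\<in> omega \<and> is_code p \<longrightarrow>
        (opair (cEx i p) s \<^bold>\<in> T \<longleftrightarrow> (\<exists>x. x \<^bold>\<in> A \<and> opair p (upd s i x) \<^bold>\<in> T)))) \<longleftrightarrow>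
    ((\<forall>i. i \<^bold>\<in> omega \<longrightarrow> (\<forall>j. j \<^bold>\<in> omega \<longrightarrow>
        (opair (cMem i j) s \<^bold>\<in> T \<longleftrightarrow> ap s i \<^bold>\<in> ap s j) \<and>
        (opair (cEq i j) s \<^bold>\<in> T \<longleftrightarrow> ap s i = ap s j))) \<and>
     (\<forall>p. p \<^bold>\<in> Codes \<longrightarrow> (opair (cNeg p) s \<^bold>\<in> T \<longleftrightarrow> \<not> opair p s \<^bold>\<in> T)) \<and>
     (\<forall>p. p \<^bold>\<in> Codes \<longrightarrow> (\<forall>q. q \<^bold>\<in> Codes \<longrightarrow>
        (opair (cAnd p q) s \<^bold>\<in> T \<longleftrightarrow> opair p s \<^bold>\<in> T \<and> opair q s \<^bold>\<in> T))) \<and>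
     (\<forall>i. i \<^bold>\<in> omega \<longrightarrow> (\<forall>p. p \<^bold>\<in> Codes \<longrightarrow>
        (opair (cEx i p) s \<^bold>\<in> T \<longleftrightarrow> (\<exists>x. x \<^bold>\<in> A \<and> opair p (up s i x) \<^bold>\<in> T)))))"
    if s: "maps s omega A" for s
  proof -
    have f: "is_fun s omega" using s by (simp add: maps_def)
    have e: "i \<^bold>\<in> omega \<Longrightarrow> app s i = ap s i" for i using app_ap[OF f] .
    show ?thesis unfolding upd_up[OF f] mem_Codes[symmetric]
      by (intro conj_cong) (simp add: e imp_conjL cong: imp_cong, blast+)
  qed
  then show ?thesis unfolding truth_set_def local_truth_def S using maps_up by (simp cong: imp_cong)
qed

text \<open>Induction on the code. Both sets of assignments are closed under updates, so the updates
  of a common assignment are again common and the quantifier case goes through.\<close>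

lemma local_truth_unique:
  assumes "local_truth A S T" "local_truth A S' T'" "p \<^bold>\<in> Codes" "s \<^bold>\<in> S" "s \<^bold>\<in> S'"
  shows "opair p s \<^bold>\<in> T \<longleftrightarrow> opair p s \<^bold>\<in> T'"
proof -
  note 1 = assms(1)[unfolded local_truth_def, rule_format]
  note 2 = assms(2)[unfolded local_truth_def, rule_format]
  have "\<forall>s. s \<^bold>\<in> S \<and> s \<^bold>\<in> S' \<longrightarrow> (opair p s \<^bold>\<in> T \<longleftrightarrow> opair p s \<^bold>\<in> T')"
  proof (rule Codes_induct[OF _ assms(3)])
    show "inK Df (\<lambda>e. \<forall>s. s \<^bold>\<in> S \<and> s \<^bold>\<in> S' \<longrightarrow> (opair (e 0) s \<^bold>\<in> T \<longleftrightarrow> opair (e 0) s \<^bold>\<in> T'))"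
      by (intro defn)
  qed (use 1 2 in metis)+
  with assms show ?thesis by blast
qed

definition val_rule :: "'a \<Rightarrow> 'a \<Rightarrow> 'a \<Rightarrow> 'a \<Rightarrow> 'a \<Rightarrow> bool" where
  "val_rule A S Z p X \<longleftrightarrow> subs X S \<and> (
    (\<exists>i. i \<^bold>\<in> omega \<and> (\<exists>j. j \<^bold>\<in> omega \<and> p = cMem i j \<and> (\<forall>s. s \<^bold>\<in> S \<longrightarrow> (s \<^bold>\<in> X \<longleftrightarrow> ap s i \<^bold>\<in> ap s j)))) \<or>
    (\<exists>i. i \<^bold>\<in> omega \<and> (\<exists>j. j \<^bold>\<in> omega \<and> p = cEq i j \<and> (\<forall>s. s \<^bold>\<in> S \<longrightarrow> (s \<^bold>\<in> X \<longleftrightarrow> ap s i = ap s j)))) \<or>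
    (\<exists>q Y. opair q Y \<^bold>\<in> Z \<and> p = cNeg q \<and> (\<forall>s. s \<^bold>\<in> S \<longrightarrow> (s \<^bold>\<in> X \<longleftrightarrow> \<not> s \<^bold>\<in> Y))) \<or>
    (\<exists>q Y r W. opair q Y \<^bold>\<in> Z \<and> opair r W \<^bold>\<in> Z \<and> p = cAnd q r \<and>
       (\<forall>s. s \<^bold>\<in> S \<longrightarrow> (s \<^bold>\<in> X \<longleftrightarrow> s \<^bold>\<in> Y \<and> s \<^bold>\<in> W))) \<or>
    (\<exists>i q Y. i \<^bold>\<in> omega \<and> opair q Y \<^bold>\<in> Z \<and> p = cEx i q \<and>
       (\<forall>s. s \<^bold>\<in> S \<longrightarrow> (s \<^bold>\<in> X \<longleftrightarrow> (\<exists>x. x \<^bold>\<in> A \<and> up s i x \<^bold>\<in> Y)))))"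

text \<open>A certificate \<open>Z\<close> for \<open>val A S p X\<close> is a set of pairs in which each pair is justified by others;
  \<open>X\<close> is then the set of assignments in \<open>S\<close> satisfying \<open>p\<close>.\<close>

definition val :: "'a \<Rightarrow> 'a \<Rightarrow> 'a \<Rightarrow> 'a \<Rightarrow> bool" where
  "val A S p X \<longleftrightarrow> (\<exists>Z. opair p X \<^bold>\<in> Z \<and> (\<forall>p X. opair p X \<^bold>\<in> Z \<longrightarrow> val_rule A S Z p X))"

lemma Df_val: "inK Df (\<lambda>e. val A S (e i) (e j))"
  unfolding val_def val_rule_def by (intro defn)

text \<open>\<open>Z\<close> occurs only positively in the rule. Certificates can therefore be
  united and extended without any compatibility check.\<close>

lemma val_rule_mono:
  assumes "val_rule A S Z p X" "\<And>z. z \<^bold>\<in> Z \<Longrightarrow> z \<^bold>\<in> Z'" shows "val_rule A S Z' p X"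
proof -
  have "val_rule A S Z p X \<longrightarrow> val_rule A S Z' p X"
    unfolding val_rule_def by (intro conj_mono disj_mono ex_mono) (simp_all add: assms(2))
  with assms(1) show ?thesis by blast
qed

lemma val_extend:
  assumes "val_rule A S Z p X" "\<And>p X. opair p X \<^bold>\<in> Z \<Longrightarrow> val_rule A S Z p X"
  shows "val A S p X"
proof -
  let ?Z = "un2 Z (upair (opair p X) (opair p X))"
  have m: "z \<^bold>\<in> ?Z" if "z \<^bold>\<in> Z" for z using that by simp
  have "val_rule A S ?Z q Y" if "opair q Y \<^bold>\<in> ?Z" for q Y
    using that val_rule_mono[OF assms(1) m] val_rule_mono[OF assms(2) m] by auto
  then show ?thesis unfolding val_def by (intro exI[of _ ?Z]) simp
qed

lemma val_subs: "val A S p X \<Longrightarrow> subs X S"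
  unfolding val_def val_rule_def by blast

lemma val_Mem: "i \<^bold>\<in> omega \<Longrightarrow> j \<^bold>\<in> omega \<Longrightarrow> val A S (cMem i j) (Sep S (\<lambda>s. ap s i \<^bold>\<in> ap s j))"
proof (rule val_extend[of A S zero])
  have "inK Df (\<lambda>e. ap (e 0) i \<^bold>\<in> ap (e 0) j)" by (intro defn)
  then show "i \<^bold>\<in> omega \<Longrightarrow> j \<^bold>\<in> omega \<Longrightarrow> val_rule A S zero (cMem i j) (Sep S (\<lambda>s. ap s i \<^bold>\<in> ap s j))"
    unfolding val_rule_def by (auto simp: mem_Sep subs_def)
qed simp

lemma val_Eq: "i \<^bold>\<in> omega \<Longrightarrow> j \<^bold>\<in> omega \<Longrightarrow> val A S (cEq i j) (Sep S (\<lambda>s. ap s i = ap s j))"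
proof (rule val_extend[of A S zero])
  have "inK Df (\<lambda>e. ap (e 0) i = ap (e 0) j)" by (intro defn)
  then show "i \<^bold>\<in> omega \<Longrightarrow> j \<^bold>\<in> omega \<Longrightarrow> val_rule A S zero (cEq i j) (Sep S (\<lambda>s. ap s i = ap s j))"
    unfolding val_rule_def by (auto simp: mem_Sep subs_def)
qed simp

lemma val_Neg: assumes "val A S p X" shows "val A S (cNeg p) (Sep S (\<lambda>s. \<not> s \<^bold>\<in> X))"
proof -
  obtain Z where Z: "opair p X \<^bold>\<in> Z" "\<And>p X. opair p X \<^bold>\<in> Z \<Longrightarrow> val_rule A S Z p X"
    using assms unfolding val_def by blast
  have "inK Df (\<lambda>e. \<not> e 0 \<^bold>\<in> X)" by (intro defn)
  then have "subs (Sep S (\<lambda>s. \<not> s \<^bold>\<in> X)) S" "\<forall>s. s \<^bold>\<in> S \<longrightarrow> (s \<^bold>\<in> Sep S (\<lambda>s. \<not> s \<^bold>\<in> X) \<longleftrightarrow> \<not> s \<^bold>\<in> X)"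
    by (simp_all add: mem_Sep subs_def)
  then have "val_rule A S Z (cNeg p) (Sep S (\<lambda>s. \<not> s \<^bold>\<in> X))"
    unfolding val_rule_def using Z(1) by blast
  then show ?thesis using Z(2) by (rule val_extend)
qed

lemma val_Ex: assumes "val A S p X" "i \<^bold>\<in> omega"
  shows "val A S (cEx i p) (Sep S (\<lambda>s. \<exists>x. x \<^bold>\<in> A \<and> up s i x \<^bold>\<in> X))"
proof -
  obtain Z where Z: "opair p X \<^bold>\<in> Z" "\<And>p X. opair p X \<^bold>\<in> Z \<Longrightarrow> val_rule A S Z p X"
    using assms unfolding val_def by blast
  let ?X = "Sep S (\<lambda>s. \<exists>x. x \<^bold>\<in> A \<and> up s i x \<^bold>\<in> X)"
  have "inK Df (\<lambda>e. \<exists>x. x \<^bold>\<in> A \<and> up (e 0) i x \<^bold>\<in> X)" by (intro defn)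
  then have "subs ?X S" "\<forall>s. s \<^bold>\<in> S \<longrightarrow> (s \<^bold>\<in> ?X \<longleftrightarrow> (\<exists>x. x \<^bold>\<in> A \<and> up s i x \<^bold>\<in> X))"
    by (simp_all add: mem_Sep subs_def)
  then have "val_rule A S Z (cEx i p) ?X"
    unfolding val_rule_def using Z(1) assms(2) by blast
  then show ?thesis using Z(2) by (rule val_extend)
qed

lemma val_And: assumes "val A S p X" "val A S q Y"
  shows "val A S (cAnd p q) (Sep S (\<lambda>s. s \<^bold>\<in> X \<and> s \<^bold>\<in> Y))"
proof -
  obtain Z where Z: "opair p X \<^bold>\<in> Z" "\<And>p X. opair p X \<^bold>\<in> Z \<Longrightarrow> val_rule A S Z p X"
    using assms unfolding val_def by blast
  obtain W where W: "opair q Y \<^bold>\<in> W" "\<And>p X. opair p X \<^bold>\<in> W \<Longrightarrow> val_rule A S W p X"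
    using assms unfolding val_def by blast
  let ?X = "Sep S (\<lambda>s. s \<^bold>\<in> X \<and> s \<^bold>\<in> Y)"
  have "inK Df (\<lambda>e. e 0 \<^bold>\<in> X \<and> e 0 \<^bold>\<in> Y)" by (intro defn)
  then have X: "subs ?X S" "\<forall>s. s \<^bold>\<in> S \<longrightarrow> (s \<^bold>\<in> ?X \<longleftrightarrow> s \<^bold>\<in> X \<and> s \<^bold>\<in> Y)"
    by (simp_all add: mem_Sep subs_def)
  have "opair p X \<^bold>\<in> un2 Z W" "opair q Y \<^bold>\<in> un2 Z W" using Z W by simp_all
  with X have "val_rule A S (un2 Z W) (cAnd p q) ?X"
    unfolding val_rule_def by blast
  moreover have "val_rule A S (un2 Z W) r V" if "opair r V \<^bold>\<in> un2 Z W" for r V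
    using that val_rule_mono[OF Z(2), of r V "un2 Z W"] val_rule_mono[OF W(2), of r V "un2 Z W"] by auto
  ultimately show ?thesis by (rule val_extend)
qed

lemma val_inv: "val A S p X \<Longrightarrow> \<exists>Z. val_rule A S Z p X \<and> (\<forall>q Y. opair q Y \<^bold>\<in> Z \<longrightarrow> val A S q Y)"
  unfolding val_def by blast

lemma val_unique:
  assumes "p \<^bold>\<in> Codes" "val A S p X" "val A S p X'" shows "X = X'"
proof -
  have "\<forall>X X'. val A S p X \<and> val A S p X' \<longrightarrow> X = X'"
  proof (rule Codes_induct[OF _ assms(1)])
    show "inK Df (\<lambda>e. \<forall>X X'. val A S (e 0) X \<and> val A S (e 0) X' \<longrightarrow> X = X')"
      by (intro defn Df_val)
  next
    have I: "\<forall>X X'. val A S p X \<and> val A S p X' \<longrightarrow> X = X'"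
      if "\<And>s X X'. val A S p X \<Longrightarrow> val A S p X' \<Longrightarrow> s \<^bold>\<in> S \<Longrightarrow> s \<^bold>\<in> X \<longleftrightarrow> s \<^bold>\<in> X'" for p
    proof (intro allI impI)
      fix X X' assume v: "val A S p X \<and> val A S p X'"
      then have "subs X S" "subs X' S" using val_subs by blast+
      then show "X = X'" using that[of X X'] v unfolding subs_def by (intro ext) blast
    qed
    {
      fix i j assume "i \<^bold>\<in> omega" "j \<^bold>\<in> omega"
      have "s \<^bold>\<in> X \<longleftrightarrow> ap s i \<^bold>\<in> ap s j" if "val A S (cMem i j) X" "s \<^bold>\<in> S" for s X
        using val_inv[OF that(1)] that(2) unfolding val_rule_def by auto
      then show "\<forall>X X'. val A S (cMem i j) X \<and> val A S (cMem i j) X' \<longrightarrow> X = X'" by (intro I) blast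
    next
      fix i j assume "i \<^bold>\<in> omega" "j \<^bold>\<in> omega"
      have "s \<^bold>\<in> X \<longleftrightarrow> ap s i = ap s j" if "val A S (cEq i j) X" "s \<^bold>\<in> S" for s X
        using val_inv[OF that(1)] that(2) unfolding val_rule_def by auto
      then show "\<forall>X X'. val A S (cEq i j) X \<and> val A S (cEq i j) X' \<longrightarrow> X = X'" by (intro I) blast
    next
      fix p assume IH: "\<forall>X X'. val A S p X \<and> val A S p X' \<longrightarrow> X = X'"
      have "\<exists>Y. val A S p Y \<and> (\<forall>s. s \<^bold>\<in> S \<longrightarrow> (s \<^bold>\<in> X \<longleftrightarrow> \<not> s \<^bold>\<in> Y))" if "val A S (cNeg p) X" for X
        using val_inv[OF that] unfolding val_rule_def by auto
      then show "\<forall>X X'. val A S (cNeg p) X \<and> val A S (cNeg p) X' \<longrightarrow> X = X'"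
        using IH by (intro I) metis
    next
      fix p q assume IH: "\<forall>X X'. val A S p X \<and> val A S p X' \<longrightarrow> X = X'"
        "\<forall>X X'. val A S q X \<and> val A S q X' \<longrightarrow> X = X'"
      have "\<exists>Y W. val A S p Y \<and> val A S q W \<and> (\<forall>s. s \<^bold>\<in> S \<longrightarrow> (s \<^bold>\<in> X \<longleftrightarrow> s \<^bold>\<in> Y \<and> s \<^bold>\<in> W))"
        if "val A S (cAnd p q) X" for X
        using val_inv[OF that] unfolding val_rule_def by auto
      then show "\<forall>X X'. val A S (cAnd p q) X \<and> val A S (cAnd p q) X' \<longrightarrow> X = X'"
        using IH by (intro I) metis
    next
      fix i p assume IH: "\<forall>X X'. val A S p X \<and> val A S p X' \<longrightarrow> X = X'"
      have "\<exists>Y. val A S p Y \<and> (\<forall>s. s \<^bold>\<in> S \<longrightarrow> (s \<^bold>\<in> X \<longleftrightarrow> (\<exists>x. x \<^bold>\<in> A \<and> up s i x \<^bold>\<in> Y)))"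
        if "val A S (cEx i p) X" for X
        using val_inv[OF that] unfolding val_rule_def by auto
      then show "\<forall>X X'. val A S (cEx i p) X \<and> val A S (cEx i p) X' \<longrightarrow> X = X'"
        using IH by (intro I) metis
    }
  qed
  with assms show ?thesis by blast
qed

lemma val_total: assumes "p \<^bold>\<in> Codes" shows "\<exists>X. val A S p X"
proof (rule Codes_induct[OF _ assms])
  show "inK Df (\<lambda>e. \<exists>X. val A S (e 0) X)" by (intro defn Df_val)
qed (blast intro: val_Mem val_Eq val_Neg val_And val_Ex)+

text \<open>The truth set consists of the pairs of a code and an assignment in the value of that
  code; existence and uniqueness of values translate the evaluation rules into Tarski's
  clauses.\<close>

lemma ex_local_truth:
  assumes "\<And>s. s \<^bold>\<in> S \<Longrightarrow> maps s omega A" "\<And>s i x. s \<^bold>\<in> S \<Longrightarrow> i \<^bold>\<in> omega \<Longrightarrow> x \<^bold>\<in> A \<Longrightarrow> up s i x \<^bold>\<in> S"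
  shows "\<exists>T. local_truth A S T"
proof -
  obtain w where w: "\<forall>p s. p \<^bold>\<in> Codes \<and> s \<^bold>\<in> S \<longrightarrow> opair p s \<^bold>\<in> w"
    using ex_product[of Codes S] by (elim exE)
  let ?P = "\<lambda>z. \<exists>p X s. p \<^bold>\<in> Codes \<and> s \<^bold>\<in> X \<and> z = opair p s \<and> val A S p X"
  have "inK Df (\<lambda>e. ?P (e 0))" by (intro defn Df_val)
  from mem_Sep[OF this] have m: "z \<^bold>\<in> Sep w ?P \<longleftrightarrow> ?P z" for z
    using w val_subs[unfolded subs_def, rule_format] by blast
  have T: "opair p s \<^bold>\<in> Sep w ?P \<longleftrightarrow> s \<^bold>\<in> X" if "p \<^bold>\<in> Codes" "val A S p X" for p s X
    unfolding m opair_inject using that val_unique[OF that] by blast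
  have "local_truth A S (Sep w ?P)"
    unfolding local_truth_def
  proof (intro allI impI conjI)
    fix s i j assume s: "s \<^bold>\<in> S" and i: "i \<^bold>\<in> omega" "j \<^bold>\<in> omega"
    have "inK Df (\<lambda>e. ap (e 0) i \<^bold>\<in> ap (e 0) j)" "inK Df (\<lambda>e. ap (e 0) i = ap (e 0) j)" by (intro defn)+
    then show "opair (cMem i j) s \<^bold>\<in> Sep w ?P \<longleftrightarrow> ap s i \<^bold>\<in> ap s j"
      "opair (cEq i j) s \<^bold>\<in> Sep w ?P \<longleftrightarrow> ap s i = ap s j"
      using T[OF _ val_Mem[OF i]] T[OF _ val_Eq[OF i]] s i by (simp_all add: Codes_intros mem_Sep)
  next
    fix s p assume s: "s \<^bold>\<in> S" and p: "p \<^bold>\<in> Codes"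
    obtain X where X: "val A S p X" using val_total[OF p] by blast
    have "inK Df (\<lambda>e. \<not> e 0 \<^bold>\<in> X)" by (intro defn)
    then show "opair (cNeg p) s \<^bold>\<in> Sep w ?P \<longleftrightarrow> \<not> opair p s \<^bold>\<in> Sep w ?P"
      using T[OF _ val_Neg[OF X]] T[OF p X] s p by (simp add: Codes_intros mem_Sep)
    fix q assume q: "q \<^bold>\<in> Codes"
    obtain Y where Y: "val A S q Y" using val_total[OF q] by blast
    have "inK Df (\<lambda>e. e 0 \<^bold>\<in> X \<and> e 0 \<^bold>\<in> Y)" by (intro defn)
    then show "opair (cAnd p q) s \<^bold>\<in> Sep w ?P \<longleftrightarrow> opair p s \<^bold>\<in> Sep w ?P \<and> opair q s \<^bold>\<in> Sep w ?P"
      using T[OF _ val_And[OF X Y]] T[OF p X] T[OF q Y] s p q by (simp add: Codes_intros mem_Sep)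
  next
    fix s i p assume s: "s \<^bold>\<in> S" and i: "i \<^bold>\<in> omega" and p: "p \<^bold>\<in> Codes"
    obtain X where X: "val A S p X" using val_total[OF p] by blast
    have "inK Df (\<lambda>e. \<exists>x. x \<^bold>\<in> A \<and> up (e 0) i x \<^bold>\<in> X)" by (intro defn)
    then show "opair (cEx i p) s \<^bold>\<in> Sep w ?P \<longleftrightarrow> (\<exists>x. x \<^bold>\<in> A \<and> opair p (up s i x) \<^bold>\<in> Sep w ?P)"
      using T[OF _ val_Ex[OF X i]] T[OF p X] s p i by (simp add: Codes_intros mem_Sep)
  qed (use assms in auto)
  then show ?thesis by blast
qed


section \<open>Satisfaction as a Delta_1 relation\<close>

definition SatR :: "'a \<Rightarrow> 'a \<Rightarrow> 'a \<Rightarrow> bool" where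
  "SatR A p s \<longleftrightarrow> p \<^bold>\<in> Codes \<and> maps s omega A \<and> models A p s"

lemma ex_full_truth: "\<exists>S T. (\<forall>s. s \<^bold>\<in> S \<longleftrightarrow> maps s omega A) \<and> local_truth A S T"
proof -
  obtain S where S: "\<forall>s. s \<^bold>\<in> S \<longleftrightarrow> maps s omega A" using ex_assignments[of A] by (elim exE)
  then have "\<exists>T. local_truth A S T" using maps_up by (intro ex_local_truth) blast+
  with S show ?thesis by blast
qed

text \<open>By uniqueness, a truth set over any update-closed set of assignments containing
  \<open>s\<close> decides \<open>models\<close>, although the latter refers to truth sets over all
  assignments.\<close>

lemma SatR_local_truth:
  assumes "local_truth A S T" "s \<^bold>\<in> S" "p \<^bold>\<in> Codes" shows "SatR A p s \<longleftrightarrow> opair p s \<^bold>\<in> T"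
proof -
  obtain S0 T0 where S0: "\<And>s. s \<^bold>\<in> S0 \<longleftrightarrow> maps s omega A" and T0: "local_truth A S0 T0"
    using ex_full_truth[of A] by blast
  have s: "maps s omega A" using assms unfolding local_truth_def by blast
  have "models A p s \<longleftrightarrow> (\<exists>T. local_truth A S0 T \<and> opair p s \<^bold>\<in> T)"
    unfolding models_def local_truth_truth_set[OF S0] ..
  also have "\<dots> \<longleftrightarrow> opair p s \<^bold>\<in> T"
    using local_truth_unique[OF assms(1) _ assms(3,2)] T0 s S0 by metis
  finally show ?thesis using assms s by (simp add: SatR_def)
qed

lemma Dl_Sg: "inK (Dl n) P \<Longrightarrow> inK (Sg n) P" and Dl_Pg: "inK (Dl n) P \<Longrightarrow> inK (Pg n) P"
  by (simp_all add: Dl_iff)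

text \<open>Local truth sets exist and agree, so both satisfaction and its failure are witnessed by
  one of them. This gives a Sigma_1 form of either.\<close>

lemma K_SatR [defn]:
  assumes "Fn (Dl (Suc n)) t" "Fn (Dl (Suc n)) u" "Fn (Dl (Suc n)) v"
  shows "inK (Dl (Suc n)) (\<lambda>e. SatR (t e) (u e) (v e))"
proof (rule K_app3[OF good_Dl _ assms])
  have 1: "SatR A p s \<longleftrightarrow> (\<exists>S T. local_truth A S T \<and> s \<^bold>\<in> S \<and> p \<^bold>\<in> Codes \<and> opair p s \<^bold>\<in> T)" for A p s
    using ex_full_truth[of A] SatR_local_truth by (metis SatR_def)
  have 2: "\<not> SatR A p s \<longleftrightarrow> (\<exists>S T. (\<not> p \<^bold>\<in> Codes \<or> \<not> maps s omega A) \<or>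
      local_truth A S T \<and> s \<^bold>\<in> S \<and> \<not> opair p s \<^bold>\<in> T)" for A p s
    using ex_full_truth[of A] SatR_local_truth by (metis SatR_def)
  show "inK (Dl (Suc n)) (\<lambda>e. SatR (e 0) (e 1) (e 2))"
    unfolding Dl_iff Pg_neg 2 unfolding 1 by (intro conjI Sg_ex Dl_Sg; intro defn)
qed

lemma K_SatR_Df [defn]:
  assumes "Fn Df t" "Fn Df u" "Fn Df v" shows "inK Df (\<lambda>e. SatR (t e) (u e) (v e))"
  by (rule K_app3[OF good_Df _ assms], rule Dl_Df[of 1], unfold One_nat_def, intro defn)

lemma SatR_rules:
  assumes "maps s omega A"
  shows "i \<^bold>\<in> omega \<Longrightarrow> j \<^bold>\<in> omega \<Longrightarrow> SatR A (cMem i j) s \<longleftrightarrow> ap s i \<^bold>\<in> ap s j"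
    "i \<^bold>\<in> omega \<Longrightarrow> j \<^bold>\<in> omega \<Longrightarrow> SatR A (cEq i j) s \<longleftrightarrow> ap s i = ap s j"
    "p \<^bold>\<in> Codes \<Longrightarrow> SatR A (cNeg p) s \<longleftrightarrow> \<not> SatR A p s"
    "p \<^bold>\<in> Codes \<Longrightarrow> q \<^bold>\<in> Codes \<Longrightarrow> SatR A (cAnd p q) s \<longleftrightarrow> SatR A p s \<and> SatR A q s"
    "i \<^bold>\<in> omega \<Longrightarrow> p \<^bold>\<in> Codes \<Longrightarrow> SatR A (cEx i p) s \<longleftrightarrow> (\<exists>x. x \<^bold>\<in> A \<and> SatR A p (up s i x))"
proof -
  obtain S T where S: "\<And>s. s \<^bold>\<in> S \<longleftrightarrow> maps s omega A" and T: "local_truth A S T"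
    using ex_full_truth[of A] by blast
  note r = SatR_local_truth[OF T]
  have s: "s \<^bold>\<in> S" using assms S by blast
  have u: "up s i x \<^bold>\<in> S" if "x \<^bold>\<in> A" for i x using maps_up[OF assms that] S by blast
  note t = T[unfolded local_truth_def, rule_format, OF s]
  show "i \<^bold>\<in> omega \<Longrightarrow> j \<^bold>\<in> omega \<Longrightarrow> SatR A (cMem i j) s \<longleftrightarrow> ap s i \<^bold>\<in> ap s j"
    using t r[OF s] Codes_intros by metis
  show "i \<^bold>\<in> omega \<Longrightarrow> j \<^bold>\<in> omega \<Longrightarrow> SatR A (cEq i j) s \<longleftrightarrow> ap s i = ap s j"
    using t r[OF s] Codes_intros by metis
  show "p \<^bold>\<in> Codes \<Longrightarrow> SatR A (cNeg p) s \<longleftrightarrow> \<not> SatR A p s"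
    using t r[OF s] Codes_intros by metis
  show "p \<^bold>\<in> Codes \<Longrightarrow> q \<^bold>\<in> Codes \<Longrightarrow> SatR A (cAnd p q) s \<longleftrightarrow> SatR A p s \<and> SatR A q s"
    using t r[OF s] Codes_intros by metis
  assume ip: "i \<^bold>\<in> omega" "p \<^bold>\<in> Codes"
  then have "SatR A (cEx i p) s \<longleftrightarrow> opair (cEx i p) s \<^bold>\<in> T" using r[OF s] Codes_intros by blast
  also have "\<dots> \<longleftrightarrow> (\<exists>x. x \<^bold>\<in> A \<and> opair p (up s i x) \<^bold>\<in> T)" using t ip by blast
  also have "\<dots> \<longleftrightarrow> (\<exists>x. x \<^bold>\<in> A \<and> SatR A p (up s i x))" using r[OF u ip(2)] by blast
  finally show "SatR A (cEx i p) s \<longleftrightarrow> (\<exists>x. x \<^bold>\<in> A \<and> SatR A p (up s i x))" .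
qed

section \<open>From formulas of the metatheory to codes\<close>

primrec code :: "fm \<Rightarrow> 'a" where
  "code (Mem i j) = cMem (num i) (num j)"
| "code (Eq i j) = cEq (num i) (num j)"
| "code (Neg p) = cNeg (code p)"
| "code (And p q) = cAnd (code p) (code q)"
| "code (Ex i p) = cEx (num i) (code p)"

lemma code_Codes [simp]: "code p \<^bold>\<in> Codes"
  by (induction p) (auto simp: Codes_intros)

lemma SatR_sat: "maps s omega A \<Longrightarrow> SatR A (code p) s \<longleftrightarrow> sat {x. x \<^bold>\<in> A} (\<lambda>i. ap s (num i)) p"
proof (induction p arbitrary: s)
  case (Ex i p)
  have "SatR A (code (Ex i p)) s \<longleftrightarrow> (\<exists>x. x \<^bold>\<in> A \<and> SatR A (code p) (up s (num i) x))"
    using Ex.prems by (simp add: SatR_rules)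
  also have "\<dots> \<longleftrightarrow> (\<exists>x. x \<^bold>\<in> A \<and> sat {x. x \<^bold>\<in> A} ((\<lambda>k. ap s (num k))(i := x)) p)"
  proof (intro ex_cong1 conj_cong refl)
    fix x assume x: "x \<^bold>\<in> A"
    have "(\<lambda>k. ap (up s (num i) x) (num k)) = (\<lambda>k. ap s (num k))(i := x)"
      by (rule HOL.ext) (simp add: up_fun)
    then show "SatR A (code p) (up s (num i) x) \<longleftrightarrow> sat {x. x \<^bold>\<in> A} ((\<lambda>k. ap s (num k))(i := x)) p"
      using Ex.IH[OF maps_up[OF Ex.prems x]] by simp
  qed
  finally show ?case by simp
qed (simp_all add: SatR_rules)

lemma const_maps: "x \<^bold>\<in> A \<Longrightarrow> maps (lam omega (\<lambda>_. x)) omega A"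
  using lam_fun[OF Fn_const] by (auto simp: maps_def)

lemma const_ap: "k \<^bold>\<in> omega \<Longrightarrow> ap (lam omega (\<lambda>_. x)) k = x"
  using lam_fun[OF Fn_const] app_ap by metis

lemma ex_assignment:
  assumes "\<And>i. e i \<^bold>\<in> A" shows "\<exists>s. maps s omega A \<and> (\<forall>i<k. ap s (num i) = e i)"
proof (induction k)
  case 0
  show ?case using const_maps[OF assms] by auto
next
  case (Suc k)
  then obtain s where s: "maps s omega A" "\<forall>i<k. ap s (num i) = e i" by blast
  have "\<forall>i<Suc k. ap (up s (num k) (e k)) (num i) = e i"
    using s by (auto simp: up_fun less_Suc_eq)
  then show ?case using maps_up[OF s(1) assms] by blast
qed

text \<open>The function \<open>e\<close> lives outside the model, so only finitely many of its
  values can be prescribed. They lie below some \<beta> < \<alpha>, which keeps the assignment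
  itself inside V_\<alpha>.\<close>

lemma Lim_assignment:
  assumes "Lim \<alpha>" "omega \<^bold>\<in> \<alpha>" "\<And>i. e i \<^bold>\<in> VV \<alpha>"
  shows "\<exists>s. s \<^bold>\<in> VV \<alpha> \<and> maps s omega (VV \<alpha>) \<and> (\<forall>i<k. ap s (num i) = e i)"
proof -
  have "\<exists>\<beta>. \<beta> \<^bold>\<in> \<alpha> \<and> omega \<^bold>\<in> VV \<beta> \<and> (\<forall>i\<le>k. e i \<^bold>\<in> VV \<beta>)"
  proof (induction k)
    case 0
    then show ?case using Lim_VV2[OF assms(1) _ assms(3)[of 0], of omega] assms(1,2) Lim_Ord Ord_mem_VV by auto
  next
    case (Suc k)
    then obtain \<beta> \<gamma> where b: "\<beta> \<^bold>\<in> \<alpha>" "omega \<^bold>\<in> VV \<beta>" "\<forall>i\<le>k. e i \<^bold>\<in> VV \<beta>"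
      and c: "\<gamma> \<^bold>\<in> \<alpha>" "e (Suc k) \<^bold>\<in> VV \<gamma>" using Lim_VV[OF assms(1,3)] by metis
    have o: "Ord \<beta>" "Ord \<gamma>" using b c assms(1) Lim_Ord Ord_mem by blast+
    show ?case
    proof (cases "\<beta> \<^bold>\<in> \<gamma>")
      case True
      then show ?thesis using b c VV_mono[OF o(2) True] by (intro exI[of _ \<gamma>]) (auto simp: le_Suc_eq)
    next
      case False
      then have "e (Suc k) \<^bold>\<in> VV \<beta>" using Ord_linear[OF o] c VV_mono[OF o(1)] by blast
      then show ?thesis using b by (intro exI[of _ \<beta>]) (auto simp: le_Suc_eq)
    qed
  qed
  then obtain \<beta> where b: "\<beta> \<^bold>\<in> \<alpha>" "omega \<^bold>\<in> VV \<beta>" "\<And>i. i \<le> k \<Longrightarrow> e i \<^bold>\<in> VV \<beta>" by blast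
  have o: "Ord \<alpha>" "Ord \<beta>" using b assms(1) Lim_Ord Ord_mem by blast+
  \<comment> \<open>Cutting the index off at \<open>k\<close> leaves only values that are known to
    lie in V_\<beta>.\<close>
  obtain s where s: "maps s omega (VV \<beta>)" "\<forall>i<k. ap s (num i) = e (min i k)"
    using ex_assignment[of "\<lambda>i. e (min i k)" "VV \<beta>" k] b(3) by auto
  have "subs omega (VV \<beta>)" using b(2) o(2) VV_trans unfolding subs_def by blast
  then have "s \<^bold>\<in> VV (succ (succ (succ \<beta>)))" using fun_VV[OF o(2) _ _ s(1)] by (simp add: subs_def)
  then have "s \<^bold>\<in> VV \<alpha>" using b(1) assms(1) Lim_succ VV_mono o by blast
  moreover have "maps s omega (VV \<alpha>)" using s(1) VV_mono[OF o(1) b(1)] by (auto simp: maps_def)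
  ultimately show ?thesis using s(2) by auto
qed

lemma assignment_mem:
  assumes "transitive N" "s \<^bold>\<in> N" "is_fun s A" "k \<^bold>\<in> A" shows "ap s k \<^bold>\<in> N"
proof -
  have "opair k (ap s k) \<^bold>\<in> s" using assms(3,4) opair_mem_fun app_ap by metis
  moreover have "z \<^bold>\<in> N" if "y \<^bold>\<in> N" "z \<^bold>\<in> y" for y z using assms(1) that unfolding transitive_def by blast
  ultimately show ?thesis using assms(2) unfolding opair_def by (metis mem_upair)
qed

lemma opair_transitive: "transitive N \<Longrightarrow> opair x y \<^bold>\<in> N \<Longrightarrow> x \<^bold>\<in> N \<and> y \<^bold>\<in> N"
proof -
  assume N: "transitive N" and o: "opair x y \<^bold>\<in> N"
  have t: "z \<^bold>\<in> N" if "w \<^bold>\<in> N" "z \<^bold>\<in> w" for w z using N that unfolding transitive_def by blast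
  have "upair x y \<^bold>\<in> N" using t[OF o] by (simp add: opair_def)
  then show ?thesis using t by simp
qed

subsection \<open>Absoluteness of the cumulative hierarchy\<close>

definition inVV :: "'a \<Rightarrow> 'a \<Rightarrow> bool" where "inVV z \<alpha> \<longleftrightarrow> z \<^bold>\<in> VV \<alpha>"

text \<open>\<open>f\<close> computes \<open>V\<^sub>\<beta> \<inter> t\<close> for all \<open>\<beta> \<le> \<alpha>\<close>; this decides membership in \<open>V\<^sub>\<alpha>\<close> without power sets.\<close>

definition hier :: "'a \<Rightarrow> 'a \<Rightarrow> 'a \<Rightarrow> bool" where
  "hier t \<alpha> f \<longleftrightarrow> is_fun f (succ \<alpha>) \<and> (\<forall>\<beta>. \<beta> \<^bold>\<in> succ \<alpha> \<longrightarrow> (\<forall>u. u \<^bold>\<in> t \<longrightarrow>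
     (u \<^bold>\<in> ap f \<beta> \<longleftrightarrow> (\<exists>\<gamma>. \<gamma> \<^bold>\<in> \<beta> \<and> (\<forall>w. w \<^bold>\<in> u \<longrightarrow> w \<^bold>\<in> ap f \<gamma>)))))"

lemma K_hier [defn]: assumes G [defn]: "good K" and "Fn K t" "Fn K u" "Fn K v"
  shows "inK K (\<lambda>e. hier (t e) (u e) (v e))"
  by (rule K_app3[OF G _ assms(2-4)]; unfold hier_def; intro defn)

text \<open>The elements of a set in \<open>t\<close> are again in \<open>t\<close> by transitivity,
  so restricting the recursion to \<open>t\<close> does not disturb it.\<close>

lemma hier_VV:
  assumes "Ord \<alpha>" "transitive t" "hier t \<alpha> f" "\<beta> \<^bold>\<in> succ \<alpha>" "u \<^bold>\<in> t"
  shows "u \<^bold>\<in> ap f \<beta> \<longleftrightarrow> u \<^bold>\<in> VV \<beta>"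
proof -
  let ?P = "\<lambda>\<beta>. \<beta> \<^bold>\<in> succ \<alpha> \<longrightarrow> (\<forall>u. u \<^bold>\<in> t \<longrightarrow> (u \<^bold>\<in> ap f \<beta> \<longleftrightarrow> u \<^bold>\<in> VV \<beta>))"
  have os: "Ord (succ \<alpha>)" using assms by simp
  have "?P \<beta>"
  proof (rule Ord_induct[where P = ?P])
    show "inK Df (\<lambda>e. ?P (e 0))" by (intro defn)
    show "Ord \<beta>" using Ord_mem[OF os assms(4)] .
  next
    fix \<beta> assume o: "Ord \<beta>" and IH: "\<And>\<gamma>. \<gamma> \<^bold>\<in> \<beta> \<Longrightarrow> ?P \<gamma>"
    show "?P \<beta>"
    proof (intro impI allI)
      fix u assume b: "\<beta> \<^bold>\<in> succ \<alpha>" and u: "u \<^bold>\<in> t"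
      have "w \<^bold>\<in> ap f \<gamma> \<longleftrightarrow> w \<^bold>\<in> VV \<gamma>" if "w \<^bold>\<in> u" "\<gamma> \<^bold>\<in> \<beta>" for w \<gamma>
        using IH[OF that(2)] Ord_trans[OF os that(2) b] that u assms(2) unfolding transitive_def by blast
      then show "u \<^bold>\<in> ap f \<beta> \<longleftrightarrow> u \<^bold>\<in> VV \<beta>"
        using assms(3) b u unfolding hier_def mem_VV[OF o] subs_def by metis
    qed
  qed
  with assms show ?thesis by blast
qed

lemma ex_hier: "\<exists>t f. transitive t \<and> z \<^bold>\<in> t \<and> (Ord \<alpha> \<longrightarrow> hier t \<alpha> f)"
proof -
  obtain \<xi> where x: "Ord \<xi>" "z \<^bold>\<in> VV \<xi>" using ex_VV by blast
  have F: "Fn Df (\<lambda>e. VV (e 0))" by (intro defn)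
  have "hier (VV \<xi>) \<alpha> (lam (succ \<alpha>) VV)" if o: "Ord \<alpha>"
  proof -
    have *: "ap (lam (succ \<alpha>) VV) \<beta> = VV \<beta>" if "\<beta> \<^bold>\<in> succ \<alpha>" for \<beta>
      using lam_fun(2)[OF F that] app_ap[OF lam_fun(1)[OF F] that] by simp
    have o2: "Ord \<beta>" "\<And>\<gamma>. \<gamma> \<^bold>\<in> \<beta> \<Longrightarrow> \<gamma> \<^bold>\<in> succ \<alpha>" if "\<beta> \<^bold>\<in> succ \<alpha>" for \<beta>
      using Ord_mem[OF Ord_succ[OF o] that] Ord_trans[OF Ord_succ[OF o] _ that] by blast+
    show ?thesis
      unfolding hier_def
    proof (intro conjI lam_fun(1)[OF F] allI impI)
      fix \<beta> u assume b: "\<beta> \<^bold>\<in> succ \<alpha>"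
      show "u \<^bold>\<in> ap (lam (succ \<alpha>) VV) \<beta> \<longleftrightarrow>
          (\<exists>\<gamma>. \<gamma> \<^bold>\<in> \<beta> \<and> (\<forall>w. w \<^bold>\<in> u \<longrightarrow> w \<^bold>\<in> ap (lam (succ \<alpha>) VV) \<gamma>))"
        unfolding *[OF b] mem_VV[OF o2(1)[OF b]] subs_def
        by (intro ex_cong1 conj_cong refl) (simp only: *[OF o2(2)[OF b]])
    qed
  qed
  then show ?thesis using x transitive_VV by blast
qed

lemma VV_nonord: "\<not> Ord \<alpha> \<Longrightarrow> VV \<alpha> = zero"
  unfolding VV_def iter_def by (rule the_set_eq) simp

text \<open>A partial hierarchy on some transitive set containing \<open>z\<close> decides the
  membership either way. Hence membership in V_\<alpha> is Delta_1, whereas being equal to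
  V_\<alpha> is shown only to be Pi_1.\<close>

lemma K_inVV [defn]:
  assumes "Fn (Dl (Suc n)) t" "Fn (Dl (Suc n)) u" shows "inK (Dl (Suc n)) (\<lambda>e. inVV (t e) (u e))"
proof (rule K_app2[OF good_Dl _ assms])
  have 1: "inVV z \<alpha> \<longleftrightarrow> (\<exists>t f. Ord \<alpha> \<and> transitive t \<and> z \<^bold>\<in> t \<and> hier t \<alpha> f \<and> z \<^bold>\<in> ap f \<alpha>)" for z \<alpha>
  proof (cases "Ord \<alpha>")
    case True
    then show ?thesis
      using ex_hier[of z \<alpha>] hier_VV[OF True, of _ _ \<alpha> z] unfolding inVV_def by (metis mem_succ)
  qed (simp add: inVV_def VV_nonord)
  have 2: "\<not> inVV z \<alpha> \<longleftrightarrow> (\<exists>t f. \<not> Ord \<alpha> \<or> transitive t \<and> z \<^bold>\<in> t \<and> hier t \<alpha> f \<and> \<not> z \<^bold>\<in> ap f \<alpha>)" for z \<alpha>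
  proof (cases "Ord \<alpha>")
    case True
    then show ?thesis
      using ex_hier[of z \<alpha>] hier_VV[OF True, of _ _ \<alpha> z] unfolding inVV_def by (metis mem_succ)
  qed (simp add: inVV_def VV_nonord)
  show "inK (Dl (Suc n)) (\<lambda>e. inVV (e 0) (e 1))"
    unfolding Dl_iff Pg_neg 2 unfolding 1 by (intro conjI Sg_ex Dl_Sg; intro defn)
qed

lemma Pg_all:
  assumes "inK (Pg (Suc n)) (\<lambda>e. P (e 0) (\<lambda>i. e (Suc i)))" shows "inK (Pg (Suc n)) (\<lambda>e. \<forall>x. P x e)"
  using Sg_ex[of n "\<lambda>x e. \<not> P x e"] assms by (simp add: Pg_neg)

lemma VV_graph: "y = VV \<alpha> \<longleftrightarrow> (\<forall>z. z \<^bold>\<in> y \<longleftrightarrow> inVV z \<alpha>)"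
  unfolding inVV_def using ext by blast

lemma Pg_VV_graph: "inK (Pg (Suc n)) (\<lambda>e. e i = VV (e j))"
  unfolding VV_graph by (intro Pg_all Dl_Pg; intro defn)

lemma Fn_VV_Dl [defn]:
  assumes "Fn (Dl (Suc (Suc n))) t" shows "Fn (Dl (Suc (Suc n))) (\<lambda>e. VV (t e))"
  by (rule Fn_app1[OF good_Dl _ assms]) (simp add: Fn_def Dl_Suc Pg_VV_graph)

end

section \<open>The classes \<open>C\<^sup>(\<^sup>n\<^sup>)\<close>\<close>

lemma Sigma_Pi_Suc: "(Sigma_fm n p \<longrightarrow> Sigma_fm (Suc n) p) \<and> (Pi_fm m q \<longrightarrow> Pi_fm (Suc m) q)"
  by (induction rule: Sigma_fm_Pi_fm.induct) (simp_all add: Sigma_fm_Pi_fm.intros)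

lemma Sigma_mono: "m \<le> n \<Longrightarrow> Sigma_fm m p \<Longrightarrow> Sigma_fm n p"
  by (induction rule: dec_induct) (use Sigma_Pi_Suc[of _ p 0 undefined] in auto)

context set_structure
begin

text \<open>The formula classes are prenex and thus not closed under \<open>Neg\<close> literally;
  the dual formula is equivalent in every structure.\<close>

lemma Sigma_Pi_dual:
  "(Sigma_fm n p \<longrightarrow> (\<exists>q. Pi_fm n q \<and> (\<forall>A s. sat A s q \<longleftrightarrow> \<not> sat A s p))) \<and>
   (Pi_fm m r \<longrightarrow> (\<exists>q. Sigma_fm m q \<and> (\<forall>A s. sat A s q \<longleftrightarrow> \<not> sat A s r)))"
proof (induction rule: Sigma_fm_Pi_fm.induct)
  case (1 p)
  then show ?case by (intro exI[of _ "Neg p"]) (simp add: delta0.intros Sigma_fm_Pi_fm.intros)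
next
  case (2 p)
  then show ?case by (intro exI[of _ "Neg p"]) (simp add: delta0.intros Sigma_fm_Pi_fm.intros)
next
  case (3 n p)
  then show ?case using Sigma_fm_Pi_fm.intros(5) by blast
next
  case (4 n p i)
  then obtain q where "Pi_fm (Suc n) q" "\<forall>A s. sat A s q \<longleftrightarrow> \<not> sat A s p" by blast
  then show ?case by (intro exI[of _ "All i q"] conjI Sigma_fm_Pi_fm.intros(6)) (auto simp: All_def)
next
  case (5 n p)
  then show ?case using Sigma_fm_Pi_fm.intros(3) by blast
next
  case (6 n p i)
  then obtain q where "Sigma_fm (Suc n) q" "\<forall>A s. sat A s q \<longleftrightarrow> \<not> sat A s p" by blast
  then show ?case by (intro exI[of _ "Ex i q"] conjI Sigma_fm_Pi_fm.intros(4)) (auto simp: All_def)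
qed

section \<open>Sigma_n-elementary substructures and correct sets\<close>

definition agree :: "nat \<Rightarrow> 'a set \<Rightarrow> 'a set \<Rightarrow> bool" where
  "agree n A B \<longleftrightarrow> A \<subseteq> B \<and> (\<forall>p s. Sigma_fm n p \<and> (\<forall>i. s i \<in> A) \<longrightarrow> (sat A s p \<longleftrightarrow> sat B s p))"

lemma agree_Pi:
  assumes "agree n A B" "Pi_fm n p" "\<And>i. s i \<in> A" shows "sat A s p \<longleftrightarrow> sat B s p"
proof -
  obtain q where q: "Sigma_fm n q" "\<forall>A s. sat A s q \<longleftrightarrow> \<not> sat A s p"
    using Sigma_Pi_dual[of 0 undefined n p] assms(2) by blast
  then have "sat A s q \<longleftrightarrow> sat B s q" using assms(1,3) unfolding agree_def by blast
  then show ?thesis using q(2) by blast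
qed

lemma agree_mono: "agree n A B \<Longrightarrow> m \<le> n \<Longrightarrow> agree m A B"
  unfolding agree_def using Sigma_mono by blast

lemma agree_up_aux:
  "(Sigma_fm k p \<longrightarrow> (\<forall>n s. k = Suc n \<longrightarrow> agree n A B \<longrightarrow> (\<forall>i. s i \<in> A) \<longrightarrow> sat A s p \<longrightarrow> sat B s p)) \<and>
   (Pi_fm l q \<longrightarrow> True)"
proof (induction rule: Sigma_fm_Pi_fm.induct)
  case (3 n p)
  then show ?case using agree_Pi by blast
next
  case (4 n p i)
  show ?case
  proof (intro allI impI)
    fix m s assume *: "Suc n = Suc m" "agree m A B" "\<forall>i. s i \<in> A" "sat A s (Ex i p)"
    then obtain x where x: "x \<in> A" "sat A (s(i := x)) p" by auto
    then have "sat B (s(i := x)) p" using 4 * by auto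
    moreover have "x \<in> B" using x(1) *(2) by (auto simp: agree_def)
    ultimately show "sat B s (Ex i p)" by auto
  qed
qed auto

lemma agree_up:
  "agree n A B \<Longrightarrow> Sigma_fm (Suc n) p \<Longrightarrow> (\<And>i. s i \<in> A) \<Longrightarrow> sat A s p \<Longrightarrow> sat B s p"
  using agree_up_aux[of "Suc n" p A B 0 undefined] by blast

lemma agree_down_Pi:
  assumes "agree n A B" "Pi_fm (Suc n) p" "\<And>i. s i \<in> A" "sat B s p" shows "sat A s p"
proof -
  obtain q where q: "Sigma_fm (Suc n) q" "\<forall>A s. sat A s q \<longleftrightarrow> \<not> sat A s p"
    using Sigma_Pi_dual[of 0 undefined "Suc n" p] assms(2) by blast
  have "sat A s q \<Longrightarrow> sat B s q" by (rule agree_up[OF assms(1) q(1)], rule assms(3))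
  then show ?thesis using q(2) assms(4) by blast
qed

lemma agree_trans: "agree n A UNIV \<Longrightarrow> agree n B UNIV \<Longrightarrow> A \<subseteq> B \<Longrightarrow> agree n A B"
  unfolding agree_def by blast

definition corr :: "nat \<Rightarrow> 'a \<Rightarrow> bool" where
  "corr n M \<longleftrightarrow> (\<exists>x. x \<^bold>\<in> M) \<and> transitive M \<and> agree n {x. x \<^bold>\<in> M} UNIV"

lemma corr_mono: "corr n M \<Longrightarrow> m \<le> n \<Longrightarrow> corr m M"
  unfolding corr_def using agree_mono by blast

lemma delta0_absolute:
  "delta0 p \<Longrightarrow> transitive M \<Longrightarrow> (\<And>i. s i \<^bold>\<in> M) \<Longrightarrow> sat {x. x \<^bold>\<in> M} s p \<longleftrightarrow> sat UNIV s p"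
proof (induction arbitrary: s rule: delta0.induct)
  case (5 p i j)
  have "x \<^bold>\<in> M" if "x \<^bold>\<in> s j" for x using 5(4,5) that unfolding transitive_def by blast
  moreover have "sat {x. x \<^bold>\<in> M} (s(i := x)) p \<longleftrightarrow> sat UNIV (s(i := x)) p" if "x \<^bold>\<in> M" for x
    using 5 that by simp
  ultimately show ?case using 5(2) by auto
qed auto

lemma corr_0: "corr 0 M \<longleftrightarrow> (\<exists>x. x \<^bold>\<in> M) \<and> transitive M"
  unfolding corr_def agree_def using delta0_absolute[of _ M] by (auto elim: Sigma_fm.cases)

end

context zfc
begin

lemma C_corr: "C n \<alpha> \<longleftrightarrow> Ord \<alpha> \<and> corr n (VV \<alpha>)"
  unfolding C_def corr_def agree_def using Vset_VV transitive_VV by auto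

text \<open>The set \<open>c\<close> packs witnesses for the leading existential quantifiers into
  nested pairs. A transitive set that contains \<open>c\<close> contains these witnesses, and if
  Sigma_n-correct it recognises the remaining Pi_n formula as true.\<close>

lemma reflection_witness:
  "Sigma_fm (Suc n) p \<Longrightarrow> sat UNIV s p \<Longrightarrow>
    \<exists>c. \<forall>M. corr n M \<and> (\<forall>i. s i \<^bold>\<in> M) \<and> c \<^bold>\<in> M \<longrightarrow> sat {x. x \<^bold>\<in> M} s p"
proof -
  have "(Sigma_fm k p \<longrightarrow> (\<forall>n s. k = Suc n \<longrightarrow> sat UNIV s p \<longrightarrow>
      (\<exists>c. \<forall>M. corr n M \<and> (\<forall>i. s i \<^bold>\<in> M) \<and> c \<^bold>\<in> M \<longrightarrow> sat {x. x \<^bold>\<in> M} s p))) \<and> (Pi_fm l q \<longrightarrow> True)" for k l q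
  proof (induction rule: Sigma_fm_Pi_fm.induct)
    case (3 n p)
    have "sat {x. x \<^bold>\<in> M} s p \<longleftrightarrow> sat UNIV s p" if "corr n M" "\<forall>i. s i \<^bold>\<in> M" for M s
      using agree_Pi[of n _ UNIV p s] 3 that unfolding corr_def by auto
    then show ?case by blast
  next
    case (4 n p i)
    show ?case
    proof (intro allI impI)
      fix m s assume m: "Suc n = Suc m" and "sat UNIV s (Ex i p)"
      then obtain x where "sat UNIV (s(i := x)) p" by auto
      then obtain c where c: "\<forall>M. corr m M \<and> (\<forall>k. (s(i := x)) k \<^bold>\<in> M) \<and> c \<^bold>\<in> M \<longrightarrow> sat {x. x \<^bold>\<in> M} (s(i := x)) p"
        using 4 m by blast
      have "sat {x. x \<^bold>\<in> M} s (Ex i p)" if M: "corr m M" "\<forall>i. s i \<^bold>\<in> M" "opair x c \<^bold>\<in> M" for M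
      proof -
        have "x \<^bold>\<in> M" "c \<^bold>\<in> M" using M opair_transitive unfolding corr_def by blast+
        moreover from this have "sat {x. x \<^bold>\<in> M} (s(i := x)) p" using c M by simp
        ultimately show ?thesis by auto
      qed
      then show "\<exists>c. \<forall>M. corr m M \<and> (\<forall>i. s i \<^bold>\<in> M) \<and> c \<^bold>\<in> M \<longrightarrow> sat {x. x \<^bold>\<in> M} s (Ex i p)" by blast
    qed
  qed auto
  then show "Sigma_fm (Suc n) p \<Longrightarrow> sat UNIV s p \<Longrightarrow> ?thesis" by blast
qed

text \<open>Sigma_(n+1) absorbs the existential quantifier, so \<open>M\<close> finds a witness; the
  matrix is Sigma_(n+1) too, so what \<open>M\<close> takes for a witness really is one.\<close>

lemma corr_witness:
  assumes M: "corr (Suc n) M" and P: "inK (Sg (Suc n)) (\<lambda>e. P (e 0) (\<lambda>i. e (Suc i)))"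
    and e: "\<And>i. e i \<^bold>\<in> M" and x: "P x e"
  shows "\<exists>x. x \<^bold>\<in> M \<and> P x e"
proof -
  obtain p where p: "Sigma_fm (Suc n) p" "\<And>e. sat UNIV e p \<longleftrightarrow> P (e 0) (\<lambda>i. e (Suc i))"
    using Sg_formula[OF P] by blast
  obtain k where k: "\<forall>i\<in>vars p. i < k" using vars_bound by metis
  have a: "agree (Suc n) {x. x \<^bold>\<in> M} UNIV" using M by (simp add: corr_def)
  have "sat UNIV e (Ex k (ren p (case_nat k id)))"
    unfolding sat_Ex_ren[OF k] using p(2)[of "case_nat x e"] x by auto
  moreover have "Sigma_fm (Suc n) (Ex k (ren p (case_nat k id)))"
    using p(1) by (intro Sigma_fm_Pi_fm.intros(4) Sigma_ren)
  ultimately have "sat {x. x \<^bold>\<in> M} e (Ex k (ren p (case_nat k id)))"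
    using a e unfolding agree_def by blast
  then obtain y where y: "y \<^bold>\<in> M" "sat {x. x \<^bold>\<in> M} (case_nat y e) p"
    unfolding sat_Ex_ren[OF k] by auto
  have "case_nat y e i \<^bold>\<in> M" for i using e y(1) by (cases i) auto
  then have "sat UNIV (case_nat y e) p" using a p(1) y(2) unfolding agree_def by simp
  then show ?thesis using p(2)[of "case_nat y e"] y(1) by auto
qed

text \<open>\<open>Q n\<close> is the class of the \<open>V\<^sub>\<alpha>\<close> with \<open>\<alpha> \<in> C\<^sup>(\<^sup>n\<^sup>)\<close>. At level \<open>0\<close> all nonempty transitive sets are admitted,
  because "is some \<open>V\<^sub>\<alpha>\<close>" is not \<open>\<Delta>\<^sub>1\<close>.\<close>

definition Q :: "nat \<Rightarrow> 'a \<Rightarrow> bool" where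
  "Q n M \<longleftrightarrow> corr n M \<and> (n = 0 \<or> (\<exists>\<alpha>. Ord \<alpha> \<and> M = VV \<alpha>))"

definition ords :: "'a \<Rightarrow> 'a" where "ords M = Sep M Ord"

definition limM :: "'a \<Rightarrow> bool" where
  "limM M \<longleftrightarrow> Lim (ords M) \<and> omega \<^bold>\<in> ords M \<and> M = VV (ords M)"

text \<open>The parameters are carried by the assignment \<open>s\<close>, an element of
  \<open>M\<close>. \<open>SatR\<close> includes that \<open>s\<close> takes its values in the
  structure, so the smaller structure contains the parameters as well.\<close>

definition reflecting :: "nat \<Rightarrow> 'a \<Rightarrow> bool" where
  "reflecting n M \<longleftrightarrow> (\<forall>N p s. Q n N \<and> p \<^bold>\<in> M \<and> s \<^bold>\<in> M \<and> SatR N p s \<longrightarrow> (\<exists>N'. N' \<^bold>\<in> M \<and> Q n N' \<and> SatR N' p s))"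

lemma mem_ords: "z \<^bold>\<in> ords M \<longleftrightarrow> z \<^bold>\<in> M \<and> Ord z"
  unfolding ords_def by (rule mem_Sep) (intro defn)

lemma ords_VV: "Ord \<alpha> \<Longrightarrow> ords (VV \<alpha>) = \<alpha>"
  by (rule ext) (metis mem_ords Ord_mem_VV Ord_mem)

lemma Fn_ords [defn]: assumes G [defn]: "good K" and "Fn K t" shows "Fn K (\<lambda>e. ords (t e))"
proof (rule Fn_app1[OF G _ assms(2)])
  have "y = ords M \<longleftrightarrow> (\<forall>z. z \<^bold>\<in> y \<longrightarrow> z \<^bold>\<in> M \<and> Ord z) \<and> (\<forall>z. z \<^bold>\<in> M \<longrightarrow> Ord z \<longrightarrow> z \<^bold>\<in> y)" for y M
    using ext[of y "ords M"] by (auto simp: mem_ords)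
  then show "Fn K (\<lambda>e. ords (e 0))" unfolding Fn_def by (simp only:) (intro defn)
qed

lemma K_Lim [defn]: assumes G [defn]: "good K" and "Fn K t" shows "inK K (\<lambda>e. Lim (t e))"
  by (rule K_app1[OF G _ assms(2)]; unfold Lim_def; intro defn)

lemma K_limM: "inK (Dl (Suc (Suc n))) (\<lambda>e. limM (e i))"
  unfolding limM_def by (intro defn)

lemma limM_VV: "limM M \<longleftrightarrow> (\<exists>\<alpha>. Lim \<alpha> \<and> omega \<^bold>\<in> \<alpha> \<and> M = VV \<alpha>)"
  unfolding limM_def using ords_VV Lim_Ord by metis

lemma Q_Suc: "Q (Suc n) M \<longleftrightarrow> corr (Suc n) M \<and> (\<exists>\<alpha>. Ord \<alpha> \<and> M = VV \<alpha>)"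
  by (simp add: Q_def)

lemma C_Q: "C (Suc n) \<alpha> \<longleftrightarrow> Ord \<alpha> \<and> Q (Suc n) (VV \<alpha>)"
  unfolding C_corr Q_Suc by blast

lemma Q_corr: "Q n M \<Longrightarrow> corr n M"
  by (simp add: Q_def)

lemma Q_0_K: "inK (Dl (Suc n)) (\<lambda>e. Q 0 (e 0))"
proof -
  have "Q 0 M \<longleftrightarrow> (\<exists>x. x \<^bold>\<in> M \<and> True) \<and> transitive M" for M by (simp add: Q_def corr_0)
  then show ?thesis by (simp only:) (intro defn)
qed

text \<open>The graphs of \<open>omega\<close> and \<open>succ\<close> are Delta_1, so a
  Sigma_1-correct set contains \<omega> and is closed under successors.\<close>

lemma corr_limM:
  assumes M: "corr (Suc n) M" "M = VV \<alpha>" "Ord \<alpha>" shows "limM M"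
proof -
  obtain y where y: "y \<^bold>\<in> M" using M(1) by (auto simp: corr_def)
  have "inK (Sg (Suc n)) (\<lambda>e. e 0 = omega)" "inK (Sg (Suc n)) (\<lambda>e. e 0 = succ (e 1))"
    by (intro Dl_Sg defn)+
  from corr_witness[where P = "\<lambda>x e. x = omega", OF M(1) this(1), of "\<lambda>_. y"]
    corr_witness[where P = "\<lambda>x e. x = succ (e 0)" and e = "\<lambda>_. \<beta>" for \<beta>, OF M(1)] this(2) y
  have o: "omega \<^bold>\<in> VV \<alpha>" and s: "\<And>\<beta>. \<beta> \<^bold>\<in> VV \<alpha> \<Longrightarrow> succ \<beta> \<^bold>\<in> VV \<alpha>"
    unfolding M(2) by (simp, simp)
  have o: "omega \<^bold>\<in> \<alpha>" using o Ord_mem_VV[OF M(3)] by simp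
  have "Lim \<alpha>"
    unfolding Lim_def using Ord_trans[OF M(3) zero_omega o] M(3) s Ord_mem_VV[OF M(3)] Ord_mem[OF M(3)] Ord_succ
    by metis
  then show ?thesis using o M(2) limM_VV by blast
qed

text \<open>Even the trivial formula \<open>cEq zero zero\<close> carries information: its
  satisfaction in \<open>N'\<close> under \<open>s\<close> forces the values of \<open>s\<close>, in
  particular \<open>x\<close>, into \<open>N'\<close>.\<close>

lemma reflect_mem:
  assumes M: "limM M" and r: "reflecting n M" and u: "\<And>x. \<exists>N. Q n N \<and> x \<^bold>\<in> N" and x: "x \<^bold>\<in> M"
  shows "\<exists>N. N \<^bold>\<in> M \<and> Q n N \<and> x \<^bold>\<in> N"
proof -
  obtain \<alpha> where a: "Lim \<alpha>" "omega \<^bold>\<in> \<alpha>" "M = VV \<alpha>" using M limM_VV by blast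
  obtain s where s: "s \<^bold>\<in> M" "maps s omega M" "ap s (num 0) = x"
    using Lim_assignment[OF a(1,2), of "\<lambda>_. x" 1] x unfolding a(3) by auto
  obtain N where N: "Q n N" "s \<^bold>\<in> N" using u by blast
  have sN: "maps s omega N"
    unfolding maps_ap using assignment_mem[of N s omega] N s(2) unfolding Q_def corr_def maps_def by blast
  let ?p = "cEq zero zero"
  have "SatR N ?p s" using SatR_rules(2)[OF sN] by simp
  moreover have "?p \<^bold>\<in> M"
    using VV_mono[OF Lim_Ord[OF a(1)] a(2)] fm_closed_VV_omega unfolding a(3) fm_closed_def by simp
  ultimately obtain N' where N': "N' \<^bold>\<in> M" "Q n N'" "SatR N' ?p s" using r N(1) s(1) unfolding reflecting_def by blast
  then have "ap s (num 0) \<^bold>\<in> N'" unfolding SatR_def maps_ap using num_omega[of 0] by blast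
  with N' s(3) show ?thesis by blast
qed

text \<open>Only finitely many variables occur in \<open>p\<close>, so an external environment may
  be replaced by one read off from an assignment that belongs to \<open>M\<close>.\<close>

lemma corr_into:
  assumes "limM M"
    "\<And>e s. maps s omega M \<Longrightarrow> s \<^bold>\<in> M \<Longrightarrow> (\<And>i. e i = ap s (num i)) \<Longrightarrow>
      sat {x. x \<^bold>\<in> M} e p \<longleftrightarrow> sat UNIV e p" and e: "\<And>i. e i \<^bold>\<in> M"
  shows "sat {x. x \<^bold>\<in> M} e p \<longleftrightarrow> sat UNIV e p"
proof -
  obtain \<alpha> where a: "Lim \<alpha>" "omega \<^bold>\<in> \<alpha>" "M = VV \<alpha>" using assms(1) limM_VV by blast
  obtain k where k: "\<forall>i\<in>vars p. i < k" using vars_bound by metis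
  obtain s where s: "s \<^bold>\<in> M" "maps s omega M" "\<forall>i<k. ap s (num i) = e i"
    using Lim_assignment[OF a(1,2), of e k] e unfolding a(3) by auto
  have "sat A e p \<longleftrightarrow> sat A (\<lambda>i. ap s (num i)) p" for A
    using k s(3) by (intro sat_cong) auto
  then show ?thesis using assms(2)[OF s(2,1), of "\<lambda>i. ap s (num i)"] by simp
qed

text \<open>By induction on the level: a true formula with parameters in \<open>M\<close> holds in
  some correct \<open>N\<close> in \<open>M\<close> that contains them, and \<open>N\<close> is
  elementary in \<open>M\<close> to one degree less, which is enough to carry the formula
  up.\<close>

lemma limit_corr:
  assumes M: "limM M" and cof: "\<And>x. x \<^bold>\<in> M \<Longrightarrow> \<exists>N. N \<^bold>\<in> M \<and> corr n N \<and> x \<^bold>\<in> N"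
  shows "corr n M"
proof -
  obtain \<alpha> where a: "Lim \<alpha>" "omega \<^bold>\<in> \<alpha>" "M = VV \<alpha>" using M limM_VV by blast
  have t: "transitive M" "\<exists>x. x \<^bold>\<in> M"
    using transitive_VV a Lim_Ord Ord_mem_VV[of \<alpha> omega] by auto
  have sub: "{x. x \<^bold>\<in> N} \<subseteq> {x. x \<^bold>\<in> M}" if "N \<^bold>\<in> M" for N using t(1) that unfolding transitive_def by blast
  have "k \<le> n \<Longrightarrow> corr k M" for k
  proof (induction k)
    case 0
    then show ?case using t by (simp add: corr_0)
  next
    case (Suc k)
    then have IH: "agree k {x. x \<^bold>\<in> M} UNIV" by (simp add: corr_def)
    have "sat {x. x \<^bold>\<in> M} e p \<longleftrightarrow> sat UNIV e p" if p: "Sigma_fm (Suc k) p" and "\<And>i. e i \<^bold>\<in> M" for p e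
    proof (rule corr_into[OF M _ that(2)])
      fix e s assume s: "maps s omega M" "s \<^bold>\<in> M" and e: "\<And>i. e i = ap s (num i)"
      obtain N where N: "N \<^bold>\<in> M" "corr n N" "s \<^bold>\<in> N" using cof[OF s(2)] by blast
      then have eN: "e i \<^bold>\<in> N" for i
        using assignment_mem[of N s omega] s(1) num_omega unfolding e corr_def maps_def by blast
      have N': "agree (Suc k) {x. x \<^bold>\<in> N} UNIV" using corr_mono[OF N(2) Suc.prems] by (simp add: corr_def)
      have eM: "e i \<^bold>\<in> M" for i using eN sub[OF N(1)] by blast
      show "sat {x. x \<^bold>\<in> M} e p \<longleftrightarrow> sat UNIV e p"
      proof
        show "sat {x. x \<^bold>\<in> M} e p \<Longrightarrow> sat UNIV e p" using agree_up[OF IH p] eM by blast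
        assume "sat UNIV e p"
        then have "sat {x. x \<^bold>\<in> N} e p" using N' p eN unfolding agree_def by blast
        moreover have "agree k {x. x \<^bold>\<in> N} {x. x \<^bold>\<in> M}"
          using agree_trans[OF agree_mono[OF N'] IH sub[OF N(1)]] by simp
        ultimately show "sat {x. x \<^bold>\<in> M} e p" using agree_up[OF _ p] eN by blast
      qed
    qed
    then show ?case unfolding corr_def agree_def using t by auto
  qed
  then show ?thesis by simp
qed

text \<open>A true Sigma_(n+1) formula holds in a Sigma_n-correct \<open>N\<close> containing its
  parameters and witnesses. Reflection replaces \<open>N\<close> by some \<open>N'\<close> in
  \<open>M\<close>, and the formula goes up from \<open>N'\<close> to \<open>M\<close> because both
  are Sigma_n-correct.\<close>

lemma reflecting_corr:
  assumes M: "limM M" and r: "reflecting n M" and u: "\<And>x. \<exists>N. Q n N \<and> x \<^bold>\<in> N"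
  shows "corr (Suc n) M"
proof -
  obtain \<alpha> where a: "Lim \<alpha>" "omega \<^bold>\<in> \<alpha>" "M = VV \<alpha>" using M limM_VV by blast
  have c: "corr n M"
    by (rule limit_corr[OF M]) (use reflect_mem[OF M r u] Q_corr in blast)
  then have t: "transitive M" "\<exists>x. x \<^bold>\<in> M" and A: "agree n {x. x \<^bold>\<in> M} UNIV" by (simp_all add: corr_def)
  have sub: "{x. x \<^bold>\<in> N} \<subseteq> {x. x \<^bold>\<in> M}" if "N \<^bold>\<in> M" for N using t(1) that unfolding transitive_def by blast
  have "sat {x. x \<^bold>\<in> M} e p \<longleftrightarrow> sat UNIV e p" if p: "Sigma_fm (Suc n) p" and "\<And>i. e i \<^bold>\<in> M" for p e
  proof (rule corr_into[OF M _ that(2)])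
    fix e s assume s: "maps s omega M" "s \<^bold>\<in> M" and e: "\<And>i. e i = ap s (num i)"
    have e': "e = (\<lambda>i. ap s (num i))" using e by blast
    have eM: "e i \<^bold>\<in> M" for i using s(1) num_omega unfolding e maps_ap by blast
    show "sat {x. x \<^bold>\<in> M} e p \<longleftrightarrow> sat UNIV e p"
    proof
      show "sat {x. x \<^bold>\<in> M} e p \<Longrightarrow> sat UNIV e p" using agree_up[OF A p] eM by blast
      assume "sat UNIV e p"
      from reflection_witness[OF p this] obtain c where
        c: "\<forall>M. corr n M \<and> (\<forall>i. e i \<^bold>\<in> M) \<and> c \<^bold>\<in> M \<longrightarrow> sat {x. x \<^bold>\<in> M} e p" by blast
      obtain N where N: "Q n N" "opair c s \<^bold>\<in> N" using u by blast
      have cN: "corr n N" "c \<^bold>\<in> N" "s \<^bold>\<in> N"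
        using N Q_corr opair_transitive unfolding corr_def by blast+
      have sN: "maps s omega N"
        unfolding maps_ap using assignment_mem[of N s omega] cN s(1) unfolding corr_def maps_def by blast
      then have "e i \<^bold>\<in> N" for i unfolding e maps_ap using num_omega by blast
      then have "sat {x. x \<^bold>\<in> N} e p" using c cN by blast
      then have "SatR N (code p) s" using SatR_sat[OF sN] e' by simp
      moreover have "code p \<^bold>\<in> M"
        using VV_mono[OF Lim_Ord[OF a(1)] a(2)] code_Codes[of p] fm_closed_VV_omega
        unfolding a(3) mem_Codes is_code_def by blast
      ultimately obtain N' where N': "N' \<^bold>\<in> M" "Q n N'" "SatR N' (code p) s"
        using r N(1) s(2) unfolding reflecting_def by blast
      then have sN': "maps s omega N'" by (simp add: SatR_def)
      then have "sat {x. x \<^bold>\<in> N'} e p" "\<And>i. e i \<^bold>\<in> N'"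
        using SatR_sat[OF sN'] N'(3) e' num_omega unfolding maps_ap by auto
      moreover have "agree n {x. x \<^bold>\<in> N'} {x. x \<^bold>\<in> M}"
        using agree_trans[OF _ A sub[OF N'(1)]] Q_corr[OF N'(2)] unfolding corr_def by blast
      ultimately show "sat {x. x \<^bold>\<in> M} e p" using agree_up[OF _ p] by blast
    qed
  qed
  then show ?thesis unfolding corr_def agree_def using t by auto
qed

text \<open>The existence of a structure in \<open>Q n\<close> satisfying \<open>p\<close> under
  \<open>s\<close> is one Sigma_(n+1) statement about \<open>p\<close> and \<open>s\<close>, so
  correctness treats all codes at once, nonstandard ones included.\<close>

lemma corr_reflecting:
  assumes K: "inK (Dl (Suc n)) (\<lambda>e. Q n (e 0))" and M: "corr (Suc n) M"
  shows "reflecting n M"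
  unfolding reflecting_def
proof (intro allI impI)
  fix N p s assume *: "Q n N \<and> p \<^bold>\<in> M \<and> s \<^bold>\<in> M \<and> SatR N p s"
  have "inK (Sg (Suc n)) (\<lambda>e. Q n (e 0) \<and> SatR (e 0) (e 1) (e 2))"
    by (intro Dl_Sg defn K)
  moreover have "case_nat p (\<lambda>_. s) i \<^bold>\<in> M" for i using * by (cases i) auto
  ultimately show "\<exists>N'. N' \<^bold>\<in> M \<and> Q n N' \<and> SatR N' p s"
    using corr_witness[where P = "\<lambda>x e. Q n x \<and> SatR x (e 0) (e 1)" and e = "case_nat p (\<lambda>_. s)", OF M] *
    by (simp add: numeral_2_eq_2, blast)
qed

lemma Q_Suc_reflecting:
  assumes K: "inK (Dl (Suc n)) (\<lambda>e. Q n (e 0))" and u: "\<And>x. \<exists>N. Q n N \<and> x \<^bold>\<in> N"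
  shows "Q (Suc n) M \<longleftrightarrow> limM M \<and> reflecting n M"
  using corr_reflecting[OF K] reflecting_corr[OF _ _ u] corr_limM limM_VV Lim_Ord unfolding Q_Suc by metis

text \<open>In the negation the search for \<open>N'\<close> is bounded by \<open>M\<close>, so it
  stays Delta_(n+1) under the outer existential quantifiers.\<close>

lemma Pg_reflecting:
  assumes K: "inK (Dl (Suc n)) (\<lambda>e. Q n (e 0))" shows "inK (Pg (Suc n)) (\<lambda>e. reflecting n (e 0))"
proof -
  have "\<not> reflecting n M \<longleftrightarrow> (\<exists>N p s. Q n N \<and> p \<^bold>\<in> M \<and> s \<^bold>\<in> M \<and> SatR N p s \<and>
      \<not> (\<exists>N'. N' \<^bold>\<in> M \<and> Q n N' \<and> SatR N' p s))" for M
    unfolding reflecting_def by blast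
  then show ?thesis
    unfolding Pg_neg by (simp only:) (intro Sg_ex Dl_Sg; intro defn K_app1[OF good_Dl K])
qed

lemma VV_union:
  assumes "\<And>z. z \<^bold>\<in> M \<Longrightarrow> \<exists>\<xi>. Ord \<xi> \<and> z \<^bold>\<in> VV \<xi> \<and> subs (VV \<xi>) M"
  shows "Ord (ords M) \<and> M = VV (ords M)"
proof
  have "transitive (ords M)"
    unfolding transitive_def mem_ords
  proof (intro allI impI, elim conjE, intro conjI)
    fix \<beta> \<gamma> assume b: "\<beta> \<^bold>\<in> M" "Ord \<beta>" "\<gamma> \<^bold>\<in> \<beta>"
    show "\<gamma> \<^bold>\<in> M" using assms[OF b(1)] b(3) VV_trans unfolding subs_def by blast
    show "Ord \<gamma>" using b Ord_mem by blast
  qed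
  then show o: "Ord (ords M)" unfolding Ord_def mem_ords by simp
  show "M = VV (ords M)"
  proof (rule ext)
    fix z
    have *: "\<gamma> \<^bold>\<in> \<xi> \<Longrightarrow> Ord \<xi> \<Longrightarrow> subs (VV \<xi>) M \<Longrightarrow> \<gamma> \<^bold>\<in> ords M" for \<gamma> \<xi>
      using subs_VV[of \<xi>] Ord_mem unfolding mem_ords subs_def by blast
    show "z \<^bold>\<in> M \<longleftrightarrow> z \<^bold>\<in> VV (ords M)"
    proof
      assume "z \<^bold>\<in> M"
      then obtain \<xi> where x: "Ord \<xi>" "z \<^bold>\<in> VV \<xi>" "subs (VV \<xi>) M" using assms by blast
      then obtain \<gamma> where "\<gamma> \<^bold>\<in> \<xi>" "subs z (VV \<gamma>)" using mem_VV by blast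
      then show "z \<^bold>\<in> VV (ords M)" using * x mem_VV[OF o] by blast
    next
      assume "z \<^bold>\<in> VV (ords M)"
      then obtain \<gamma> where g: "\<gamma> \<^bold>\<in> M" "Ord \<gamma>" "subs z (VV \<gamma>)" unfolding mem_VV[OF o] mem_ords by blast
      obtain \<xi> where x: "Ord \<xi>" "\<gamma> \<^bold>\<in> VV \<xi>" "subs (VV \<xi>) M" using assms[OF g(1)] by blast
      then have "z \<^bold>\<in> VV \<xi>" using g Ord_mem_VV mem_VV by blast
      then show "z \<^bold>\<in> M" using x unfolding subs_def by blast
    qed
  qed
qed

text \<open>\<open>M\<close> is the union of \<open>\<omega>\<close> many \<open>V\<^sub>\<xi>\<close>, each of which contains the witnesses required by its predecessors.\<close>

lemma ex_reflecting:
  assumes K: "inK Df (\<lambda>e. Q n (e 0))" shows "\<exists>M. limM M \<and> reflecting n M \<and> x \<^bold>\<in> M"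
proof -
  note Kr = K_app1[OF good_Df K]
  let ?g = "\<lambda>y \<xi>. y \<^bold>\<in> VV \<xi> \<and> (\<forall>p. p \<^bold>\<in> y \<longrightarrow> (\<forall>s. s \<^bold>\<in> y \<longrightarrow> (\<exists>N. Q n N \<and> SatR N p s) \<longrightarrow>
      (\<exists>N. N \<^bold>\<in> VV \<xi> \<and> Q n N \<and> SatR N p s)))"
  \<comment> \<open>Taking the least \<xi> makes the closure step \<open>H\<close> a definable
    function, as the recursion \<open>iter\<close> requires.\<close>
  let ?l = "\<lambda>y \<xi>. Ord \<xi> \<and> ?g y \<xi> \<and> (\<forall>\<eta>. \<eta> \<^bold>\<in> \<xi> \<longrightarrow> \<not> ?g y \<eta>)"
  have ex: "\<exists>\<xi>. ?l y \<xi>" for y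
  proof -
    let ?R = "\<lambda>z N. \<forall>p s. z = opair p s \<longrightarrow> (\<exists>N. Q n N \<and> SatR N p s) \<longrightarrow> Q n N \<and> SatR N p s"
    obtain w where w: "\<forall>p s. p \<^bold>\<in> y \<and> s \<^bold>\<in> y \<longrightarrow> opair p s \<^bold>\<in> w" using ex_product[of y y] by (elim exE)
    have "inK Df (\<lambda>e. ?R (e 0) (e 1))" by (intro defn Kr)
    moreover have "\<exists>N. ?R z N" for z
      by (cases "\<exists>p s. z = opair p s \<and> (\<exists>N. Q n N \<and> SatR N p s)") auto
    ultimately obtain W where W: "\<forall>z. z \<^bold>\<in> w \<longrightarrow> (\<exists>N. N \<^bold>\<in> W \<and> ?R z N)"
      using collection[where R = ?R and a = w] by blast
    obtain \<xi> where x: "Ord \<xi>" "W \<^bold>\<in> VV \<xi>" "y \<^bold>\<in> VV \<xi>" using ex_VV2 by blast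
    have "?g y \<xi>"
    proof (intro conjI x allI impI)
      fix p s assume p: "p \<^bold>\<in> y" and s: "s \<^bold>\<in> y" and N: "\<exists>N. Q n N \<and> SatR N p s"
      obtain N where "N \<^bold>\<in> W" "Q n N \<and> SatR N p s" using W w p s N by blast
      then show "\<exists>N. N \<^bold>\<in> VV \<xi> \<and> Q n N \<and> SatR N p s" using VV_trans[OF x(1,2)] by blast
    qed
    moreover have "inK Df (\<lambda>e. ?g y (e 0))" by (intro defn Kr)
    ultimately show ?thesis using Ord_least[where P = "?g y"] x(1) by blast
  qed
  have uniq: "\<xi> = \<xi>'" if "?l y \<xi>" "?l y \<xi>'" for y \<xi> \<xi>' using that Ord_linear by blast
  define H where "H y = VV (THE \<xi>. ?l y \<xi>)" for y
  have H: "\<exists>\<xi>. ?l y \<xi> \<and> H y = VV \<xi>" for y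
    using theI'[of "?l y"] ex uniq unfolding H_def by blast
  have HF: "Fn Df (\<lambda>e. H (e 0))"
  proof -
    have "z = H y \<longleftrightarrow> (\<exists>\<xi>. ?l y \<xi> \<and> z = VV \<xi>)" for z y
    proof
      show "z = H y \<Longrightarrow> \<exists>\<xi>. ?l y \<xi> \<and> z = VV \<xi>" using H[of y] by (simp only:)
      assume "\<exists>\<xi>. ?l y \<xi> \<and> z = VV \<xi>"
      then obtain \<xi> where x: "?l y \<xi>" "z = VV \<xi>" by (elim exE conjE) (rule that, intro conjI)
      obtain \<xi>' where x': "?l y \<xi>'" "H y = VV \<xi>'" using H[of y] by (elim exE conjE) (rule that, intro conjI)
      have "\<xi> = \<xi>'" by (rule uniq[OF x(1) x'(1)])
      then show "z = H y" using x(2) x'(2) by (simp only:)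
    qed
    then show ?thesis unfolding Fn_def by (simp only:) (intro defn Kr)
  qed
  obtain \<gamma>0 where g: "Ord \<gamma>0" "x \<^bold>\<in> VV \<gamma>0" "omega \<^bold>\<in> VV \<gamma>0" using ex_VV2 by blast
  define F where "F = iter H (VV \<gamma>0)"
  note it = mem_iter[OF HF, where B = "VV \<gamma>0", folded F_def]
  define M where "M = F omega"
  have Ok: "k \<^bold>\<in> omega \<Longrightarrow> Ord k" for k using Ord_mem[OF Ord_omega] .
  have HM: "subs (H (F k)) M" if "k \<^bold>\<in> omega" for k
    unfolding M_def subs_def it[OF Ord_omega] using that by blast
  have FH: "F k \<^bold>\<in> H (F k)" for k using H[of "F k"] by metis
  have inF: "\<exists>k. k \<^bold>\<in> omega \<and> z \<^bold>\<in> F k" if z: "z \<^bold>\<in> M" for z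
  proof (cases "z \<^bold>\<in> VV \<gamma>0")
    case True
    then show ?thesis using it[OF Ord_zero, of z] zero_omega by blast
  next
    case False
    then obtain k where "k \<^bold>\<in> omega" "z \<^bold>\<in> H (F k)" using z unfolding M_def it[OF Ord_omega] by blast
    then show ?thesis using it[OF Ord_succ[OF Ok]] succ_omega by (metis mem_succ)
  qed
  have mono: "z \<^bold>\<in> F l" if "z \<^bold>\<in> F k" "k \<^bold>\<in> l" "l \<^bold>\<in> omega" for z k l
    using that it[OF Ok[OF that(3)], of z] it[of k z] Ord_mem[OF Ok[OF that(3)] that(2)]
      Ord_trans[OF Ok[OF that(3)] _ that(2)] by blast
  have "\<exists>\<xi>. Ord \<xi> \<and> z \<^bold>\<in> VV \<xi> \<and> subs (VV \<xi>) M" if z: "z \<^bold>\<in> M" for z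
  proof -
    obtain k where k: "k \<^bold>\<in> omega" "z \<^bold>\<in> F k" using inF[OF z] by blast
    obtain \<xi> where x: "?l (F k) \<xi>" "H (F k) = VV \<xi>" using H by blast
    then have "z \<^bold>\<in> VV \<xi>" using VV_trans k(2) by blast
    then show ?thesis using x HM[OF k(1)] by auto
  qed
  then have "Ord (ords M) \<and> M = VV (ords M)" by (rule VV_union)
  then have o: "Ord (ords M)" and M: "M = VV (ords M)" by auto
  have B: "z \<^bold>\<in> M" if "z \<^bold>\<in> VV \<gamma>0" for z unfolding M_def it[OF Ord_omega] using that by blast
  have om: "omega \<^bold>\<in> ords M" using B[OF g(3)] by (simp add: mem_ords)
  have "succ \<beta> \<^bold>\<in> ords M" if b: "\<beta> \<^bold>\<in> ords M" for \<beta>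
  proof -
    obtain k where k: "k \<^bold>\<in> omega" "\<beta> \<^bold>\<in> F k" using inF b mem_ords by blast
    obtain \<xi> where x: "?l (F k) \<xi>" "H (F k) = VV \<xi>" using H by blast
    then have "F k \<^bold>\<in> VV \<xi>" "Ord \<xi>" by auto
    then obtain \<gamma> where c: "\<gamma> \<^bold>\<in> \<xi>" "subs (F k) (VV \<gamma>)" using mem_VV by blast
    have oc: "Ord \<gamma>" "Ord \<beta>" using c \<open>Ord \<xi>\<close> Ord_mem b mem_ords by blast+
    then have "\<beta> \<^bold>\<in> \<gamma>" using c(2) k(2) Ord_mem_VV unfolding subs_def by blast
    moreover have "\<gamma> \<^bold>\<in> ords M"
      using subs_VV[OF \<open>Ord \<xi>\<close>] c(1) HM[OF k(1)] x(2) oc unfolding mem_ords subs_def by auto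
    moreover have "succ \<beta> \<^bold>\<in> \<gamma> \<or> succ \<beta> = \<gamma>"
      using Ord_linear[OF Ord_succ[OF oc(2)] oc(1)] \<open>\<beta> \<^bold>\<in> \<gamma>\<close> mem_asym by auto
    ultimately show ?thesis using Ord_trans[OF o] by blast
  qed
  then have "limM M" unfolding limM_def Lim_def using o M om Ord_trans[OF o zero_omega om] by blast
  moreover have "reflecting n M"
    unfolding reflecting_def
  proof (intro allI impI)
    fix N p s assume *: "Q n N \<and> p \<^bold>\<in> M \<and> s \<^bold>\<in> M \<and> SatR N p s"
    obtain k l where k: "k \<^bold>\<in> omega" "p \<^bold>\<in> F k" and l: "l \<^bold>\<in> omega" "s \<^bold>\<in> F l" using inF * by blast
    obtain m where m: "m \<^bold>\<in> omega" "p \<^bold>\<in> F m" "s \<^bold>\<in> F m"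
      using k l mono Ord_linear[OF Ok[OF k(1)] Ok[OF l(1)]] by blast
    obtain \<xi> where x: "?l (F m) \<xi>" "H (F m) = VV \<xi>" using H by blast
    then obtain N' where "N' \<^bold>\<in> VV \<xi>" "Q n N'" "SatR N' p s" using m * by blast
    then show "\<exists>N'. N' \<^bold>\<in> M \<and> Q n N' \<and> SatR N' p s"
      using HM[OF m(1)] x(2) unfolding subs_def by auto
  qed
  ultimately show ?thesis using B[OF g(2)] by blast
qed

text \<open>Both halves are needed at once: definability of level n makes closure points exist at
  level n+1, and unboundedness of level n identifies these with the correct sets.\<close>

lemma Q_main: "inK (Dl (Suc n)) (\<lambda>e. Q n (e 0)) \<and> (\<forall>x. \<exists>N. Q n N \<and> x \<^bold>\<in> N)"
proof (induction n)
  case 0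
  have "\<exists>N. Q 0 N \<and> x \<^bold>\<in> N" for x
    using ex_VV[of x] transitive_VV by (auto simp: Q_def corr_0)
  then show ?case using Q_0_K by blast
next
  case (Suc n)
  then have K: "inK (Dl (Suc n)) (\<lambda>e. Q n (e 0))" and u: "\<And>x. \<exists>N. Q n N \<and> x \<^bold>\<in> N" by blast+
  note q = Q_Suc_reflecting[OF K u]
  have "inK (Dl (Suc (Suc n))) (\<lambda>e. limM (e 0) \<and> reflecting n (e 0))"
    by (intro K_conj good_Dl K_limM Dl_Suc disjI2 Pg_reflecting K)
  moreover have "\<exists>M. Q (Suc n) M \<and> x \<^bold>\<in> M" for x
    unfolding q using ex_reflecting[OF Dl_Df[OF K]] by blast
  ultimately show ?case unfolding q by blast
qed

lemma K_Q: "inK (Dl (Suc n)) (\<lambda>e. Q n (e 0))" and Q_unbounded: "\<exists>N. Q n N \<and> x \<^bold>\<in> N"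
  using Q_main by blast+

text \<open>The Pi form is what passes down to a set with one degree of correctness less. It is
  stated from level 2 on, where the Delta_2 condition \<open>limM\<close> can be
  accommodated.\<close>

lemma Pg_Q: "inK (Pg (Suc (Suc n))) (\<lambda>e. Q (Suc (Suc n)) (e 0))"
  unfolding Q_Suc_reflecting[OF K_Q Q_unbounded]
  by (intro C_conj closed_Pg closed_Sg Dl_Pg[OF K_limM] Pg_reflecting K_Q)

lemma C_unbounded: "\<exists>\<alpha>. C (Suc n) \<alpha> \<and> x \<^bold>\<in> VV \<alpha>"
  using Q_unbounded[of "Suc n" x] unfolding C_corr Q_Suc by blast

end

section \<open>Elementary embeddings\<close>

context zfc
begin

section \<open>Elementarity expressed by satisfaction of codes\<close>

definition cmp :: "'a \<Rightarrow> 'a \<Rightarrow> 'a" where "cmp j s = lam omega (\<lambda>k. ap j (ap s k))"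

lemma cmp_fun: "is_fun (cmp j s) omega" "k \<^bold>\<in> omega \<Longrightarrow> ap (cmp j s) k = ap j (ap s k)"
proof -
  have F: "Fn Df (\<lambda>e. ap j (ap s (e 0)))" by (intro defn)
  show f: "is_fun (cmp j s) omega" unfolding cmp_def by (rule lam_fun[OF F])
  show "k \<^bold>\<in> omega \<Longrightarrow> ap (cmp j s) k = ap j (ap s k)"
    unfolding app_ap[OF f, symmetric] unfolding cmp_def by (rule lam_fun[OF F])
qed

lemma comp_cmp: assumes "maps s omega A" "is_fun j A" shows "comp j s = cmp j s"
  unfolding comp_def
proof (rule the_set_eq)
  have *: "app (cmp j s) k = app j (app s k)" if "k \<^bold>\<in> omega" for k
    using cmp_fun[where j = j and s = s] app_ap[of s omega k] app_ap[of "cmp j s" omega k]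
      app_ap[OF assms(2), of "ap s k"] assms that
    unfolding maps_ap by simp
  show "z \<^bold>\<in> cmp j s \<longleftrightarrow> (\<exists>k. k \<^bold>\<in> omega \<and> z = opair k (app j (app s k)))" for z
    unfolding mem_fun[OF cmp_fun(1)] using * by (simp cong: conj_cong)
qed

lemma maps_cmp: "maps j A B \<Longrightarrow> maps s omega A \<Longrightarrow> maps (cmp j s) omega B"
  unfolding maps_ap using cmp_fun[where j = j and s = s] by simp

lemma Fn_cmp [defn]: assumes G [defn]: "good K" and "Fn K t" "Fn K u" shows "Fn K (\<lambda>e. cmp (t e) (u e))"
proof (rule Fn_app2[OF G _ assms(2,3)])
  have "w = cmp j s \<longleftrightarrow> is_fun w omega \<and> (\<forall>k. k \<^bold>\<in> omega \<longrightarrow> ap w k = ap j (ap s k))" for w j s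
    using cmp_fun[where j = j and s = s] fun_ext_ap[of w omega "cmp j s"] by auto
  then show "Fn K (\<lambda>e. cmp (e 0) (e 1))" unfolding Fn_def by (simp only:) (intro defn)
qed

lemma elem_emb_SatR: "elem_emb j A B \<longleftrightarrow> maps j A B \<and>
    (\<forall>s. maps s omega A \<longrightarrow> (\<forall>p. p \<^bold>\<in> Codes \<longrightarrow> (SatR A p s \<longleftrightarrow> SatR B p (cmp j s))))"
proof (cases "maps j A B")
  case True
  have "models A p s \<longleftrightarrow> SatR A p s" "models B p (comp j s) \<longleftrightarrow> SatR B p (cmp j s)"
    if "p \<^bold>\<in> Codes" "maps s omega A" for p s
    using that maps_cmp[OF True that(2)] comp_cmp[OF that(2)] True unfolding SatR_def maps_def by simp_all
  with True show ?thesis unfolding elem_emb_def mem_Codes[symmetric] by blast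
qed (simp add: elem_emb_def)

lemma Pg_elem_emb: "inK (Pg (Suc n)) (\<lambda>e. elem_emb (e i) (e j) (e k))"
  unfolding elem_emb_SatR by (intro C_conj closed_Pg closed_Sg Pg_all Dl_Pg; intro defn)

lemma K_elem_emb [defn]:
  assumes "Fn (Dl (Suc (Suc n))) t" "Fn (Dl (Suc (Suc n))) u" "Fn (Dl (Suc (Suc n))) v"
  shows "inK (Dl (Suc (Suc n))) (\<lambda>e. elem_emb (t e) (u e) (v e))"
  by (rule K_app3[OF good_Dl _ assms], rule Dl_Suc, rule disjI2, rule Pg_elem_emb)

definition crit :: "'a \<Rightarrow> 'a \<Rightarrow> 'a \<Rightarrow> bool" where
  "crit j A \<kappa> \<longleftrightarrow> Ord \<kappa> \<and> \<kappa> \<^bold>\<in> A \<and> \<not> ap j \<kappa> = \<kappa> \<and> (\<forall>\<beta>. \<beta> \<^bold>\<in> \<kappa> \<longrightarrow> ap j \<beta> = \<beta>)"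

lemma K_crit [defn]: assumes G [defn]: "good K" and "Fn K t" "Fn K u" "Fn K v"
  shows "inK K (\<lambda>e. crit (t e) (u e) (v e))"
  by (rule K_app3[OF G _ assms(2-4)]; unfold crit_def; intro defn)

lemma critical_point_crit:
  assumes "maps j A B" "transitive A" shows "critical_point j A \<kappa> \<longleftrightarrow> crit j A \<kappa>"
proof -
  have *: "app j x = ap j x" if "x \<^bold>\<in> A" for x using app_ap[of j A x] assms(1) that by (simp add: maps_def)
  have t: "\<beta> \<^bold>\<in> A" if "\<beta> \<^bold>\<in> \<kappa>" "\<kappa> \<^bold>\<in> A" for \<beta> using assms(2) that unfolding transitive_def by blast
  show ?thesis
  proof (cases "\<kappa> \<^bold>\<in> A")
    case True
    then have "(\<forall>\<beta>. \<beta> \<^bold>\<in> \<kappa> \<longrightarrow> app j \<beta> = \<beta>) \<longleftrightarrow> (\<forall>\<beta>. \<beta> \<^bold>\<in> \<kappa> \<longrightarrow> ap j \<beta> = \<beta>)"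
      using * t by simp
    then show ?thesis unfolding critical_point_def crit_def using *[OF True] by simp
  qed (simp add: critical_point_def crit_def)
qed

lemma emb_maps: "elem_emb j A B \<Longrightarrow> x \<^bold>\<in> A \<Longrightarrow> ap j x \<^bold>\<in> B"
  by (simp add: elem_emb_def maps_ap)

text \<open>An assignment of the model matches \<open>e\<close> on the finitely many variables of
  \<open>p\<close>, and elementarity is applied to the code of \<open>p\<close>.\<close>

lemma emb_sat:
  assumes j: "elem_emb j A B" and e: "\<And>i. e i \<^bold>\<in> A"
  shows "sat {x. x \<^bold>\<in> A} e p \<longleftrightarrow> sat {x. x \<^bold>\<in> B} (\<lambda>i. ap j (e i)) p"
proof -
  obtain k where k: "\<forall>i\<in>vars p. i < k" using vars_bound by metis
  obtain s where s: "maps s omega A" "\<forall>i<k. ap s (num i) = e i" using ex_assignment[where e = e and A = A and k = k, OF e] by blast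
  have m: "maps j A B" using j by (simp add: elem_emb_def)
  have "sat {x. x \<^bold>\<in> A} e p \<longleftrightarrow> sat {x. x \<^bold>\<in> A} (\<lambda>i. ap s (num i)) p"
    using k s(2) by (intro sat_cong) auto
  also have "\<dots> \<longleftrightarrow> SatR A (code p) s" using SatR_sat[OF s(1)] by simp
  also have "\<dots> \<longleftrightarrow> SatR B (code p) (cmp j s)" using j s(1) unfolding elem_emb_SatR by simp
  also have "\<dots> \<longleftrightarrow> sat {x. x \<^bold>\<in> B} (\<lambda>i. ap (cmp j s) (num i)) p" using SatR_sat[OF maps_cmp[OF m s(1)]] by simp
  also have "\<dots> \<longleftrightarrow> sat {x. x \<^bold>\<in> B} (\<lambda>i. ap j (e i)) p"
    using k s(2) cmp_fun(2)[OF num_omega] by (intro sat_cong) auto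
  finally show ?thesis .
qed

text \<open>What holds in A of every element holds in B of every element, including those outside
  the range of \<open>j\<close>.\<close>

lemma emb_all:
  assumes j: "elem_emb j A B" and e: "\<And>i. e i \<^bold>\<in> A"
    and all: "\<And>x. x \<^bold>\<in> A \<Longrightarrow> sat {x. x \<^bold>\<in> A} (case_nat x e) p" and y: "y \<^bold>\<in> B"
  shows "sat {x. x \<^bold>\<in> B} (case_nat y (\<lambda>i. ap j (e i))) p"
proof -
  obtain k where k: "\<forall>i\<in>vars (Neg p). i < k" using vars_bound by metis
  have "\<not> sat {x. x \<^bold>\<in> A} e (Ex k (ren (Neg p) (case_nat k id)))"
    unfolding sat_Ex_ren[OF k] using all by simp
  then have "\<not> sat {x. x \<^bold>\<in> B} (\<lambda>i. ap j (e i)) (Ex k (ren (Neg p) (case_nat k id)))"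
    using emb_sat[where e = e, OF j e] by blast
  then show ?thesis unfolding sat_Ex_ren[OF k] using y by simp
qed

text \<open>The target needs one degree of correctness less than the source, because a Sigma_(n+1)
  formula goes up from a Sigma_n-correct set.\<close>

lemma emb_Sg:
  assumes j: "elem_emb j A B" and A: "corr (Suc n) A" and B: "corr n B"
    and P: "inK (Sg (Suc n)) P" and e: "\<And>i. e i \<^bold>\<in> A" and "P e"
  shows "P (\<lambda>i. ap j (e i))"
proof -
  obtain p where p: "Sigma_fm (Suc n) p" "\<And>e. sat UNIV e p \<longleftrightarrow> P e" using Sg_formula[OF P] by blast
  have "sat {x. x \<^bold>\<in> A} e p" using A p e \<open>P e\<close> unfolding corr_def agree_def by blast
  then have "sat {x. x \<^bold>\<in> B} (\<lambda>i. ap j (e i)) p" using emb_sat[where e = e, OF j e] by blast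
  moreover have "agree n {x. x \<^bold>\<in> B} UNIV" using B by (simp add: corr_def)
  moreover have "ap j (e i) \<in> {x. x \<^bold>\<in> B}" for i using emb_maps[OF j e] by simp
  ultimately have "sat UNIV (\<lambda>i. ap j (e i)) p"
    using agree_up[where s = "\<lambda>i. ap j (e i)", OF _ p(1)] by blast
  then show ?thesis using p(2) by blast
qed

lemma emb_Dl:
  assumes "elem_emb j A B" "corr (Suc n) A" "corr n B" "inK (Dl (Suc n)) P" "\<And>i. e i \<^bold>\<in> A"
  shows "P e \<longleftrightarrow> P (\<lambda>i. ap j (e i))"
  using emb_Sg[of j A B n P e] emb_Sg[of j A B n "\<lambda>e. \<not> P e" e] assms unfolding Dl_iff Pg_neg by blast

lemma emb_Fn:
  assumes "elem_emb j A B" "corr (Suc n) A" "corr n B" and t: "Fn (Dl (Suc n)) t"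
    and e: "\<And>i. e i \<^bold>\<in> A" and te: "t e \<^bold>\<in> A"
  shows "ap j (t e) = t (\<lambda>i. ap j (e i))"
proof -
  have "case_nat (t e) e i \<^bold>\<in> A" for i using e te by (cases i) auto
  from emb_Sg[where e = "case_nat (t e) e", OF assms(1-3) Dl_Sg[OF t[unfolded Fn_def]] this] show ?thesis by simp
qed

lemma Lim_fun: "Lim \<theta> \<Longrightarrow> A \<^bold>\<in> VV \<theta> \<Longrightarrow> B \<^bold>\<in> VV \<theta> \<Longrightarrow> maps f A B \<Longrightarrow> f \<^bold>\<in> VV \<theta>"
proof -
  assume L: "Lim \<theta>" and A: "A \<^bold>\<in> VV \<theta>" "B \<^bold>\<in> VV \<theta>" and f: "maps f A B"
  obtain \<beta> where b: "\<beta> \<^bold>\<in> \<theta>" "A \<^bold>\<in> VV \<beta>" "B \<^bold>\<in> VV \<beta>" using Lim_VV2[OF L A] by blast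
  have o: "Ord \<theta>" "Ord \<beta>" using L b(1) Lim_Ord Ord_mem by blast+
  then have "subs A (VV \<beta>)" "subs B (VV \<beta>)" using b VV_trans unfolding subs_def by blast+
  then have "f \<^bold>\<in> VV (succ (succ (succ \<beta>)))" using fun_VV o f by blast
  then show ?thesis using VV_mono[OF o(1)] Lim_succ[OF L] b(1) by blast
qed

end

text \<open>Only \<open>V\<^sub>\<mu>\<close> is assumed to be \<open>\<Sigma>\<^sub>1\<close>-correct. The target need not be, as for an extendibility embedding;
  \<open>\<Sigma>\<^sub>1\<close> facts are still transferred, since they go up from the target to \<open>V\<close>.\<close>

locale emb = zfc +
  fixes j \<mu> \<theta>
  assumes emb: "elem_emb j (VV \<mu>) (VV \<theta>)" and source: "C 1 \<mu>" and target: "Ord \<theta>"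
begin

lemma corr_source: "corr (Suc 0) (VV \<mu>)" "Ord \<mu>"
  using source unfolding C_corr by simp_all

lemma Lim_source: "Lim \<mu>" "omega \<^bold>\<in> \<mu>"
proof -
  have "limM (VV \<mu>)" using corr_limM[OF corr_source(1)] corr_source(2) by blast
  then show "Lim \<mu>" "omega \<^bold>\<in> \<mu>" unfolding limM_VV using VV_inject[OF corr_source(2)] Lim_Ord by blast+
qed

lemma corr_target: "corr 0 (VV \<theta>)"
proof -
  have "omega \<^bold>\<in> VV \<mu>" using Lim_source corr_source Ord_mem_VV by simp
  then show ?thesis using emb_maps[OF emb] transitive_VV[OF target] unfolding corr_0 by blast
qed

lemma j_maps: "x \<^bold>\<in> VV \<mu> \<Longrightarrow> ap j x \<^bold>\<in> VV \<theta>"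
  by (rule emb_maps[OF emb])

lemmas Dl_transfer = emb_Dl[OF emb corr_source(1) corr_target]
lemmas Fn_transfer = emb_Fn[OF emb corr_source(1) corr_target]

lemma j_mem: assumes "x \<^bold>\<in> VV \<mu>" "y \<^bold>\<in> VV \<mu>" shows "ap j x \<^bold>\<in> ap j y \<longleftrightarrow> x \<^bold>\<in> y"
proof -
  have "inK (Dl (Suc 0)) (\<lambda>e. e 0 \<^bold>\<in> e 1)" by (intro defn)
  moreover have "case_nat x (\<lambda>_. y) i \<^bold>\<in> VV \<mu>" for i using assms by (cases i) auto
  ultimately show ?thesis using Dl_transfer[of "\<lambda>e. e 0 \<^bold>\<in> e 1" "case_nat x (\<lambda>_. y)"] by simp
qed

lemma j_Ord: assumes "x \<^bold>\<in> VV \<mu>" shows "Ord (ap j x) \<longleftrightarrow> Ord x"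
proof -
  have "inK (Dl (Suc 0)) (\<lambda>e. Ord (e 0))" by (intro defn)
  then show ?thesis using Dl_transfer[of "\<lambda>e. Ord (e 0)" "\<lambda>_. x"] assms by simp
qed

lemma j_subs: assumes "x \<^bold>\<in> VV \<mu>" "y \<^bold>\<in> VV \<mu>" shows "subs x y \<longleftrightarrow> subs (ap j x) (ap j y)"
proof -
  have "inK (Dl (Suc 0)) (\<lambda>e. subs (e 0) (e 1))" by (intro defn)
  moreover have "case_nat x (\<lambda>_. y) i \<^bold>\<in> VV \<mu>" for i using assms by (cases i) auto
  ultimately show ?thesis using Dl_transfer[of "\<lambda>e. subs (e 0) (e 1)" "case_nat x (\<lambda>_. y)"] by simp
qed

lemma j_ap: assumes "f \<^bold>\<in> VV \<mu>" "x \<^bold>\<in> VV \<mu>" "ap f x \<^bold>\<in> VV \<mu>" shows "ap j (ap f x) = ap (ap j f) (ap j x)"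
proof -
  have "Fn (Dl (Suc 0)) (\<lambda>e. ap (e 0) (e 1))" by (intro defn)
  moreover have "case_nat f (\<lambda>_. x) i \<^bold>\<in> VV \<mu>" for i using assms by (cases i) auto
  ultimately show ?thesis using Fn_transfer[of "\<lambda>e. ap (e 0) (e 1)" "case_nat f (\<lambda>_. x)"] assms by simp
qed

lemma omega_source: "omega \<^bold>\<in> VV \<mu>"
  using Lim_source corr_source Ord_mem_VV by simp

lemma mem_source: "x \<^bold>\<in> y \<Longrightarrow> y \<^bold>\<in> VV \<mu> \<Longrightarrow> x \<^bold>\<in> VV \<mu>"
  using VV_trans corr_source by blast

lemma j_const: assumes "\<And>K. good K \<Longrightarrow> Fn K (\<lambda>e. a)" "a \<^bold>\<in> VV \<mu>" shows "ap j a = a"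
  using Fn_transfer[of "\<lambda>_. a" "\<lambda>_. a"] assms good_Dl by blast

lemma j_app1: assumes "\<And>K. good K \<Longrightarrow> Fn K (\<lambda>e. F (e 0))" "x \<^bold>\<in> VV \<mu>" "F x \<^bold>\<in> VV \<mu>"
  shows "ap j (F x) = F (ap j x)"
  using Fn_transfer[of "\<lambda>e. F (e 0)" "\<lambda>_. x"] assms good_Dl by blast

lemma j_app2: assumes "\<And>K. good K \<Longrightarrow> Fn K (\<lambda>e. F (e 0) (e 1))" "x \<^bold>\<in> VV \<mu>" "y \<^bold>\<in> VV \<mu>" "F x y \<^bold>\<in> VV \<mu>"
  shows "ap j (F x y) = F (ap j x) (ap j y)"
proof -
  have "case_nat x (\<lambda>_. y) i \<^bold>\<in> VV \<mu>" for i using assms by (cases i) auto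
  then show ?thesis using Fn_transfer[OF assms(1)[OF good_Dl], of "case_nat x (\<lambda>_. y)"] assms by simp
qed

lemma j_zero: "ap j zero = zero"
  by (rule j_const) (auto intro: defn mem_source[OF zero_omega omega_source])

lemma j_omega: "ap j omega = omega"
  by (rule j_const) (auto intro: defn omega_source)

lemma j_num: assumes "k \<^bold>\<in> omega" shows "ap j k = k"
proof (rule omega_induct[OF _ assms])
  show "inK Df (\<lambda>e. ap j (e 0) = e 0)" by (intro defn)
  show "ap j zero = zero" by (rule j_zero)
  show "ap j (succ k) = succ k" if "k \<^bold>\<in> omega" "ap j k = k" for k
    using j_app1[of succ k] that mem_source[OF _ omega_source] succ_omega Fn_succ Fn_var by auto
qed

lemma Codes_source: "p \<^bold>\<in> Codes \<Longrightarrow> p \<^bold>\<in> VV \<mu>"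
  using VV_mono[OF corr_source(2) Lim_source(2)] fm_closed_VV_omega unfolding mem_Codes is_code_def by blast

text \<open>The property of being fixed by \<open>j\<close> is definable because \<open>j\<close> is
  a set of the model, so induction on codes reaches nonstandard codes too.\<close>

lemma j_code: assumes "p \<^bold>\<in> Codes" shows "ap j p = p"
proof (rule Codes_induct[OF _ assms])
  show "inK Df (\<lambda>e. ap j (e 0) = e 0)" by (intro defn)
  have o: "i \<^bold>\<in> VV \<mu>" if "i \<^bold>\<in> omega" for i using mem_source[OF that omega_source] .
  have c: "Fn K (\<lambda>e. cMem (e 0) (e 1))" "Fn K (\<lambda>e. cEq (e 0) (e 1))" "Fn K (\<lambda>e. cAnd (e 0) (e 1))"
    "Fn K (\<lambda>e. cEx (e 0) (e 1))" "Fn K (\<lambda>e. cNeg (e 0))" if [defn]: "good K" for K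
    by (intro defn)+
  show "ap j (cMem i k) = cMem i k" if "i \<^bold>\<in> omega" "k \<^bold>\<in> omega" for i k
    using j_app2[OF c(1) o[OF that(1)] o[OF that(2)]] Codes_source Codes_intros j_num that by simp
  show "ap j (cEq i k) = cEq i k" if "i \<^bold>\<in> omega" "k \<^bold>\<in> omega" for i k
    using j_app2[OF c(2) o[OF that(1)] o[OF that(2)]] Codes_source Codes_intros j_num that by simp
  show "ap j (cNeg p) = cNeg p" if "p \<^bold>\<in> Codes" "ap j p = p" for p
    using j_app1[OF c(5) Codes_source[OF that(1)]] Codes_source Codes_intros that by simp
  show "ap j (cAnd p q) = cAnd p q" if "p \<^bold>\<in> Codes" "q \<^bold>\<in> Codes" "ap j p = p" "ap j q = q" for p q
    using j_app2[OF c(3) Codes_source[OF that(1)] Codes_source[OF that(2)]] Codes_source Codes_intros that by simp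
  show "ap j (cEx i p) = cEx i p" if "i \<^bold>\<in> omega" "p \<^bold>\<in> Codes" "ap j p = p" for i p
    using j_app2[OF c(4) o[OF that(1)] Codes_source[OF that(2)]] Codes_source Codes_intros j_num that by simp
qed

lemma j_assignment:
  assumes s: "s \<^bold>\<in> VV \<mu>" "is_fun s omega" shows "ap j s = cmp j s"
proof -
  have "inK (Dl (Suc 0)) (\<lambda>e. is_fun (e 0) (e 1))" by (intro defn)
  moreover have "case_nat s (\<lambda>_. omega) i \<^bold>\<in> VV \<mu>" for i using s omega_source by (cases i) auto
  ultimately have f: "is_fun (ap j s) omega"
    using Dl_transfer[of "\<lambda>e. is_fun (e 0) (e 1)" "case_nat s (\<lambda>_. omega)"] s(2) j_omega by simp
  show ?thesis
  proof (rule fun_ext_ap[OF f cmp_fun(1)])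
    fix k assume k: "k \<^bold>\<in> omega"
    have "ap s k \<^bold>\<in> VV \<mu>" using assignment_mem[OF transitive_VV] corr_source s k by blast
    then have "ap j (ap s k) = ap (ap j s) (ap j k)" using j_ap s(1) mem_source[OF k omega_source] by blast
    then show "ap (ap j s) k = ap (cmp j s) k" using cmp_fun(2)[OF k] j_num[OF k] by simp
  qed
qed

lemma j_SatR:
  assumes "A \<^bold>\<in> VV \<mu>" "p \<^bold>\<in> Codes" "maps s omega A" shows "SatR A p s \<longleftrightarrow> SatR (ap j A) p (cmp j s)"
proof -
  have s: "s \<^bold>\<in> VV \<mu>" using Lim_fun[OF Lim_source(1) omega_source assms(1,3)] .
  let ?e = "case_nat A (case_nat p (\<lambda>_. s))"
  have "?e i \<^bold>\<in> VV \<mu>" for i using assms Codes_source s by (auto split: nat.split)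
  moreover have "inK (Dl (Suc 0)) (\<lambda>e. SatR (e 0) (e 1) (e 2))" by (intro defn)
  moreover have "ap j s = cmp j s" using j_assignment[OF s] assms(3) by (simp add: maps_def)
  ultimately show ?thesis
    using Dl_transfer[of "\<lambda>e. SatR (e 0) (e 1) (e 2)" ?e] j_code[OF assms(2)] by (simp add: numeral_2_eq_2)
qed

text \<open>For a set \<open>A\<close> in the source, satisfaction in \<open>A\<close> is Delta_1
  and is therefore carried to satisfaction in \<open>j A\<close>. This is elementarity of the
  restriction of \<open>j\<close> to \<open>A\<close>.\<close>

lemma restriction:
  assumes A: "A \<^bold>\<in> VV \<mu>"
  obtains i where "elem_emb i A (ap j A)" "\<And>x. x \<^bold>\<in> A \<Longrightarrow> ap i x = ap j x"
proof -
  have F: "Fn Df (\<lambda>e. ap j (e 0))" by (intro defn)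
  define i where "i = lam A (ap j)"
  have f: "is_fun i A" unfolding i_def by (rule lam_fun[OF F])
  have i: "ap i x = ap j x" if "x \<^bold>\<in> A" for x
    using lam_fun(2)[OF F that] app_ap[OF f that] by (simp add: i_def)
  have "maps i A (ap j A)" unfolding maps_ap using f i j_mem A mem_source[OF _ A] by simp
  moreover have "cmp i s = cmp j s" if "maps s omega A" for s
    using that i unfolding maps_ap by (intro fun_ext_ap[OF cmp_fun(1) cmp_fun(1)]) (simp add: cmp_fun)
  ultimately have "elem_emb i A (ap j A)" unfolding elem_emb_SatR using j_SatR[OF A] by simp
  with i show ?thesis using that by blast
qed

text \<open>The graph of \<open>VV\<close> is Pi_1 and cannot be carried up from a target that is
  merely transitive. Membership in V_\<xi> and its failure are both Sigma_1, however. That each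
  follows from the corresponding fact about the set \<open>VV \<xi>\<close> is a universal statement
  true in V_\<mu>, hence in V_\<theta>, whose Sigma_1 conclusions go up.\<close>

lemma j_VV: assumes l: "\<xi> \<^bold>\<in> \<mu>" shows "ap j (VV \<xi>) = VV (ap j \<xi>)"
proof -
  have o: "Ord \<xi>" using l corr_source Ord_mem by blast
  have lm: "\<xi> \<^bold>\<in> VV \<mu>" using o l corr_source Ord_mem_VV by blast
  have Vm: "VV \<xi> \<^bold>\<in> VV \<mu>" using VV_mem l corr_source by blast
  have ol: "Ord (ap j \<xi>)" using j_Ord[OF lm] o by blast
  have jl: "ap j \<xi> \<^bold>\<in> \<theta>" using j_maps[OF lm] ol target Ord_mem_VV by blast
  have inVV: "inK (Sg (Suc 0)) (\<lambda>e. inVV (e 0) (e 2))" "inK (Sg (Suc 0)) (\<lambda>e. \<not> inVV (e 0) (e 2))"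
    by (intro Dl_Sg; intro defn)+
  from Sg_formula[OF inVV(1)] Sg_formula[OF inVV(2)] obtain p q where
    p: "Sigma_fm (Suc 0) p" "\<And>e. sat UNIV e p \<longleftrightarrow> inVV (e 0) (e 2)"
    and q: "Sigma_fm (Suc 0) q" "\<And>e. sat UNIV e q \<longleftrightarrow> \<not> inVV (e 0) (e 2)"
    by blast
  let ?e = "case_nat (VV \<xi>) (\<lambda>_. \<xi>)"
  have e: "?e i \<^bold>\<in> VV \<mu>" for i using lm Vm by (cases i) auto
  have e': "case_nat x ?e i \<^bold>\<in> VV \<mu>" if "x \<^bold>\<in> VV \<mu>" for x i using that e by (cases i) auto
  let ?A = "{x. x \<^bold>\<in> VV \<mu>}" and ?B = "{x. x \<^bold>\<in> VV \<theta>}"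
  have je: "(\<lambda>i. ap j (?e i)) = case_nat (ap j (VV \<xi>)) (\<lambda>_. ap j \<xi>)"
    by (rule HOL.ext) (simp split: nat.split)
  have A: "sat ?A (case_nat x ?e) r \<longleftrightarrow> sat UNIV (case_nat x ?e) r"
    if "x \<^bold>\<in> VV \<mu>" "Sigma_fm (Suc 0) r" for x r
    using corr_source(1) e'[OF that(1)] that(2) unfolding corr_def agree_def by blast
  have B: "sat ?B (case_nat y (\<lambda>i. ap j (?e i))) r \<Longrightarrow> sat UNIV (case_nat y (\<lambda>i. ap j (?e i))) r"
    if "y \<^bold>\<in> VV \<theta>" "Sigma_fm (Suc 0) r" for y r
  proof (rule agree_up[OF _ that(2)])
    show "agree 0 ?B UNIV" using corr_target by (simp add: corr_def)
    show "case_nat y (\<lambda>i. ap j (?e i)) i \<in> ?B" for i using that(1) j_maps[OF e] by (simp split: nat.split)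
  qed
  have 1: "inVV y (ap j \<xi>)" if y: "y \<^bold>\<in> ap j (VV \<xi>)" "y \<^bold>\<in> VV \<theta>" for y
  proof -
    let ?r = "Neg (And (Mem 0 1) (Neg p))"
    have "sat ?A (case_nat x ?e) ?r" if "x \<^bold>\<in> VV \<mu>" for x
      using A[OF that p(1)] p(2)[of "case_nat x ?e"] by (simp add: inVV_def numeral_2_eq_2)
    from emb_all[where e = ?e, OF emb e this y(2)] have "sat ?B (case_nat y (\<lambda>i. ap j (?e i))) p"
      using y(1) by simp
    from B[OF y(2) p(1) this] show ?thesis
      using p(2)[of "case_nat y (\<lambda>i. ap j (?e i))"] by (simp add: numeral_2_eq_2)
  qed
  have 2: "\<not> inVV y (ap j \<xi>)" if y: "\<not> y \<^bold>\<in> ap j (VV \<xi>)" "y \<^bold>\<in> VV \<theta>" for y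
  proof -
    let ?r = "Neg (And (Neg (Mem 0 1)) (Neg q))"
    have "sat ?A (case_nat x ?e) ?r" if "x \<^bold>\<in> VV \<mu>" for x
      using A[OF that q(1)] q(2)[of "case_nat x ?e"] by (simp add: inVV_def numeral_2_eq_2)
    from emb_all[where e = ?e, OF emb e this y(2)] have "sat ?B (case_nat y (\<lambda>i. ap j (?e i))) q"
      using y(1) by simp
    from B[OF y(2) q(1) this] show ?thesis
      using q(2)[of "case_nat y (\<lambda>i. ap j (?e i))"] by (simp add: numeral_2_eq_2)
  qed
  show ?thesis
    by (rule ext) (metis 1 2 inVV_def VV_trans[OF target] VV_mono[OF target jl] j_maps[OF Vm])
qed

text \<open>V_\<mu> satisfies that everything is an element of something, so V_\<theta> does too and
  has no largest rank.\<close>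

lemma Lim_target: "Lim \<theta>" "omega \<^bold>\<in> \<theta>"
proof -
  have "omega \<^bold>\<in> VV \<theta>" using j_maps[OF omega_source] j_omega by simp
  then show om: "omega \<^bold>\<in> \<theta>" using Ord_mem_VV[OF target] by simp
  have "succ \<beta> \<^bold>\<in> \<theta>" if b: "\<beta> \<^bold>\<in> \<theta>" for \<beta>
  proof -
    have ob: "Ord \<beta>" "\<beta> \<^bold>\<in> VV \<theta>" using b target Ord_mem Ord_mem_VV by blast+
    have "sat {x. x \<^bold>\<in> VV \<mu>} (case_nat x (\<lambda>_. omega)) (Ex 1 (Mem 0 1))" if x: "x \<^bold>\<in> VV \<mu>" for x
    proof -
      obtain \<gamma> where "\<gamma> \<^bold>\<in> \<mu>" "x \<^bold>\<in> VV \<gamma>" using Lim_VV[OF Lim_source(1) x] by blast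
      then show ?thesis using VV_mem[OF corr_source(2)] by auto
    qed
    from emb_all[where e = "\<lambda>_. omega", OF emb omega_source this ob(2)] obtain y where y: "y \<^bold>\<in> VV \<theta>" "\<beta> \<^bold>\<in> y" by auto
    obtain \<gamma> where g: "\<gamma> \<^bold>\<in> \<theta>" "subs y (VV \<gamma>)" using y mem_VV[OF target] by blast
    have "Ord \<gamma>" using g target Ord_mem by blast
    then have "\<beta> \<^bold>\<in> \<gamma>" using g y ob Ord_mem_VV unfolding subs_def by blast
    then have "succ \<beta> \<^bold>\<in> \<gamma> \<or> succ \<beta> = \<gamma>"
      using Ord_linear[OF Ord_succ[OF ob(1)] \<open>Ord \<gamma>\<close>] mem_asym by auto
    then show ?thesis using g(1) Ord_trans[OF target] by blast
  qed
  then show "Lim \<theta>" unfolding Lim_def using target Ord_trans[OF target zero_omega om] by blast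
qed

text \<open>A Pi_1 property goes down to any transitive set. So V_\<theta> sees a witness, V_\<mu>
  has one by elementarity, and the latter is genuine since V_\<mu> is Sigma_1-correct.\<close>

lemma pull_back:
  assumes P: "inK (Pg (Suc 0)) (\<lambda>e. P (e 0) (\<lambda>i. e (Suc i)))" and e: "\<And>i. e i \<^bold>\<in> VV \<mu>"
    and y: "y \<^bold>\<in> VV \<theta>" "P y (\<lambda>i. ap j (e i))"
  shows "\<exists>x. x \<^bold>\<in> VV \<mu> \<and> P x e"
proof -
  obtain p where p: "Pi_fm (Suc 0) p" "\<And>e. sat UNIV e p \<longleftrightarrow> P (e 0) (\<lambda>i. e (Suc i))"
    using Pg_formula[OF P] by blast
  let ?A = "{x. x \<^bold>\<in> VV \<mu>}" and ?B = "{x. x \<^bold>\<in> VV \<theta>}"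
  have "sat ?B (case_nat y (\<lambda>i. ap j (e i))) p"
  proof (rule agree_down_Pi[OF _ p(1)])
    show "agree 0 ?B UNIV" using corr_target by (simp add: corr_def)
    show "case_nat y (\<lambda>i. ap j (e i)) i \<in> ?B" for i using y(1) j_maps[OF e] by (simp split: nat.split)
    show "sat UNIV (case_nat y (\<lambda>i. ap j (e i))) p" using p(2)[of "case_nat y (\<lambda>i. ap j (e i))"] y(2) by simp
  qed
  then have "\<not> (\<forall>x. x \<^bold>\<in> VV \<mu> \<longrightarrow> sat ?A (case_nat x e) (Neg p))"
    using emb_all[where e = e, OF emb e, of "Neg p" y] y(1) by auto
  then obtain x where x: "x \<^bold>\<in> VV \<mu>" "sat ?A (case_nat x e) p" by auto
  have "case_nat x e i \<in> ?A" for i using x(1) e by (simp split: nat.split)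
  moreover have "agree (Suc 0) ?A UNIV" using corr_source by (simp add: corr_def)
  ultimately have "sat UNIV (case_nat x e) p" using agree_Pi p(1) x(2) by blast
  then show ?thesis using p(2)[of "case_nat x e"] x(1) by auto
qed

text \<open>Induction on rank. If \<open>x\<close> is a subset of V_\<beta> with \<beta> below the
  critical point, so is \<open>j x\<close>, because \<open>j\<close> maps V_\<beta> to itself; the
  two have the same elements since elements of V_\<beta> are fixed.\<close>

lemma j_below_crit:
  assumes c: "crit j (VV \<mu>) \<delta>" and x: "x \<^bold>\<in> VV \<delta>" shows "ap j x = x"
proof -
  have d: "Ord \<delta>" "\<delta> \<^bold>\<in> VV \<mu>" and fix_ord: "\<And>\<beta>. \<beta> \<^bold>\<in> \<delta> \<Longrightarrow> ap j \<beta> = \<beta>" using c by (simp_all add: crit_def)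
  have dm: "\<delta> \<^bold>\<in> \<mu>" using d corr_source Ord_mem_VV by blast
  let ?P = "\<lambda>\<beta>. \<beta> \<^bold>\<in> \<delta> \<longrightarrow> (\<forall>x. subs x (VV \<beta>) \<longrightarrow> ap j x = x)"
  have P: "?P \<beta>" if "Ord \<beta>" for \<beta>
  proof (rule Ord_induct[where P = ?P, OF _ that])
    show "inK Df (\<lambda>e. ?P (e 0))" by (intro defn)
  next
    fix \<beta> assume o: "Ord \<beta>" and IH: "\<And>\<gamma>. \<gamma> \<^bold>\<in> \<beta> \<Longrightarrow> ?P \<gamma>"
    show "?P \<beta>"
    proof (intro impI allI)
      fix x assume b: "\<beta> \<^bold>\<in> \<delta>" and x: "subs x (VV \<beta>)"
      have bm: "\<beta> \<^bold>\<in> \<mu>" using b dm corr_source Ord_trans by blast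
      have Vm: "VV \<beta> \<^bold>\<in> VV \<mu>" using VV_mem bm corr_source by blast
      have xm: "x \<^bold>\<in> VV \<mu>" using VV_subs[OF corr_source(2) Vm x] .
      have fixV: "ap j y = y" if "y \<^bold>\<in> VV \<beta>" for y
        using that IH b Ord_trans[OF d(1)] unfolding mem_VV[OF o] by blast
      have "subs (ap j x) (VV \<beta>)" using j_subs[OF xm Vm] x j_VV[OF bm] fix_ord[OF b] by simp
      show "ap j x = x"
      proof (rule ext)
        fix z
        show "z \<^bold>\<in> ap j x \<longleftrightarrow> z \<^bold>\<in> x"
        proof (cases "z \<^bold>\<in> VV \<beta>")
          case True
          then show ?thesis using j_mem[OF mem_source[OF True Vm] xm] fixV by simp
        next
          case False
          then show ?thesis using x \<open>subs (ap j x) (VV \<beta>)\<close> unfolding subs_def by blast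
        qed
      qed
    qed
  qed
  obtain \<beta> where "\<beta> \<^bold>\<in> \<delta>" "subs x (VV \<beta>)" using x mem_VV[OF d(1)] by blast
  then show ?thesis using P Ord_mem[OF d(1)] by blast
qed

end

section \<open>Extendibility and supercompactness\<close>

context zfc
begin

lemma C_mono: "C n \<alpha> \<Longrightarrow> m \<le> n \<Longrightarrow> C m \<alpha>"
  unfolding C_corr using corr_mono by blast

lemma C_Ord: "C n \<alpha> \<Longrightarrow> Ord \<alpha>"
  by (simp add: C_corr)

lemma emb_app: "elem_emb j A B \<Longrightarrow> x \<^bold>\<in> A \<Longrightarrow> app j x = ap j x"
  unfolding elem_emb_def maps_def using app_ap[of j A x] by simp

lemma C_extendible_iff: "C_extendible n \<delta> \<longleftrightarrow> (\<forall>\<mu>. Ord \<mu> \<and> \<delta> \<^bold>\<in> \<mu> \<longrightarrow>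
   (\<exists>\<theta> j. Ord \<theta> \<and> elem_emb j (VV \<mu>) (VV \<theta>) \<and> crit j (VV \<mu>) \<delta> \<and> \<mu> \<^bold>\<in> ap j \<delta> \<and> C n (ap j \<delta>)))"
proof -
  have "(Ord \<theta> \<and> elem_emb j (Vset \<mu>) (Vset \<theta>) \<and> critical_point j (Vset \<mu>) \<delta> \<and> \<mu> \<^bold>\<in> app j \<delta> \<and> C n (app j \<delta>)) \<longleftrightarrow>
     (Ord \<theta> \<and> elem_emb j (VV \<mu>) (VV \<theta>) \<and> crit j (VV \<mu>) \<delta> \<and> \<mu> \<^bold>\<in> ap j \<delta> \<and> C n (ap j \<delta>))"
    if o: "Ord \<mu>" for \<mu> \<theta> j
  proof (cases "Ord \<theta> \<and> elem_emb j (VV \<mu>) (VV \<theta>)")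
    case True
    then have "critical_point j (VV \<mu>) \<delta> \<longleftrightarrow> crit j (VV \<mu>) \<delta>"
      using critical_point_crit transitive_VV[OF o] unfolding elem_emb_def by blast
    moreover have "crit j (VV \<mu>) \<delta> \<Longrightarrow> app j \<delta> = ap j \<delta>" using emb_app True by (auto simp: crit_def)
    ultimately show ?thesis using True Vset_VV o by auto
  qed (use Vset_VV o in auto)
  then show ?thesis unfolding C_extendible_def by blast
qed

lemma supercompact_at_iff:
  assumes o: "Ord \<theta>"
  shows "supercompact_at n \<theta> \<delta> \<longleftrightarrow> (\<forall>a. a \<^bold>\<in> VV \<theta> \<longrightarrow>
     (\<exists>\<delta>' \<theta>' a' j. Ord \<delta>' \<and> Ord \<theta>' \<and> \<delta>' \<^bold>\<in> \<theta>' \<and> \<theta>' \<^bold>\<in> \<delta> \<and> a' \<^bold>\<in> VV \<theta>' \<and>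
        elem_emb j (VV \<theta>') (VV \<theta>) \<and> crit j (VV \<theta>') \<delta>' \<and>
        ap j \<delta>' = \<delta> \<and> ap j a' = a \<and> C n \<theta>'))"
proof -
  have "(Ord \<delta>' \<and> Ord \<theta>' \<and> \<delta>' \<^bold>\<in> \<theta>' \<and> \<theta>' \<^bold>\<in> \<delta> \<and> a' \<^bold>\<in> Vset \<theta>' \<and>
        elem_emb j (Vset \<theta>') (Vset \<theta>) \<and> critical_point j (Vset \<theta>') \<delta>' \<and>
        app j \<delta>' = \<delta> \<and> app j a' = a \<and> C n \<theta>') \<longleftrightarrow>
     (Ord \<delta>' \<and> Ord \<theta>' \<and> \<delta>' \<^bold>\<in> \<theta>' \<and> \<theta>' \<^bold>\<in> \<delta> \<and> a' \<^bold>\<in> VV \<theta>' \<and>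
        elem_emb j (VV \<theta>') (VV \<theta>) \<and> crit j (VV \<theta>') \<delta>' \<and>
        ap j \<delta>' = \<delta> \<and> ap j a' = a \<and> C n \<theta>')" for \<delta>' \<theta>' a' j a
  proof (cases "Ord \<theta>' \<and> a' \<^bold>\<in> VV \<theta>' \<and> elem_emb j (VV \<theta>') (VV \<theta>)")
    case True
    then have "critical_point j (VV \<theta>') \<delta>' \<longleftrightarrow> crit j (VV \<theta>') \<delta>'"
      using critical_point_crit transitive_VV[of \<theta>'] unfolding elem_emb_def by blast
    moreover have "crit j (VV \<theta>') \<delta>' \<Longrightarrow> app j \<delta>' = ap j \<delta>'" "app j a' = ap j a'"
      using emb_app True by (auto simp: crit_def)
    ultimately show ?thesis using True Vset_VV[OF o] Vset_VV[of \<theta>'] by auto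
  qed (use Vset_VV[OF o] Vset_VV in auto)
  then show ?thesis unfolding supercompact_at_def Vset_VV[OF o] by blast
qed

section \<open>From extendibility to supercompactness\<close>

lemma extendible_emb:
  assumes "C_extendible (Suc m) \<delta>" "Ord \<delta>"
  shows "\<exists>\<mu> \<theta> j. C (Suc (Suc m)) \<mu> \<and> x \<^bold>\<in> VV \<mu> \<and> emb mem j \<mu> \<theta> \<and> crit j (VV \<mu>) \<delta> \<and>
     \<mu> \<^bold>\<in> ap j \<delta> \<and> C (Suc m) (ap j \<delta>)"
proof -
  \<comment> \<open>The pair brings both \<delta> and \<open>x\<close> into V_\<mu>.\<close>
  obtain \<mu> where m: "C (Suc (Suc m)) \<mu>" "opair \<delta> x \<^bold>\<in> VV \<mu>" using C_unbounded by blast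
  then have o: "Ord \<mu>" and t: "transitive (VV \<mu>)" using C_Ord transitive_VV by blast+
  have x: "\<delta> \<^bold>\<in> VV \<mu>" "x \<^bold>\<in> VV \<mu>" using opair_transitive[OF t m(2)] by blast+
  then have "\<delta> \<^bold>\<in> \<mu>" using assms(2) o Ord_mem_VV by blast
  with assms o obtain \<theta> j where j: "Ord \<theta>" "elem_emb j (VV \<mu>) (VV \<theta>)" "crit j (VV \<mu>) \<delta>"
    "\<mu> \<^bold>\<in> ap j \<delta>" "C (Suc m) (ap j \<delta>)"
    unfolding C_extendible_iff by blast
  moreover have "emb mem j \<mu> \<theta>"
    by unfold_locales (use j m C_mono[OF m(1), of 1] in simp_all)
  ultimately show ?thesis using m x by blast
qed

text \<open>By induction on the level. Given a true formula with witness \<open>c\<close>, an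
  embedding is chosen with \<open>c\<close> in V_\<mu>, hence in V_(j \<delta>), which is correct
  enough to satisfy the formula. The restriction of \<open>j\<close> to V_\<delta> fixes the
  parameters, so V_\<delta> satisfies it as well.\<close>

lemma extendible_corr:
  assumes ext: "C_extendible (Suc m) \<delta>" and o: "Ord \<delta>" shows "corr (Suc (Suc m)) (VV \<delta>)"
proof -
  have ne: "zero \<^bold>\<in> VV \<delta>"
  proof -
    obtain \<mu> \<theta> j where j: "emb mem j \<mu> \<theta>" "crit j (VV \<mu>) \<delta>" using extendible_emb[OF ext o] by blast
    have "\<delta> \<noteq> zero" using j(2) emb.j_zero[OF j(1)] by (auto simp: crit_def)
    then have "zero \<^bold>\<in> \<delta>" using Ord_linear[OF o Ord_zero] by auto
    then show ?thesis using Ord_mem_VV[OF o] by simp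
  qed
  have "k \<le> Suc (Suc m) \<Longrightarrow> corr k (VV \<delta>)" for k
  proof (induction k)
    case 0
    then show ?case using ne transitive_VV[OF o] by (auto simp: corr_0)
  next
    case (Suc k)
    then have IH: "agree k {x. x \<^bold>\<in> VV \<delta>} UNIV" by (simp add: corr_def)
    have "sat {x. x \<^bold>\<in> VV \<delta>} e p \<longleftrightarrow> sat UNIV e p"
      if p: "Sigma_fm (Suc k) p" and e: "\<forall>i. e i \<^bold>\<in> VV \<delta>" for p e
    proof
      show "sat {x. x \<^bold>\<in> VV \<delta>} e p \<Longrightarrow> sat UNIV e p" using agree_up[OF IH p] e by blast
      assume "sat UNIV e p"
      from reflection_witness[OF p this] obtain c where
        c: "\<forall>M. corr k M \<and> (\<forall>i. e i \<^bold>\<in> M) \<and> c \<^bold>\<in> M \<longrightarrow> sat {x. x \<^bold>\<in> M} e p" by blast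
      obtain \<mu> \<theta> j where m: "C (Suc (Suc m)) \<mu>" "c \<^bold>\<in> VV \<mu>" and j: "emb mem j \<mu> \<theta>" "crit j (VV \<mu>) \<delta>"
        "\<mu> \<^bold>\<in> ap j \<delta>" "C (Suc m) (ap j \<delta>)" using extendible_emb[OF ext o, of c] by blast
      interpret emb mem j \<mu> \<theta> by (rule j(1))
      have dm: "\<delta> \<^bold>\<in> \<mu>" using j(2) Ord_mem_VV[OF corr_source(2) o] by (simp add: crit_def)
      have oj: "Ord (ap j \<delta>)" using C_Ord j(4) .
      have Vm: "VV \<delta> \<^bold>\<in> VV \<mu>" using VV_mem[OF corr_source(2) dm] .
      obtain i where i: "elem_emb i (VV \<delta>) (ap j (VV \<delta>))" "\<And>x. x \<^bold>\<in> VV \<delta> \<Longrightarrow> ap i x = ap j x"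
        using restriction[OF Vm] by blast
      have ie: "(\<lambda>k. ap i (e k)) = e" using i(2) e j_below_crit[OF j(2)] by (intro HOL.ext) simp
      have "corr k (VV (ap j \<delta>))" using Suc.prems corr_mono j(4) unfolding C_corr by blast
      moreover have "e i \<^bold>\<in> VV (ap j \<delta>)" "c \<^bold>\<in> VV (ap j \<delta>)" for i
        using VV_mono[OF oj j(3)] VV_mono[OF corr_source(2) dm] e m(2) by blast+
      ultimately have "sat {x. x \<^bold>\<in> VV (ap j \<delta>)} e p" using c by blast
      then show "sat {x. x \<^bold>\<in> VV \<delta>} e p"
        using emb_sat[where e = e, OF i(1)] e unfolding ie j_VV[OF dm] by blast
    qed
    then show ?case unfolding corr_def agree_def using ne transitive_VV[OF o] by blast
  qed
  then show ?thesis by simp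
qed

text \<open>The embedding \<open>j\<close> restricted to \<open>V\<^sub>\<nu>\<close> witnesses, inside \<open>V\<^sub>\<theta>\<close>, an instance of supercompactness of \<open>j \<delta>\<close>; all but
  the correctness of \<open>\<theta>'\<close> is a \<open>\<Pi>\<^sub>1\<close> matter, and that is expressed by satisfaction in \<open>V\<^sub>j\<^sub>\<delta>\<close>.\<close>

lemma extendible_supercompact:
  assumes ext: "C_extendible (Suc m) \<delta>" and o: "Ord \<delta>"
  shows "Sigma_supercompact (Suc (Suc m)) \<delta>"
  unfolding Sigma_supercompact_def
proof (intro allI impI, elim conjE)
  fix \<nu> assume dl: "\<delta> \<^bold>\<in> \<nu>" and Cl: "C (Suc (Suc m)) \<nu>"
  have ol: "Ord \<nu>" using C_Ord Cl .
  show "supercompact_at (Suc (Suc m)) \<nu> \<delta>"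
    unfolding supercompact_at_iff[OF ol]
  proof (intro allI impI)
    fix a assume a: "a \<^bold>\<in> VV \<nu>"
    obtain \<mu> \<theta> j where m: "C (Suc (Suc m)) \<mu>" "\<nu> \<^bold>\<in> VV \<mu>" and j: "emb mem j \<mu> \<theta>" "crit j (VV \<mu>) \<delta>"
      "\<mu> \<^bold>\<in> ap j \<delta>" "C (Suc m) (ap j \<delta>)" using extendible_emb[OF ext o, of \<nu>] by blast
    interpret emb mem j \<mu> \<theta> by (rule j(1))
    have om: "Ord \<mu>" by (rule corr_source)
    have lm: "\<nu> \<^bold>\<in> \<mu>" using m(2) Ord_mem_VV[OF om ol] by simp
    have dm: "\<delta> \<^bold>\<in> \<mu>" using Ord_trans[OF om dl lm] .
    have src: "\<delta> \<^bold>\<in> VV \<mu>" "VV \<delta> \<^bold>\<in> VV \<mu>" "VV \<nu> \<^bold>\<in> VV \<mu>" "a \<^bold>\<in> VV \<mu>"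
      using j(2) VV_mem[OF om dm] VV_mem[OF om lm] VV_mono[OF om lm a] by (simp_all add: crit_def)
    let ?\<kappa> = "ap j \<delta>"
    have ok: "Ord ?\<kappa>" using C_Ord j(4) .
    have kt: "?\<kappa> \<^bold>\<in> \<theta>" using j_maps[OF src(1)] Ord_mem_VV[OF target ok] by simp
    have mt: "\<mu> \<^bold>\<in> \<theta>" using Ord_trans[OF target j(3) kt] .
    have up: "x \<^bold>\<in> VV \<theta>" if "x \<^bold>\<in> VV \<mu>" for x using VV_mono[OF target mt that] .
    have corr_k: "corr (Suc m) (VV ?\<kappa>)" using j(4) by (simp add: C_corr)
    obtain i where i: "elem_emb i (VV \<nu>) (ap j (VV \<nu>))" "\<And>x. x \<^bold>\<in> VV \<nu> \<Longrightarrow> ap i x = ap j x"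
      using restriction[OF src(3)] by blast
    have dV: "\<delta> \<^bold>\<in> VV \<nu>" using Ord_mem_VV[OF ol o] dl by simp
    have it: "i \<^bold>\<in> VV \<theta>"
      by (rule Lim_fun[OF Lim_target(1) up[OF src(3)] j_maps[OF src(3)]]) (use i(1) in \<open>simp add: elem_emb_def\<close>)
    \<comment> \<open>A fixed formula for being some V_\<alpha> with \<alpha> in
      \<open>C (Suc (Suc m))\<close>, to be evaluated inside V_(j \<delta>).\<close>
    obtain q where q: "Pi_fm (Suc (Suc m)) q" "\<And>e. sat UNIV e q \<longleftrightarrow> Q (Suc (Suc m)) (e 0)"
      using Pg_formula[OF Pg_Q] by blast
    obtain k where k: "\<forall>i\<in>vars q. i < k" using vars_bound by metis
    have lk: "\<nu> \<^bold>\<in> ?\<kappa>" using Ord_trans[OF ok lm j(3)] .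
    have lk': "VV \<nu> \<^bold>\<in> VV ?\<kappa>" using VV_mem[OF ok lk] .
    \<comment> \<open>A constant assignment; the meaning of \<open>q\<close> depends on variable 0
      alone.\<close>
    obtain s where s: "maps s omega (VV ?\<kappa>)" "ap s zero = VV \<nu>"
      using const_maps[OF lk'] const_ap[OF zero_omega] by blast
    have st: "s \<^bold>\<in> VV \<theta>"
      by (rule Lim_fun[OF Lim_target(1) _ _ s(1)]) (use up omega_source VV_mem[OF target kt] in blast)+
    have sat_s: "SatR (VV ?\<kappa>) (code q) s"
      unfolding SatR_sat[OF s(1)]
    proof (rule agree_down_Pi[OF _ q(1)])
      show "agree (Suc m) {x. x \<^bold>\<in> VV ?\<kappa>} UNIV" using corr_k by (simp add: corr_def)
      show "ap s (num i) \<in> {x. x \<^bold>\<in> VV ?\<kappa>}" for i using s(1) num_omega unfolding maps_ap by blast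
      show "sat UNIV (\<lambda>i. ap s (num i)) q" using Cl q(2) s(2) C_Q by simp
    qed
    \<comment> \<open>All witnesses are collected in one set \<open>x\<close> to keep the
      quantifiers over them bounded. The environment holds \<delta>, V_\<delta>, V_\<nu>,
      \<open>a\<close> and the code of \<open>q\<close> in positions 0 to 4, or their images under
      \<open>j\<close>.\<close>
    define P where "P x e \<longleftrightarrow> (\<exists>d. d \<^bold>\<in> x \<and> (\<exists>t. t \<^bold>\<in> x \<and> (\<exists>a'. a' \<^bold>\<in> x \<and> (\<exists>i. i \<^bold>\<in> x \<and> (\<exists>A'. A' \<^bold>\<in> x \<and> (\<exists>s. s \<^bold>\<in> x \<and>
      ((Ord d \<and> Ord t \<and> d \<^bold>\<in> t \<and> t \<^bold>\<in> e 0 \<and> a' \<^bold>\<in> A' \<and> crit i A' d \<and> ap i d = e 0 \<and> ap i a' = e 3 \<and>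
        maps s omega (e 1) \<and> ap s zero = A' \<and> SatR (e 1) (e 4) s) \<and> A' = VV t \<and> elem_emb i A' (e 2))))))))"
      for x and e :: "nat \<Rightarrow> 'a"
    have KP: "inK (Pg (Suc 0)) (\<lambda>e. P (e 0) (\<lambda>i. e (Suc i)))"
      unfolding P_def
      by (intro C_bex C_conj[OF closed_Pg[OF closed_Sg]] closed_Pg closed_Sg Pg_VV_graph Pg_elem_emb; rule Dl_Pg; intro defn)
    let ?e = "case_nat \<delta> (case_nat (VV \<delta>) (case_nat (VV \<nu>) (case_nat a (\<lambda>_. code q))))"
    have e: "?e i \<^bold>\<in> VV \<mu>" for i using src Codes_source by (auto split: nat.split)
    have je: "(\<lambda>i. ap j (?e i)) = case_nat ?\<kappa> (case_nat (VV ?\<kappa>) (case_nat (ap j (VV \<nu>)) (case_nat (ap j a) (\<lambda>_. code q))))"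
      using j_VV[OF dm] j_code[OF code_Codes] by (intro HOL.ext) (auto split: nat.split)
    \<comment> \<open>A nested pair below the limit \<theta> yields one V_\<xi> in V_\<theta> that
      contains all six witnesses.\<close>
    have "opair \<delta> (opair \<nu> (opair a (opair i (opair (VV \<nu>) s)))) \<^bold>\<in> VV \<theta>"
      by (intro Lim_opair Lim_target up src m it st)
    then obtain \<xi> where x: "\<xi> \<^bold>\<in> \<theta>" "opair \<delta> (opair \<nu> (opair a (opair i (opair (VV \<nu>) s)))) \<^bold>\<in> VV \<xi>"
      using Lim_VV[OF Lim_target(1)] by blast
    have "transitive (VV \<xi>)" using transitive_VV Ord_mem[OF target x(1)] .
    then have mems: "\<delta> \<^bold>\<in> VV \<xi>" "\<nu> \<^bold>\<in> VV \<xi>" "a \<^bold>\<in> VV \<xi>" "i \<^bold>\<in> VV \<xi>" "VV \<nu> \<^bold>\<in> VV \<xi>" "s \<^bold>\<in> VV \<xi>"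
      using x(2) opair_transitive by blast+
    have cr: "crit i (VV \<nu>) \<delta>"
      using j(2) i(2) dV VV_trans[OF ol dV] unfolding crit_def by simp
    have "P (VV \<xi>) (\<lambda>i. ap j (?e i))"
      unfolding je P_def
      by (rule exI[of _ \<delta>], rule conjI, rule mems, rule exI[of _ \<nu>], rule conjI, rule mems,
          rule exI[of _ a], rule conjI, rule mems, rule exI[of _ i], rule conjI, rule mems,
          rule exI[of _ "VV \<nu>"], rule conjI, rule mems, rule exI[of _ s], rule conjI, rule mems)
        (use o ol dl lk a cr i(2)[OF dV] i(2)[OF a] s sat_s i(1) in \<open>simp add: eval_nat_numeral\<close>)
    from pull_back[where e = ?e, OF KP e VV_mem[OF target x(1)] this] obtain x where "P x ?e" by blast
    then obtain d t a' i' A' s' where w: "Ord d" "Ord t" "d \<^bold>\<in> t" "t \<^bold>\<in> \<delta>" "a' \<^bold>\<in> A'" "crit i' A' d" "ap i' d = \<delta>"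
      "ap i' a' = a" "maps s' omega (VV \<delta>)" "ap s' zero = A'" "SatR (VV \<delta>) (code q) s'" "A' = VV t" "elem_emb i' A' (VV \<nu>)"
      unfolding P_def by (elim exE conjE) (rule that; simp add: eval_nat_numeral)
    \<comment> \<open>After the pull-back the correctness of \<open>t\<close> is asserted only by
      V_\<delta>. It is true because \<delta> itself is correct to this level.\<close>
    have "agree (Suc (Suc m)) {x. x \<^bold>\<in> VV \<delta>} UNIV" using extendible_corr[OF ext o] by (simp add: corr_def)
    moreover have "ap s' (num i) \<in> {x. x \<^bold>\<in> VV \<delta>}" for i using w(9) num_omega unfolding maps_ap by blast
    ultimately have "sat UNIV (\<lambda>i. ap s' (num i)) q"
      using agree_Pi[where s = "\<lambda>i. ap s' (num i)", OF _ q(1)] w(11) unfolding SatR_sat[OF w(9)] by blast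
    then have Ct: "C (Suc (Suc m)) t" using q(2) w(2,10,12) C_Q by simp
    show "\<exists>\<delta>' \<theta>' a' j. Ord \<delta>' \<and> Ord \<theta>' \<and> \<delta>' \<^bold>\<in> \<theta>' \<and> \<theta>' \<^bold>\<in> \<delta> \<and> a' \<^bold>\<in> VV \<theta>' \<and>
        elem_emb j (VV \<theta>') (VV \<nu>) \<and> crit j (VV \<theta>') \<delta>' \<and>
        ap j \<delta>' = \<delta> \<and> ap j a' = a \<and> C (Suc (Suc m)) \<theta>'"
      by (rule exI[of _ d], rule exI[of _ t], rule exI[of _ a'], rule exI[of _ i']) (use w Ct in simp)
  qed
qed

section \<open>From supercompactness to extendibility\<close>

lemma supercompact_emb:
  assumes "Sigma_supercompact n \<delta>" "1 \<le> n" "C n \<theta>" "\<delta> \<^bold>\<in> \<theta>" "a \<^bold>\<in> VV \<theta>"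
  shows "\<exists>\<delta>' \<theta>' a' j. emb mem j \<theta>' \<theta> \<and> \<delta>' \<^bold>\<in> \<theta>' \<and> \<theta>' \<^bold>\<in> \<delta> \<and> a' \<^bold>\<in> VV \<theta>' \<and> crit j (VV \<theta>') \<delta>' \<and>
        ap j \<delta>' = \<delta> \<and> ap j a' = a \<and> C n \<theta>'"
proof -
  have o: "Ord \<theta>" using C_Ord assms(3) .
  obtain \<delta>' \<theta>' a' j where j: "Ord \<delta>'" "Ord \<theta>'" "\<delta>' \<^bold>\<in> \<theta>'" "\<theta>' \<^bold>\<in> \<delta>" "a' \<^bold>\<in> VV \<theta>'"
        "elem_emb j (VV \<theta>') (VV \<theta>)" "crit j (VV \<theta>') \<delta>'" "ap j \<delta>' = \<delta>" "ap j a' = a" "C n \<theta>'"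
    using assms unfolding Sigma_supercompact_def using supercompact_at_iff[OF o] by blast
  moreover have "emb mem j \<theta>' \<theta>"
    by unfold_locales (use j o C_mono[OF j(10) assms(2)] in simp_all)
  ultimately show ?thesis by blast
qed

text \<open>Supercompactness is applied with the ordinal \<alpha> < \<delta> as the set to be
  captured. Its preimage lies below the critical point \<delta>', hence is fixed and equals
  \<alpha>, so that \<alpha> < \<delta>' < \<theta>'.\<close>

lemma supercompact_limit:
  assumes sc: "Sigma_supercompact (Suc n) \<delta>" and o: "Ord \<delta>"
  shows "\<exists>\<theta>. \<theta> \<^bold>\<in> \<delta> \<and> C (Suc n) \<theta> \<and> (\<alpha> \<^bold>\<in> \<delta> \<longrightarrow> \<alpha> \<^bold>\<in> \<theta>)"
proof -
  obtain \<theta> where t: "C (Suc n) \<theta>" "\<delta> \<^bold>\<in> VV \<theta>" using C_unbounded by blast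
  have ot: "Ord \<theta>" using C_Ord t(1) .
  have dt: "\<delta> \<^bold>\<in> \<theta>" using t o ot Ord_mem_VV by blast
  \<comment> \<open>When \<alpha> is not below \<delta> nothing about it is claimed, and \<delta>
    serves as a default in V_\<theta>.\<close>
  define \<beta> where "\<beta> = (if \<alpha> \<^bold>\<in> \<delta> then \<alpha> else \<delta>)"
  have "\<beta> \<^bold>\<in> VV \<theta>" using t VV_trans[OF ot t(2)] by (simp add: \<beta>_def)
  from supercompact_emb[OF sc _ t(1) dt this] obtain \<delta>' \<theta>' a' j where
    j: "emb mem j \<theta>' \<theta>" "\<delta>' \<^bold>\<in> \<theta>'" "\<theta>' \<^bold>\<in> \<delta>" "a' \<^bold>\<in> VV \<theta>'" "crit j (VV \<theta>') \<delta>'"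
    "ap j \<delta>' = \<delta>" "ap j a' = \<beta>" "C (Suc n) \<theta>'" by auto
  interpret emb mem j \<theta>' \<theta> by (rule j(1))
  have "\<alpha> \<^bold>\<in> \<theta>'" if a: "\<alpha> \<^bold>\<in> \<delta>"
  proof -
    have dV: "\<delta>' \<^bold>\<in> VV \<theta>'" using j(5) by (simp add: crit_def)
    have "a' \<^bold>\<in> \<delta>'" using j_mem[OF j(4) dV] a j(6,7) by (simp add: \<beta>_def)
    then have "a' = \<alpha>" using j(5,7) a by (simp add: crit_def \<beta>_def)
    then show ?thesis using \<open>a' \<^bold>\<in> \<delta>'\<close> j(2) Ord_trans[OF corr_source(2)] by blast
  qed
  then show ?thesis using j(3,8) by blast
qed

lemma supercompact_corr:
  assumes sc: "Sigma_supercompact (Suc n) \<delta>" and o: "Ord \<delta>" shows "C (Suc n) \<delta>"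
proof -
  note lim = supercompact_limit[OF sc o]
  have lw: "Lim \<theta> \<and> omega \<^bold>\<in> \<theta>" if "C (Suc n) \<theta>" for \<theta>
    using corr_limM[of n "VV \<theta>" \<theta>] that unfolding C_corr limM_VV by (metis VV_inject Lim_Ord)
  obtain \<theta> where t: "\<theta> \<^bold>\<in> \<delta>" "C (Suc n) \<theta>" using lim by blast
  have om: "omega \<^bold>\<in> \<delta>" using lw[OF t(2)] Ord_trans[OF o _ t(1)] by blast
  have "succ \<beta> \<^bold>\<in> \<delta>" if b: "\<beta> \<^bold>\<in> \<delta>" for \<beta>
  proof -
    obtain \<theta> where "\<theta> \<^bold>\<in> \<delta>" "C (Suc n) \<theta>" "\<beta> \<^bold>\<in> \<theta>" using lim[of \<beta>] b by blast
    then show ?thesis using lw Lim_succ Ord_trans[OF o] by blast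
  qed
  then have L: "Lim \<delta>" unfolding Lim_def using o Ord_trans[OF o zero_omega om] by blast
  have "corr (Suc n) (VV \<delta>)"
  proof (rule limit_corr)
    show "limM (VV \<delta>)" unfolding limM_VV using L om by blast
    fix x assume "x \<^bold>\<in> VV \<delta>"
    then obtain \<beta> where b: "\<beta> \<^bold>\<in> \<delta>" "x \<^bold>\<in> VV \<beta>" using Lim_VV[OF L] by blast
    obtain \<theta> where t: "\<theta> \<^bold>\<in> \<delta>" "C (Suc n) \<theta>" "\<beta> \<^bold>\<in> \<theta>" using lim[of \<beta>] b by blast
    then have "x \<^bold>\<in> VV \<theta>" using VV_mono b(2) C_Ord by blast
    then show "\<exists>N. N \<^bold>\<in> VV \<delta> \<and> corr (Suc n) N \<and> x \<^bold>\<in> N"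
      using t VV_mem[OF o t(1)] C_corr by blast
  qed
  then show ?thesis using o by (simp add: C_corr)
qed

lemma supercompact_extendible:
  assumes sc: "Sigma_supercompact (Suc (Suc m)) \<delta>" and o: "Ord \<delta>" shows "C_extendible (Suc m) \<delta>"
  unfolding C_extendible_iff
proof (intro allI impI, elim conjE)
  fix \<alpha> assume oa: "Ord \<alpha>" and da: "\<delta> \<^bold>\<in> \<alpha>"
  obtain \<theta> where t: "C (Suc (Suc m)) \<theta>" "\<alpha> \<^bold>\<in> VV \<theta>" using C_unbounded by blast
  have ot: "Ord \<theta>" using C_Ord t(1) .
  have at: "\<alpha> \<^bold>\<in> \<theta>" using t oa ot Ord_mem_VV by blast
  have dt: "\<delta> \<^bold>\<in> \<theta>" using Ord_trans[OF ot da at] .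
  from supercompact_emb[OF sc _ t(1) dt t(2)] obtain \<delta>' \<theta>' \<alpha>' j where
    j: "emb mem j \<theta>' \<theta>" "\<delta>' \<^bold>\<in> \<theta>'" "\<theta>' \<^bold>\<in> \<delta>" "\<alpha>' \<^bold>\<in> VV \<theta>'" "crit j (VV \<theta>') \<delta>'"
    "ap j \<delta>' = \<delta>" "ap j \<alpha>' = \<alpha>" "C (Suc (Suc m)) \<theta>'" by auto
  interpret emb mem j \<theta>' \<theta> by (rule j(1))
  have oa': "Ord \<alpha>'" using j_Ord[OF j(4)] oa j(7) by simp
  have at': "\<alpha>' \<^bold>\<in> \<theta>'" using j(4) oa' Ord_mem_VV[OF corr_source(2)] by blast
  have dV: "\<delta>' \<^bold>\<in> VV \<theta>'" using j(5) by (simp add: crit_def)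
  have da': "\<delta>' \<^bold>\<in> \<alpha>'" using j_mem[OF dV j(4)] da j(6,7) by simp
  have od': "Ord \<delta>'" using Ord_mem[OF oa' da'] .
  \<comment> \<open>Extendibility of \<open>d\<close> at the single ordinal \<open>l\<close>, with
    membership in \<open>C (Suc m)\<close> replaced by its definable form.\<close>
  let ?R = "\<lambda>d l. \<exists>\<mu> i. Ord \<mu> \<and> elem_emb i (VV l) (VV \<mu>) \<and> crit i (VV l) d \<and> l \<^bold>\<in> ap i d \<and>
    Ord (ap i d) \<and> Q (Suc m) (VV (ap i d))"
  obtain i where i: "elem_emb i (VV \<alpha>') (ap j (VV \<alpha>'))" "\<And>x. x \<^bold>\<in> VV \<alpha>' \<Longrightarrow> ap i x = ap j x"
    using restriction[OF VV_mem[OF corr_source(2) at']] by blast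
  have dA: "\<delta>' \<^bold>\<in> VV \<alpha>'" using Ord_mem_VV[OF oa' od'] da' by simp
  have id: "ap i \<delta>' = \<delta>" using i(2)[OF dA] j(6) by simp
  have cr: "crit i (VV \<alpha>') \<delta>'"
    using j(5) i(2) dA VV_trans[OF oa' dA] unfolding crit_def by simp
  have ad: "\<alpha>' \<^bold>\<in> \<delta>" using Ord_trans[OF o at' j(3)] .
  \<comment> \<open>The critical point \<delta>' is sent to \<delta>, so the class condition on its
    image concerns \<delta> itself; the target ordinal for this instance is \<alpha>.\<close>
  have Cd: "C (Suc m) \<delta>" using C_mono[OF supercompact_corr[OF sc o]] by simp
  have R: "?R \<delta>' \<alpha>'"
    by (rule exI[of _ \<alpha>], rule exI[of _ i])
      (use i(1) j_VV[OF at'] j(7) oa o id cr ad Cd C_Q in simp)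
  have K: "inK (Sg (Suc (Suc m))) (\<lambda>e. ?R (e 0) (e 1))"
    by (intro Sg_ex; rule Dl_Sg; intro defn K_app1[OF good_Dl K_Q])
  have "case_nat \<delta>' (\<lambda>_. \<alpha>') i \<^bold>\<in> VV \<theta>'" for i using dV j(4) by (cases i) auto
  \<comment> \<open>This is where the choice of \<theta>' in \<open>C (Suc (Suc m))\<close> is used:
    a Sigma_(m+2) statement true of \<delta>' and \<alpha>' has to be seen by V_\<theta>' before it
    can be moved.\<close>
  moreover have "corr (Suc (Suc m)) (VV \<theta>')" "corr (Suc m) (VV \<theta>)"
    using j(8) C_mono[OF t(1), of "Suc m"] by (simp_all add: C_corr)
  ultimately have "?R \<delta> \<alpha>"
    using emb_Sg[OF emb _ _ K, of "case_nat \<delta>' (\<lambda>_. \<alpha>')"] R j(6,7) by simp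
  then show "\<exists>\<theta> j. Ord \<theta> \<and> elem_emb j (VV \<alpha>) (VV \<theta>) \<and> crit j (VV \<alpha>) \<delta> \<and> \<alpha> \<^bold>\<in> ap j \<delta> \<and> C (Suc m) (ap j \<delta>)"
    unfolding C_Q by blast
qed

end

theorem theorem2p3:
  fixes E :: "'a \<Rightarrow> 'a \<Rightarrow> bool" and n :: nat and \<delta> :: 'a
  assumes "set_structure.ZFC E"
    and "n \<ge> 1"
    and "set_structure.Card E \<delta>"
  shows "set_structure.C_extendible E n \<delta> \<longleftrightarrow> set_structure.Sigma_supercompact E (n + 1) \<delta>"
proof -
  interpret zfc E by unfold_locales (rule assms(1))
  obtain m where n: "n = Suc m" using assms(2) by (cases n) auto
  have "Ord \<delta>" using assms(3) by (simp add: Card_def)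
  then show ?thesis
    using extendible_supercompact supercompact_extendible unfolding n by auto
qed

end
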